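(* Let $(X^{n+1},g_+)$ be a Riemannian manifold with $\mathrm{Ric}(g_+)=-ng_+$. Then for any $k\in\mathbb N$ and any $m\in(1-n,\infty)$, the weighted GJMS operator $L_{2k,\phi}^m$ of the smooth metric measure space $(X^{n+1},g_+,1^m\mathrm{dvol},m-1)$ satisfies $$L_{2k,\phi}^m=\prod_{j=1}^k\left(-\Delta_{g_+}-\frac{(n-m+2k-4j+3)(m+n-2k+4j-3)}4\right).$$
   Context: For a metric $g$ on an $(n+1)$-dimensional manifold $X$, a positive function $v$ and $m\in\mathbb R$, the smooth metric measure space $(X^{n+1},g,v^m\mathrm{dvol}_g,m-1)$ has $\phi$ defined by $v^m=e^{-\phi}$ and $\Delta_\phi=\Delta-\langle\nabla\phi,\nabla\cdot\rangle$; "$1^m$" means $v\equiv1$ (so $\phi=0$ and $\Delta_\phi=\Delta$). The weighted GJMS operator $L_{2k,\phi}^m$ is the linear differential operator on functions on $X$ with leading term $(-\Delta_\phi)^k$ obtained as follows: for positive integers $m$, apply the GJMS operator of order $2k$ (with leading term $(-\Delta)^k$) of the warped product $(X\times F^m,g\oplus v^2g_F)$, with $(F^m,g_F)$ the simply connected spaceform with $\mathrm{Ric}(g_F)=(m-1)g_F$ (the round unit sphere), to functions pulled back from $X$, and regard the result as a function on $X$; this is a universal expression in $g,v$ and $m$, which is extended to real $m$ by treating $m$ as a formal parameter. The GJMS operator of order $2k$ in dimension $N$ is $2^k$ times the suitably normalized obstruction to formally extending a function $u_0$, given at $\rho=0$, $t=1$, to a function homogeneous of degree $-\frac N2+k$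 in $t$ that is harmonic for the ambient metric $\tilde g=2\rho\,dt^2+2t\,dt\,d\rho+t^2g_\rho$ (Fefferman–Graham); for the product $g_+\oplus g_F$ the ambient metric is given by $g_\rho=(1-\frac\rho2)^2g_++(1+\frac\rho2)^2g_F$, and it is used for every $k$. For $k=1$ this gives $L_{2,\phi}^m=-\Delta_\phi+\frac{m+n-1}2J_\phi^m$ with $J_\phi^m=\frac1{2(m+n)}\big(R-2mv^{-1}\Delta v-m(m-1)v^{-2}(|\nabla v|^2-1)\big)$. *)

theory Defs
  imports "HOL-Analysis.Analysis"
begin

section \<open>Manifolds with a metric, in local coordinates\<close>

text \<open>
  A \<open>d\<close>-dimensional manifold carries an atlas indexed by \<open>chart_index\<close>.  Coordinates are sequences
  \<open>nat \<Rightarrow> real\<close> vanishing from position \<open>d\<close> on, i.e. points of \<^const>\<open>Euclidean_space\<close>; the dimension is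
  a number rather than a type because it varies with the sphere dimension below.
  \<open>gcomp M i a b\<close> is the component \<open>g\<^sub>a\<^sub>b\<close> of the metric in the chart \<open>i\<close>, as a function of the point;
  only \<open>a, b < d\<close> matter.  The record itself assumes nothing about the signature, so that it also serves for
  the ambient (Lorentzian) metric.
\<close>

record ('a, 'i) mfd =
  mtop :: "'a topology"
  mdim :: nat
  chart_index :: "'i set"
  chart_dom :: "'i \<Rightarrow> 'a set"
  coord :: "'i \<Rightarrow> 'a \<Rightarrow> nat \<Rightarrow> real"
  gcomp :: "'i \<Rightarrow> nat \<Rightarrow> nat \<Rightarrow> 'a \<Rightarrow> real"

definition coord_line :: "('a, 'i) mfd \<Rightarrow> 'i \<Rightarrow> nat \<Rightarrow> 'a \<Rightarrow> real \<Rightarrow> 'a" where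
  "coord_line M i a p s = inv_into (chart_dom M i) (coord M i) ((coord M i p)(a := s))"

definition pd :: "('a, 'i) mfd \<Rightarrow> 'i \<Rightarrow> nat \<Rightarrow> ('a \<Rightarrow> real) \<Rightarrow> 'a \<Rightarrow> real" where
  "pd M i a f p = deriv (\<lambda>s. f (coord_line M i a p s)) (coord M i p a)"

text \<open>
  \<open>A\<close> is meant to be an open subset of the chart domain.  A function is \<open>C\<^sup>\<infinity>\<close> iff all its iterated partial
  derivatives exist and are continuous.
\<close>

definition smooth_in :: "('a, 'i) mfd \<Rightarrow> 'i \<Rightarrow> 'a set \<Rightarrow> ('a \<Rightarrow> real) \<Rightarrow> bool" where
  "smooth_in M i A f \<longleftrightarrow>
    (\<forall>as. set as \<subseteq> {..<mdim M} \<longrightarrow>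
       continuous_map (subtopology (mtop M) A) euclideanreal (foldr (pd M i) as f) \<and>
       (\<forall>p\<in>A. \<forall>a<mdim M.
          (\<lambda>s. foldr (pd M i) as f (coord_line M i a p s)) differentiable (at (coord M i p a))))"

definition smooth_fun :: "('a, 'i) mfd \<Rightarrow> ('a \<Rightarrow> real) \<Rightarrow> bool" where
  "smooth_fun M f \<longleftrightarrow> (\<forall>i\<in>chart_index M. smooth_in M i (chart_dom M i) f)"

definition riemannian_manifold :: "('a, 'i) mfd \<Rightarrow> bool" where
  "riemannian_manifold M \<longleftrightarrow>
    Hausdorff_space (mtop M) \<and> second_countable (mtop M) \<and>
    (\<Union>i\<in>chart_index M. chart_dom M i) = topspace (mtop M) \<and>
    (\<forall>i\<in>chart_index M.
       openin (mtop M) (chart_dom M i) \<and>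
       openin (Euclidean_space (mdim M)) (coord M i ` chart_dom M i) \<and>
       homeomorphic_map (subtopology (mtop M) (chart_dom M i))
         (subtopology (Euclidean_space (mdim M)) (coord M i ` chart_dom M i)) (coord M i)) \<and>
    (\<forall>i\<in>chart_index M. \<forall>j\<in>chart_index M. \<forall>a<mdim M.
       smooth_in M i (chart_dom M i \<inter> chart_dom M j) (\<lambda>p. coord M j p a)) \<and>
    (\<forall>i\<in>chart_index M. \<forall>a<mdim M. \<forall>b<mdim M. smooth_in M i (chart_dom M i) (gcomp M i a b)) \<and>
    (\<forall>i\<in>chart_index M. \<forall>p\<in>chart_dom M i.
       (\<forall>a<mdim M. \<forall>b<mdim M. gcomp M i a b p = gcomp M i b a p) \<and>
       (\<forall>v. (\<exists>a<mdim M. v a \<noteq> 0) \<longrightarrow>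
          0 < (\<Sum>a<mdim M. \<Sum>b<mdim M. gcomp M i a b p * v a * v b))) \<and>
    (\<forall>i\<in>chart_index M. \<forall>j\<in>chart_index M. \<forall>p\<in>chart_dom M i \<inter> chart_dom M j.
       \<forall>a<mdim M. \<forall>b<mdim M.
         gcomp M i a b p =
           (\<Sum>c<mdim M. \<Sum>e<mdim M. gcomp M j c e p *
              pd M i a (\<lambda>q. coord M j q c) p * pd M i b (\<lambda>q. coord M j q e) p))"

definition matrix_inverse :: "nat \<Rightarrow> (nat \<Rightarrow> nat \<Rightarrow> real) \<Rightarrow> nat \<Rightarrow> nat \<Rightarrow> real" where
  "matrix_inverse d A = (THE B.
     (\<forall>a b. a \<ge> d \<or> b \<ge> d \<longrightarrow> B a b = 0) \<and>
     (\<forall>a<d. \<forall>b<d. (\<Sum>c<d. A a c * B c b) = (if a = b then 1 else 0) \<and>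
                   (\<Sum>c<d. B a c * A c b) = (if a = b then 1 else 0)))"

definition ginv :: "('a, 'i) mfd \<Rightarrow> 'i \<Rightarrow> nat \<Rightarrow> nat \<Rightarrow> 'a \<Rightarrow> real" where
  "ginv M i a b p = matrix_inverse (mdim M) (\<lambda>c e. gcomp M i c e p) a b"

text \<open>\<open>christoffel M i c a b\<close> is \<open>\<Gamma>\<^sup>c\<^sub>a\<^sub>b\<close>.\<close>

definition christoffel :: "('a, 'i) mfd \<Rightarrow> 'i \<Rightarrow> nat \<Rightarrow> nat \<Rightarrow> nat \<Rightarrow> 'a \<Rightarrow> real" where
  "christoffel M i c a b p = (\<Sum>e<mdim M. ginv M i c e p *
     (pd M i a (gcomp M i b e) p + pd M i b (gcomp M i a e) p - pd M i e (gcomp M i a b) p)) / 2"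

text \<open>The sign is the one for which round spheres have positive Ricci curvature.\<close>

definition ricci :: "('a, 'i) mfd \<Rightarrow> 'i \<Rightarrow> nat \<Rightarrow> nat \<Rightarrow> 'a \<Rightarrow> real" where
  "ricci M i a b p =
     (\<Sum>c<mdim M. pd M i c (christoffel M i c a b) p - pd M i b (christoffel M i c a c) p) +
     (\<Sum>c<mdim M. \<Sum>e<mdim M.
        christoffel M i c c e p * christoffel M i e a b p -
        christoffel M i c b e p * christoffel M i e a c p)"

text \<open>\<open>\<Delta>f = g\<^sup>a\<^sup>b \<nabla>\<^sub>a\<nabla>\<^sub>b f\<close>, a nonpositive operator for Riemannian metrics.\<close>

definition laplacian_in :: "('a, 'i) mfd \<Rightarrow> 'i \<Rightarrow> ('a \<Rightarrow> real) \<Rightarrow> 'a \<Rightarrow> real" where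
  "laplacian_in M i f p = (\<Sum>a<mdim M. \<Sum>b<mdim M. ginv M i a b p *
     (pd M i a (pd M i b f) p - (\<Sum>c<mdim M. christoffel M i c a b p * pd M i c f p)))"

text \<open>The value does not depend on the chart, so any chart around \<open>p\<close> may be used.\<close>

definition laplacian :: "('a, 'i) mfd \<Rightarrow> ('a \<Rightarrow> real) \<Rightarrow> 'a \<Rightarrow> real" where
  "laplacian M f p = laplacian_in M (SOME i. i \<in> chart_index M \<and> p \<in> chart_dom M i) f p"


section \<open>Round spheres and products\<close>

text \<open>
  The unit sphere in \<open>\<real>\<^sup>l\<^sup>+\<^sup>1\<close> with its two stereographic charts: the index is \<open>True\<close> for projection from the
  pole \<open>x\<^sub>l = 1\<close> and \<open>False\<close> for projection from \<open>x\<^sub>l = -1\<close>.  In the stereographic coordinate \<open>y\<close> the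
  round metric is \<open>4 |dy|\<^sup>2 / (1 + |y|\<^sup>2)\<^sup>2\<close>.  For \<open>l = 1\<close> this is the circle instead of its universal cover,
  the line; they are locally isometric, and the sphere is only used for local differential operators.
\<close>

definition pole_sign :: "bool \<Rightarrow> real" where
  "pole_sign N = (if N then 1 else - 1)"

definition stereographic :: "nat \<Rightarrow> bool \<Rightarrow> (nat \<Rightarrow> real) \<Rightarrow> nat \<Rightarrow> real" where
  "stereographic l N x = (\<lambda>a. if a < l then x a / (1 - pole_sign N * x l) else 0)"

definition round_sphere :: "nat \<Rightarrow> (nat \<Rightarrow> real, bool) mfd" where
  "round_sphere l =
    \<lparr> mtop = nsphere l,
      mdim = l,
      chart_index = UNIV,
      chart_dom = (\<lambda>N. {x \<in> topspace (nsphere l). x l \<noteq> pole_sign N}),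
      coord = stereographic l,
      gcomp = (\<lambda>N a b x. if a = b then 4 / (1 + (\<Sum>c<l. (stereographic l N x c)\<^sup>2))\<^sup>2 else 0) \<rparr>"

text \<open>Components of \<open>\<alpha> g\<^sub>X \<oplus> \<beta> g\<^sub>F\<close>, where \<open>\<alpha>\<close> and \<open>\<beta>\<close> are functions on \<open>X\<close>.\<close>

definition block_metric ::
  "('a, 'i) mfd \<Rightarrow> ('b, 'j) mfd \<Rightarrow> ('a \<Rightarrow> real) \<Rightarrow> ('a \<Rightarrow> real) \<Rightarrow>
   'i \<times> 'j \<Rightarrow> nat \<Rightarrow> nat \<Rightarrow> 'a \<times> 'b \<Rightarrow> real" where
  "block_metric X F \<alpha> \<beta> = (\<lambda>(i, j) a b (x, z).
     if a < mdim X \<and> b < mdim X then \<alpha> x * gcomp X i a b x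
     else if mdim X \<le> a \<and> mdim X \<le> b then \<beta> x * gcomp F j (a - mdim X) (b - mdim X) z
     else 0)"

text \<open>The warped product \<open>(X \<times> F, g\<^sub>X \<oplus> v\<^sup>2 g\<^sub>F)\<close>.\<close>

definition warped_product ::
  "('a, 'i) mfd \<Rightarrow> ('a \<Rightarrow> real) \<Rightarrow> ('b, 'j) mfd \<Rightarrow> ('a \<times> 'b, 'i \<times> 'j) mfd" where
  "warped_product X v F =
    \<lparr> mtop = prod_topology (mtop X) (mtop F),
      mdim = mdim X + mdim F,
      chart_index = chart_index X \<times> chart_index F,
      chart_dom = (\<lambda>(i, j). chart_dom X i \<times> chart_dom F j),
      coord = (\<lambda>(i, j) (x, z) a. if a < mdim X then coord X i x a else coord F j z (a - mdim X)),
      gcomp = block_metric X F (\<lambda>_. 1) (\<lambda>x. (v x)\<^sup>2) \<rparr>"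


section \<open>GJMS operators\<close>

text \<open>
  The ambient space of \<open>M\<close> with \<open>g~ = 2\<rho> dt\<^sup>2 + 2t dt d\<rho> + t\<^sup>2 g\<^sub>\<rho>\<close>, where \<open>gr \<rho>\<close> gives the components of
  \<open>g\<^sub>\<rho>\<close> in the charts of \<open>M\<close>.  The coordinates are ordered as \<open>(t, \<rho>, coordinates of M)\<close>.  Only the germ at
  \<open>\<rho> = 0\<close> matters; the interval \<open>|\<rho>| < 2\<close> is the one on which \<open>product_ambient\<close> below is nondegenerate.
\<close>

definition ambient_space ::
  "('a, 'i) mfd \<Rightarrow> (real \<Rightarrow> 'i \<Rightarrow> nat \<Rightarrow> nat \<Rightarrow> 'a \<Rightarrow> real) \<Rightarrow> (real \<times> real \<times> 'a, 'i) mfd" where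
  "ambient_space M gr =
    \<lparr> mtop = prod_topology (top_of_set {0<..}) (prod_topology (top_of_set {-2<..<2}) (mtop M)),
      mdim = mdim M + 2,
      chart_index = chart_index M,
      chart_dom = (\<lambda>i. {0<..} \<times> {-2<..<2} \<times> chart_dom M i),
      coord = (\<lambda>i (t, \<rho>, p). case_nat t (case_nat \<rho> (coord M i p))),
      gcomp = (\<lambda>i a b (t, \<rho>, p).
        if a = 0 \<and> b = 0 then 2 * \<rho>
        else if a = 0 \<and> b = 1 \<or> a = 1 \<and> b = 0 then t
        else if 2 \<le> a \<and> 2 \<le> b then t\<^sup>2 * gr \<rho> i (a - 2) (b - 2) p
        else 0) \<rparr>"

text \<open>
  A formal power series \<open>\<Sum>\<^sub>j f\<^sub>j \<rho>\<^sup>j\<close> gives a formal function homogeneous of degree \<open>-N/2 + k\<close> in \<open>t\<close>,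
  \<open>N = dim M\<close>.  It is truncated after \<open>\<rho>\<^sup>k\<close>, which loses nothing here: the coefficients of \<open>\<rho>\<^sup>l\<close>, \<open>l < k\<close>,
  in its ambient Laplacian involve only \<open>f\<^sub>0, \<dots>, f\<^sub>k\<close>, because the coefficient of \<open>\<partial>\<^sub>\<rho>\<^sup>2\<close>
  in the Laplacian is \<open>-2\<rho>/t\<^sup>2\<close>.
\<close>

definition homogeneous_ext ::
  "('a, 'i) mfd \<Rightarrow> nat \<Rightarrow> (nat \<Rightarrow> 'a \<Rightarrow> real) \<Rightarrow> real \<times> real \<times> 'a \<Rightarrow> real" where
  "homogeneous_ext M k f = (\<lambda>(t, \<rho>, p).
     t powr (- real (mdim M) / 2 + real k) * (\<Sum>j\<le>k. f j p * \<rho> ^ j))"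

text \<open>The coefficient of \<open>\<rho>\<^sup>l\<close> in the ambient Laplacian at \<open>t = 1\<close>.\<close>

definition ambient_laplacian_coeff ::
  "('a, 'i) mfd \<Rightarrow> (real \<Rightarrow> 'i \<Rightarrow> nat \<Rightarrow> nat \<Rightarrow> 'a \<Rightarrow> real) \<Rightarrow> nat \<Rightarrow> (nat \<Rightarrow> 'a \<Rightarrow> real) \<Rightarrow>
   nat \<Rightarrow> 'a \<Rightarrow> real" where
  "ambient_laplacian_coeff M gr k f l p =
     (deriv ^^ l) (\<lambda>\<rho>. laplacian (ambient_space M gr) (homogeneous_ext M k f) (1, \<rho>, p)) 0 / fact l"

text \<open>
  \<open>f\<close> extends \<open>u\<close> harmonically as far as possible in general: the coefficient of \<open>\<rho>\<^sup>l\<close> contains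
  \<open>f\<^sub>l\<^sub>+\<^sub>1\<close> with the factor \<open>2 (l + 1) (k - 1 - l)\<close>, which vanishes first at \<open>l = k - 1\<close>.
\<close>

definition harmonic_ext ::
  "('a, 'i) mfd \<Rightarrow> (real \<Rightarrow> 'i \<Rightarrow> nat \<Rightarrow> nat \<Rightarrow> 'a \<Rightarrow> real) \<Rightarrow> nat \<Rightarrow> ('a \<Rightarrow> real) \<Rightarrow>
   (nat \<Rightarrow> 'a \<Rightarrow> real) \<Rightarrow> bool" where
  "harmonic_ext M gr k u f \<longleftrightarrow>
     (\<forall>j\<le>k. smooth_fun M (f j)) \<and> (\<forall>p\<in>topspace (mtop M). f 0 p = u p) \<and>
     (\<forall>l<k - 1. \<forall>p\<in>topspace (mtop M). ambient_laplacian_coeff M gr k f l p = 0)"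

text \<open>
  The GJMS operator of order \<open>2k\<close>, \<open>k \<ge> 1\<close>, of \<open>M\<close> with ambient metric given by \<open>gr\<close>: the coefficient of
  \<open>\<rho>\<^sup>k\<^sup>-\<^sup>1\<close> is the obstruction to harmonicity.  Since \<open>f\<^sub>l\<^sub>+\<^sub>1 = - \<Delta>f\<^sub>l / (2 (l + 1) (k - 1 - l)) + \<dots>\<close>
  for \<open>l < k - 1\<close>, that coefficient has leading term \<open>- (-\<Delta>)\<^sup>k u / (2\<^sup>k\<^sup>-\<^sup>1 ((k - 1)!)\<^sup>2)\<close>, and the
  normalization below makes the leading term of the operator \<open>(-\<Delta>)\<^sup>k\<close>.
\<close>

definition gjms ::
  "('a, 'i) mfd \<Rightarrow> (real \<Rightarrow> 'i \<Rightarrow> nat \<Rightarrow> nat \<Rightarrow> 'a \<Rightarrow> real) \<Rightarrow> nat \<Rightarrow> ('a \<Rightarrow> real) \<Rightarrow> 'a \<Rightarrow> real" where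
  "gjms M gr k u p = (THE y. \<exists>f. gr 0 = gcomp M \<and> harmonic_ext M gr k u f \<and>
     y = 2 ^ k * (- ((fact (k - 1))\<^sup>2 / 2) * ambient_laplacian_coeff M gr k f (k - 1) p))"


section \<open>Weighted GJMS operators\<close>

text \<open>
  The weighted GJMS operator of \<open>(X, g, v\<^sup>m dvol, m - 1)\<close>; \<open>G l\<close> is the family \<open>g\<^sub>\<rho>\<close> of the
  ambient metric of the warped product of \<open>X\<close> with the round \<open>l\<close>-sphere, for each \<open>l \<ge> 1\<close>.
  For integral \<open>m = l \<ge> 1\<close> the GJMS operator of the warped product is applied to a function pulled back from
  \<open>X\<close> and the result descends to \<open>X\<close>.  Being a universal expression it depends on \<open>l\<close> through a rational function
  \<open>P/Q\<close>, and treating \<open>m\<close> as a formal parameter means evaluating this function at \<open>m\<close>.  It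
  is unique because it is prescribed at infinitely many points.
\<close>

definition weighted_gjms ::
  "('a, 'i) mfd \<Rightarrow> ('a \<Rightarrow> real) \<Rightarrow>
   (nat \<Rightarrow> real \<Rightarrow> 'i \<times> bool \<Rightarrow> nat \<Rightarrow> nat \<Rightarrow> 'a \<times> (nat \<Rightarrow> real) \<Rightarrow> real) \<Rightarrow>
   nat \<Rightarrow> real \<Rightarrow> ('a \<Rightarrow> real) \<Rightarrow> 'a \<Rightarrow> real" where
  "weighted_gjms X v G k m u x = (THE y. \<exists>P Q :: real poly. poly Q m \<noteq> 0 \<and>
     (\<forall>l\<ge>1. poly Q (real l) \<noteq> 0 \<longrightarrow> (\<forall>z\<in>topspace (mtop (round_sphere l)).
        gjms (warped_product X v (round_sphere l)) (G l) k (\<lambda>(x', _). u x') (x, z) =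
          poly P (real l) / poly Q (real l))) \<and>
     y = poly P m / poly Q m)"

text \<open>
  The ambient metric of \<open>X \<times> S\<^sup>l\<close>, \<open>g\<^sub>\<rho> = (1 - \<rho>/2)\<^sup>2 g\<^sub>X \<oplus> (1 + \<rho>/2)\<^sup>2 g\<^sub>S\<close>.  It is Ricci flat
  precisely when \<open>Ric(g\<^sub>X) = - n g\<^sub>X\<close>, \<open>n + 1 = dim X\<close>, and so is the ambient metric in that case only.
\<close>

definition product_ambient ::
  "('a, 'i) mfd \<Rightarrow> nat \<Rightarrow> real \<Rightarrow> 'i \<times> bool \<Rightarrow> nat \<Rightarrow> nat \<Rightarrow> 'a \<times> (nat \<Rightarrow> real) \<Rightarrow> real" where
  "product_ambient X l \<rho> =
     block_metric X (round_sphere l) (\<lambda>_. (1 - \<rho> / 2)\<^sup>2) (\<lambda>_. (1 + \<rho> / 2)\<^sup>2)"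

end

theory Submission
  imports Defs
begin

text \<open>
  The ambient space of \<open>X \<times> S\<^sup>l\<close> is the product of the cones over \<open>X\<close> and \<open>S\<^sup>l\<close> with radial variables
  \<open>r = t (1 - \<rho>/2)\<close> and \<open>t (1 + \<rho>/2)\<close>.  Hence its Laplacian maps \<open>r\<^sup>w u\<close>, with \<open>u\<close> a function on \<open>X\<close>, to
  \<open>r\<^sup>w\<^sup>-\<^sup>2 (\<Delta> - w (w + n)) u\<close>, and its \<open>k\<close>-th power, applied to \<open>r\<^sup>w u\<close> with \<open>w = k - N/2\<close>, gives the asserted
  product.  By the commutator of the Laplacian with \<open>\<rho> t\<^sup>2\<close>, the value of that \<open>k\<close>-th power on the cone \<open>\<rho> = 0\<close>
  depends only on the value of its argument there, so that the harmonic extension of \<open>u\<close> may be used instead of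
  \<open>r\<^sup>w u\<close>; for it one gets a multiple of the obstruction.  Since all coefficients are polynomials in \<open>\<Delta>\<close>, this
  may be computed with formal power series in \<open>\<rho>\<close> in which \<open>\<Delta>\<close> is replaced by a real number.
\<close>

section \<open>Calculus in a chart\<close>

text \<open>The cones arise from \<open>2 \<rho> dt^2 + 2 t dt d\<rho> = dq^2 - dr^2\<close> with r
  = t (1 - \<rho>/2) and q = t (1 + \<rho>/2): the ambient metric is the sum of
  \<open>- dr^2 + r^2 g\<close> over X and \<open>dq^2 + q^2 g_S\<close> over the sphere. The
  function \<rho> t^2 is half the squared length of the Euler field, so its commutator with the
  Laplacian acts on homogeneous functions by a number, and the numbers collected over k Laplacians
  add up to zero exactly in degree k - N/2. Much of the analysis is forced by
  \<open>laplacian\<close>, which chooses a chart at each point separately, while the harmonic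
  extension contains iterated Laplacians of u. On X this requires chart independence, hence the
  chain rule and the symmetry of second derivatives, and smoothness of the Laplacian of a smooth
  function. On the sphere only constants get differentiated, and on the ambient space one chart
  serves all \<rho>, so there the explicit metrics suffice. Passing from numbers to operators is
  legitimate because an identity of polynomials may be checked at every real argument. Passing to
  real m works because, for fixed u and x, the value is polynomial in m and thus fixed by its values
  at positive integers.\<close>

definition has_pd :: "('a, 'i) mfd \<Rightarrow> 'i \<Rightarrow> nat \<Rightarrow> ('a \<Rightarrow> real) \<Rightarrow> 'a \<Rightarrow> real \<Rightarrow> bool" where
  "has_pd M i a f p D \<longleftrightarrow>
    ((\<lambda>s. f (coord_line M i a p s)) has_real_derivative D) (at (coord M i p a))"

text \<open>Openness of \<open>A\<close> along the coordinate lines only; this passes to products without any topology.\<close>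

definition line_open :: "('a, 'i) mfd \<Rightarrow> 'i \<Rightarrow> 'a set \<Rightarrow> bool" where
  "line_open M i A \<longleftrightarrow> A \<subseteq> chart_dom M i \<and> inj_on (coord M i) (chart_dom M i) \<and>
    (\<forall>p\<in>A. \<forall>a\<ge>mdim M. coord M i p a = 0) \<and>
    (\<forall>p\<in>A. \<forall>a<mdim M. \<forall>\<^sub>F s in nhds (coord M i p a). (coord M i p)(a := s) \<in> coord M i ` A)"

lemma has_pd_imp_pd: "has_pd M i a f p D \<Longrightarrow> pd M i a f p = D"
  by (simp add: has_pd_def pd_def DERIV_imp_deriv)

text \<open>Injectivity of the coordinates evaluates \<open>inv_into\<close> once a point with the
  moved coordinate is exhibited. Coordinate lines of products and of the ambient space are computed
  this way.\<close>

lemma coord_lineI: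
  assumes "line_open M i A" "q \<in> A" "coord M i q = (coord M i p)(a := s)"
  shows "coord_line M i a p s = q"
  using assms unfolding line_open_def coord_line_def by (metis inv_into_f_f subsetD)

lemma coord_line_self:
  assumes "line_open M i A" "p \<in> A"
  shows "coord_line M i a p (coord M i p a) = p"
  by (rule coord_lineI[OF assms]) simp

lemma line_open_eventually:
  assumes "line_open M i A" "p \<in> A" "a < mdim M"
  shows "\<forall>\<^sub>F s in nhds (coord M i p a).
    coord_line M i a p s \<in> A \<and> coord M i (coord_line M i a p s) = (coord M i p)(a := s)"
proof -
  have "\<forall>\<^sub>F s in nhds (coord M i p a). (coord M i p)(a := s) \<in> coord M i ` A"
    using assms by (auto simp: line_open_def)
  then show ?thesis
  proof (rule eventually_mono)
    fix s assume "(coord M i p)(a := s) \<in> coord M i ` A"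
    then obtain q where q: "q \<in> A" "coord M i q = (coord M i p)(a := s)" by auto
    with coord_lineI[OF assms(1) q]
    show "coord_line M i a p s \<in> A \<and> coord M i (coord_line M i a p s) = (coord M i p)(a := s)" by simp
  qed
qed

lemma line_eventually_eq:
  assumes "line_open M i A" "p \<in> A" "a < mdim M" "\<And>q. q \<in> A \<Longrightarrow> f q = g q"
  shows "\<forall>\<^sub>F s in nhds (coord M i p a). f (coord_line M i a p s) = g (coord_line M i a p s)"
  using line_open_eventually[OF assms(1-3)] by (rule eventually_mono) (use assms(4) in auto)

lemma has_pd_cong:
  assumes "line_open M i A" "p \<in> A" "a < mdim M" "\<And>q. q \<in> A \<Longrightarrow> f q = g q"
  shows "has_pd M i a f p D \<longleftrightarrow> has_pd M i a g p D"
  unfolding has_pd_def using line_eventually_eq[OF assms] by (intro DERIV_cong_ev) auto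

lemma pd_cong:
  assumes "line_open M i A" "p \<in> A" "a < mdim M" "\<And>q. q \<in> A \<Longrightarrow> f q = g q"
  shows "pd M i a f p = pd M i a g p"
  unfolding pd_def using line_eventually_eq[OF assms] by (intro deriv_cong_ev) auto

lemma has_pd_const: "has_pd M i a (\<lambda>_. c) p 0"
  by (simp add: has_pd_def)

lemma pd_const: "pd M i a (\<lambda>_. c) = (\<lambda>_. 0)"
  by (rule ext) (rule has_pd_imp_pd[OF has_pd_const])

lemma has_pd_coord:
  assumes "line_open M i A" "p \<in> A" "a < mdim M"
  shows "has_pd M i a (\<lambda>q. coord M i q b) p (if a = b then 1 else 0)"
proof -
  have "has_pd M i a (\<lambda>q. coord M i q b) p (if a = b then 1 else 0) \<longleftrightarrow>
    ((\<lambda>s. ((coord M i p)(a := s)) b) has_real_derivative (if a = b then 1 else 0)) (at (coord M i p a))"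
    unfolding has_pd_def using line_open_eventually[OF assms]
    by (intro DERIV_cong_ev) (auto elim: eventually_mono)
  then show ?thesis by auto
qed

lemma has_pd_add: "has_pd M i a f p D \<Longrightarrow> has_pd M i a g p E \<Longrightarrow> has_pd M i a (\<lambda>q. f q + g q) p (D + E)"
  unfolding has_pd_def by (rule DERIV_add)

lemma has_pd_cmult: "has_pd M i a f p D \<Longrightarrow> has_pd M i a (\<lambda>q. c * f q) p (c * D)"
  unfolding has_pd_def by (rule DERIV_cmult)

lemma has_pd_sum:
  "(\<And>x. x \<in> S \<Longrightarrow> has_pd M i a (f x) p (D x)) \<Longrightarrow> has_pd M i a (\<lambda>q. \<Sum>x\<in>S. f x q) p (\<Sum>x\<in>S. D x)"
  unfolding has_pd_def by (rule DERIV_sum)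

lemma has_pd_mult:
  assumes "line_open M i A" "p \<in> A" "has_pd M i a f p D" "has_pd M i a g p E"
  shows "has_pd M i a (\<lambda>q. f q * g q) p (D * g p + f p * E)"
  using DERIV_mult'[OF assms(3,4)[unfolded has_pd_def]] coord_line_self[OF assms(1,2)]
  by (simp add: has_pd_def algebra_simps)

lemma has_pd_inverse:
  assumes "line_open M i A" "p \<in> A" "has_pd M i a f p D" "f p \<noteq> 0"
  shows "has_pd M i a (\<lambda>q. inverse (f q)) p (- D * (inverse (f p) * inverse (f p)))"
  using DERIV_inverse'[OF assms(3)[unfolded has_pd_def]] assms(4) coord_line_self[OF assms(1,2)]
  by (simp add: has_pd_def algebra_simps)

text \<open>Class C^r by recursion on the order. Closure under products and inverses becomes an
  induction on r, because one derivative of a product or an inverse is again built from functions of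
  class r.\<close>

fun ck :: "('a, 'i) mfd \<Rightarrow> 'i \<Rightarrow> 'a set \<Rightarrow> nat \<Rightarrow> ('a \<Rightarrow> real) \<Rightarrow> bool" where
  "ck M i A 0 f \<longleftrightarrow> continuous_map (subtopology (mtop M) A) euclideanreal f"
| "ck M i A (Suc r) f \<longleftrightarrow> continuous_map (subtopology (mtop M) A) euclideanreal f \<and>
    (\<forall>a<mdim M. (\<forall>p\<in>A. has_pd M i a f p (pd M i a f p)) \<and> ck M i A r (pd M i a f))"

lemma ck_continuous: "ck M i A r f \<Longrightarrow> continuous_map (subtopology (mtop M) A) euclideanreal f"
  by (cases r) auto

lemma ck_Suc_imp: "ck M i A (Suc r) f \<Longrightarrow> ck M i A r f"
proof (induction r arbitrary: f)
  case (Suc r)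
  then show ?case by (metis ck.simps(2))
qed auto

lemma has_pd_iff_differentiable:
  "(\<lambda>s. f (coord_line M i a p s)) differentiable (at (coord M i p a)) \<longleftrightarrow> has_pd M i a f p (pd M i a f p)"
  unfolding has_pd_def pd_def real_differentiable_def
  by (metis DERIV_imp_deriv)

lemma smooth_in_iff_ck: "smooth_in M i A f \<longleftrightarrow> (\<forall>r. ck M i A r f)"
proof
  assume "smooth_in M i A f"
  then show "\<forall>r. ck M i A r f"
  proof (intro allI)
    fix r from \<open>smooth_in M i A f\<close> show "ck M i A r f"
    proof (induction r arbitrary: f)
      case 0
      then show ?case unfolding smooth_in_def by (auto dest: spec[of _ "[]"])
    next
      case (Suc r)
      have "smooth_in M i A (pd M i a f)" if "a < mdim M" for a
        unfolding smooth_in_def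
      proof (intro allI impI)
        fix as assume "set as \<subseteq> {..<mdim M}"
        \<comment> \<open>\<open>foldr\<close> applies the last entry of the list first, so the
          derivative taken first is appended at the end.\<close>
        with that have "set (as @ [a]) \<subseteq> {..<mdim M}" by auto
        with Suc.prems show "continuous_map (subtopology (mtop M) A) euclideanreal (foldr (pd M i) as (pd M i a f)) \<and>
           (\<forall>p\<in>A. \<forall>b<mdim M. (\<lambda>s. foldr (pd M i) as (pd M i a f) (coord_line M i b p s))
              differentiable (at (coord M i p b)))"
          unfolding smooth_in_def by (auto dest!: spec[of _ "as @ [a]"])
      qed
      moreover have "continuous_map (subtopology (mtop M) A) euclideanreal f"
        "\<forall>p\<in>A. \<forall>a<mdim M. has_pd M i a f p (pd M i a f p)"
        using Suc.prems unfolding smooth_in_def has_pd_iff_differentiable by (auto dest: spec[of _ "[]"])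
      ultimately show ?case using Suc.IH by auto
    qed
  qed
next
  assume f: "\<forall>r. ck M i A r f"
  have *: "\<forall>r. ck M i A r (foldr (pd M i) as f)" if "set as \<subseteq> {..<mdim M}" for as
    using that
  proof (induction as)
    case (Cons a as)
    then have "ck M i A (Suc r) (foldr (pd M i) as f)" for r by (auto simp del: ck.simps)
    with Cons.prems show ?case by auto
  qed (use f in simp)
  show "smooth_in M i A f"
    unfolding smooth_in_def has_pd_iff_differentiable
  proof (intro allI impI conjI)
    fix as assume "set as \<subseteq> {..<mdim M}"
    from *[OF this] show "continuous_map (subtopology (mtop M) A) euclideanreal (foldr (pd M i) as f)"
      "\<forall>p\<in>A. \<forall>a<mdim M. has_pd M i a (foldr (pd M i) as f) p (pd M i a (foldr (pd M i) as f) p)"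
      by (blast intro: ck_continuous, metis ck.simps(2))
  qed
qed

text \<open>The product and inverse rules determine \<open>pd\<close> only at points of A;
  regularity must therefore pass along equality on A alone.\<close>

lemma ck_cong:
  assumes "line_open M i A" "\<And>q. q \<in> A \<Longrightarrow> f q = g q" "ck M i A r f"
  shows "ck M i A r g"
  using assms(2,3)
proof (induction r arbitrary: f g)
  case 0
  then show ?case by (auto elim!: continuous_map_eq)
next
  case (Suc r)
  have c: "continuous_map (subtopology (mtop M) A) euclideanreal g"
    using Suc.prems by (auto elim!: continuous_map_eq)
  have "pd M i a f q = pd M i a g q" if "q \<in> A" "a < mdim M" for a q
    using pd_cong[OF assms(1) that] Suc.prems by blast
  moreover have "has_pd M i a g q (pd M i a f q)" if "q \<in> A" "a < mdim M" for a q
    using has_pd_cong[OF assms(1) that, of f g] Suc.prems that by auto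
  ultimately show ?case using c Suc.IH Suc.prems by (simp) (metis)
qed

lemma ck_const: "ck M i A r (\<lambda>_. c)"
  by (induction r arbitrary: c) (auto simp: pd_const has_pd_const)

lemma ck_add:
  assumes A: "line_open M i A"
  shows "ck M i A r f \<Longrightarrow> ck M i A r g \<Longrightarrow> ck M i A r (\<lambda>p. f p + g p)"
proof (induction r arbitrary: f g)
  case (Suc r)
  have h: "has_pd M i a (\<lambda>p. f p + g p) p (pd M i a f p + pd M i a g p)" if "p \<in> A" "a < mdim M" for a p
    using Suc.prems that by (auto intro: has_pd_add)
  have "ck M i A r (pd M i a (\<lambda>p. f p + g p))" if "a < mdim M" for a
    by (rule ck_cong[OF A _ Suc.IH[of "pd M i a f" "pd M i a g"]])
      (use h[THEN has_pd_imp_pd] that Suc.prems in auto)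
  moreover have "has_pd M i a (\<lambda>p. f p + g p) p (pd M i a (\<lambda>p. f p + g p) p)" if "p \<in> A" "a < mdim M" for a p
    using h[OF that] has_pd_imp_pd by metis
  ultimately show ?case using Suc.prems by (auto intro: continuous_map_add)
qed (auto intro: continuous_map_add)

lemma ck_mult:
  assumes A: "line_open M i A"
  shows "ck M i A r f \<Longrightarrow> ck M i A r g \<Longrightarrow> ck M i A r (\<lambda>p. f p * g p)"
proof (induction r arbitrary: f g)
  case (Suc r)
  have h: "has_pd M i a (\<lambda>p. f p * g p) p (pd M i a f p * g p + f p * pd M i a g p)" if "p \<in> A" "a < mdim M" for a p
    using Suc.prems that by (auto intro: has_pd_mult[OF A])
  have "ck M i A r (pd M i a (\<lambda>p. f p * g p))" if "a < mdim M" for a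
    by (rule ck_cong[OF A _ ck_add[OF A Suc.IH[of "pd M i a f" g] Suc.IH[of f "pd M i a g"]]])
      (use h[THEN has_pd_imp_pd] that Suc.prems in \<open>auto intro: ck_Suc_imp\<close>)
  moreover have "has_pd M i a (\<lambda>p. f p * g p) p (pd M i a (\<lambda>p. f p * g p) p)" if "p \<in> A" "a < mdim M" for a p
    using h[OF that] has_pd_imp_pd by metis
  ultimately show ?case using Suc.prems by (auto intro: continuous_map_real_mult)
qed (auto intro: continuous_map_real_mult)

text \<open>In the derivative - f' / f^2 the inverse itself reappears, one order lower, where the
  induction hypothesis covers it.\<close>

lemma ck_inverse:
  assumes A: "line_open M i A" and nz: "\<And>p. p \<in> A \<Longrightarrow> f p \<noteq> 0"
  shows "ck M i A r f \<Longrightarrow> ck M i A r (\<lambda>p. inverse (f p))"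
proof (induction r)
  case 0
  then show ?case using nz by (auto intro!: continuous_map_real_inverse)
next
  case (Suc r)
  let ?h = "\<lambda>p. inverse (f p)"
  have h: "has_pd M i a ?h p (- 1 * pd M i a f p * (?h p * ?h p))" if "p \<in> A" "a < mdim M" for a p
    using Suc.prems that nz by (auto intro!: has_pd_inverse[OF A, simplified])
  have r: "ck M i A r ?h" by (rule Suc.IH[OF ck_Suc_imp[OF Suc.prems]])
  have "ck M i A r (\<lambda>p. - 1 * pd M i a f p * (?h p * ?h p))" if "a < mdim M" for a
    by (intro ck_mult[OF A] ck_const r) (use Suc.prems that in auto)
  then have "ck M i A r (pd M i a ?h)" if "a < mdim M" for a
    by (rule ck_cong[OF A, rotated]) (use h[THEN has_pd_imp_pd] that Suc.prems in auto)
  moreover have "has_pd M i a ?h p (pd M i a ?h p)" if "p \<in> A" "a < mdim M" for a p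
    using h[OF that] has_pd_imp_pd by metis
  ultimately show ?case using Suc.prems nz by (auto intro!: continuous_map_real_inverse)
qed

lemma smooth_in_cong:
  "line_open M i A \<Longrightarrow> (\<And>q. q \<in> A \<Longrightarrow> f q = g q) \<Longrightarrow> smooth_in M i A f \<Longrightarrow> smooth_in M i A g"
  unfolding smooth_in_iff_ck by (blast intro: ck_cong)

lemma smooth_in_const: "smooth_in M i A (\<lambda>_. c)"
  unfolding smooth_in_iff_ck by (blast intro: ck_const)

lemma smooth_in_add:
  "line_open M i A \<Longrightarrow> smooth_in M i A f \<Longrightarrow> smooth_in M i A g \<Longrightarrow> smooth_in M i A (\<lambda>p. f p + g p)"
  unfolding smooth_in_iff_ck by (blast intro: ck_add)

lemma smooth_in_mult:
  "line_open M i A \<Longrightarrow> smooth_in M i A f \<Longrightarrow> smooth_in M i A g \<Longrightarrow> smooth_in M i A (\<lambda>p. f p * g p)"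
  unfolding smooth_in_iff_ck by (blast intro: ck_mult)

lemma smooth_in_uminus:
  "line_open M i A \<Longrightarrow> smooth_in M i A f \<Longrightarrow> smooth_in M i A (\<lambda>p. - f p)"
  using smooth_in_mult[OF _ smooth_in_const[of M i A "- 1"]] by force

lemma smooth_in_diff:
  "line_open M i A \<Longrightarrow> smooth_in M i A f \<Longrightarrow> smooth_in M i A g \<Longrightarrow> smooth_in M i A (\<lambda>p. f p - g p)"
  using smooth_in_add[OF _ _ smooth_in_uminus] by force

lemma smooth_in_inverse:
  "line_open M i A \<Longrightarrow> (\<And>p. p \<in> A \<Longrightarrow> f p \<noteq> 0) \<Longrightarrow> smooth_in M i A f \<Longrightarrow> smooth_in M i A (\<lambda>p. inverse (f p))"
  unfolding smooth_in_iff_ck by (blast intro: ck_inverse)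

lemma smooth_in_sum:
  assumes "line_open M i A" "\<And>x. x \<in> S \<Longrightarrow> smooth_in M i A (f x)"
  shows "smooth_in M i A (\<lambda>p. \<Sum>x\<in>S. f x p)"
  using assms(2) by (induction S rule: infinite_finite_induct)
    (simp_all add: smooth_in_const smooth_in_add[OF assms(1)])

lemma smooth_in_pd: "a < mdim M \<Longrightarrow> smooth_in M i A f \<Longrightarrow> smooth_in M i A (pd M i a f)"
  unfolding smooth_in_iff_ck by (metis ck.simps(2))

lemma smooth_in_has_pd: "smooth_in M i A f \<Longrightarrow> p \<in> A \<Longrightarrow> a < mdim M \<Longrightarrow> has_pd M i a f p (pd M i a f p)"
  unfolding smooth_in_iff_ck by (metis ck.simps(2))

lemma smooth_in_continuous: "smooth_in M i A f \<Longrightarrow> continuous_map (subtopology (mtop M) A) euclideanreal f"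
  unfolding smooth_in_iff_ck by (metis ck.simps(1))

lemma ck_mono_set: "B \<subseteq> A \<Longrightarrow> ck M i A r f \<Longrightarrow> ck M i B r f"
  by (induction r arbitrary: f) (auto intro: continuous_map_from_subtopology_mono)

lemma smooth_in_mono: "B \<subseteq> A \<Longrightarrow> smooth_in M i A f \<Longrightarrow> smooth_in M i B f"
  unfolding smooth_in_iff_ck by (blast intro: ck_mono_set)

section \<open>Matrices with index range \<open>{..<d}\<close>\<close>

text \<open>The property inside \<open>matrix_inverse\<close> without the condition that entries
  outside the index range vanish.\<close>

definition is_inverse :: "nat \<Rightarrow> (nat \<Rightarrow> nat \<Rightarrow> real) \<Rightarrow> (nat \<Rightarrow> nat \<Rightarrow> real) \<Rightarrow> bool" where
  "is_inverse d A B \<longleftrightarrow> (\<forall>a<d. \<forall>b<d. (\<Sum>c<d. A a c * B c b) = (if a = b then 1 else 0) \<and>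
                                     (\<Sum>c<d. B a c * A c b) = (if a = b then 1 else 0))"

lemma sum_delta_left: "(b::nat) < d \<Longrightarrow> (\<Sum>c<d. (if c = b then 1 else 0) * f c) = (f b :: real)"
  "(b::nat) < d \<Longrightarrow> (\<Sum>c<d. (if b = c then 1 else 0) * f c) = (f b :: real)"
  "(b::nat) < d \<Longrightarrow> (\<Sum>c<d. f c * (if c = b then 1 else 0)) = (f b :: real)"
  "(b::nat) < d \<Longrightarrow> (\<Sum>c<d. f c * (if b = c then 1 else 0)) = (f b :: real)"
  by (simp_all add: if_distrib if_distribR cong: if_cong)

lemma matrix_mult_assoc:
  "(\<Sum>c<(d::nat). (\<Sum>e<(d'::nat). A a e * B e c) * C c b) = (\<Sum>e<d'. A a e * (\<Sum>c<d. B e c * (C c b :: real)))"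
  unfolding sum_distrib_right sum_distrib_left
  by (subst sum.swap) (simp add: mult.assoc)

lemma is_inverse_unique:
  assumes "is_inverse d A B" "is_inverse d A B'" "a < d" "b < d"
  shows "B a b = B' a b"
proof -
  have "B a b = (\<Sum>c<d. B a c * (\<Sum>e<d. A c e * B' e b))"
    using assms by (simp add: is_inverse_def sum_delta_left)
  also have "\<dots> = (\<Sum>e<d. (\<Sum>c<d. B a c * A c e) * B' e b)" by (simp only: matrix_mult_assoc)
  also have "\<dots> = B' a b" using assms by (simp add: is_inverse_def sum_delta_left)
  finally show ?thesis .
qed

lemma matrix_inverse_eq:
  assumes B: "is_inverse d A B" and ab: "a < d" "b < d"
  shows "matrix_inverse d A a b = B a b"
proof -
  \<comment> \<open>Padding by zero meets the normalisation in \<open>matrix_inverse\<close>, which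
    makes the inverse unique as a function on all indices.\<close>
  define B' where "B' = (\<lambda>a b. if a < d \<and> b < d then B a b else 0)"
  have "matrix_inverse d A = B'"
    unfolding matrix_inverse_def
  proof (rule the_equality)
    show "(\<forall>a b. a \<ge> d \<or> b \<ge> d \<longrightarrow> B' a b = 0) \<and>
     (\<forall>a<d. \<forall>b<d. (\<Sum>c<d. A a c * B' c b) = (if a = b then 1 else 0) \<and>
                   (\<Sum>c<d. B' a c * A c b) = (if a = b then 1 else 0))"
      using B by (simp add: is_inverse_def B'_def)
  next
    fix C assume C: "(\<forall>a b. a \<ge> d \<or> b \<ge> d \<longrightarrow> C a b = 0) \<and>
     (\<forall>a<d. \<forall>b<d. (\<Sum>c<d. A a c * C c b) = (if a = b then 1 else 0) \<and>
                   (\<Sum>c<d. C a c * A c b) = (if a = b then 1 else 0))"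
    then have "is_inverse d A C" by (simp add: is_inverse_def)
    then have "C a b = B' a b" for a b
      using is_inverse_unique[OF _ B] C by (cases "a < d \<and> b < d") (auto simp: B'_def)
    then show "C = B'" by blast
  qed
  then show ?thesis using ab by (simp add: B'_def)
qed

lemma is_inverse_trace:
  assumes "is_inverse d g B" "\<And>a b. a < d \<Longrightarrow> b < d \<Longrightarrow> g a b = g b a"
  shows "(\<Sum>a<d. \<Sum>b<d. B a b * g a b) = real d"
proof -
  have "(\<Sum>b<d. B a b * g a b) = 1" if "a < d" for a
  proof -
    have "(\<Sum>b<d. B a b * g a b) = (\<Sum>b<d. B a b * g b a)"
      by (intro sum.cong refl) (use assms(2) that in auto)
    then show ?thesis using assms(1) that by (simp add: is_inverse_def)
  qed
  then show ?thesis by simp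
qed

section \<open>Inverses of positive definite matrices\<close>

definition spd :: "nat \<Rightarrow> (nat \<Rightarrow> nat \<Rightarrow> real) \<Rightarrow> bool" where
  "spd d A \<longleftrightarrow> (\<forall>a<d. \<forall>b<d. A a b = A b a) \<and>
    (\<forall>v. (\<exists>a<d. v a \<noteq> 0) \<longrightarrow> 0 < (\<Sum>a<d. \<Sum>b<d. A a b * v a * v b))"

text \<open>The inverse of a positive definite matrix by recursion on its size; \<open>s\<close> is the Schur complement of
  the upper left block.\<close>

fun spd_inv :: "nat \<Rightarrow> (nat \<Rightarrow> nat \<Rightarrow> real) \<Rightarrow> nat \<Rightarrow> nat \<Rightarrow> real" where
  "spd_inv 0 A a b = 0"
| "spd_inv (Suc d) A a b =
    (let u = (\<lambda>a. \<Sum>c<d. spd_inv d A a c * A c d); s = A d d - (\<Sum>a<d. A d a * u a)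
     in (if a < d then (if b < d then spd_inv d A a b + u a * u b * inverse s else - u a * inverse s)
         else if b < d then - u b * inverse s else inverse s))"

lemma spd_inv_sym: "spd_inv d A a b = spd_inv d A b a"
  by (induction d arbitrary: a b) (auto simp: Let_def mult.commute)

lemma spd_Suc:
  assumes "spd (Suc d) A"
  shows "spd d A"
  unfolding spd_def
proof (intro conjI allI impI)
  fix v :: "nat \<Rightarrow> real" assume v: "\<exists>a<d. v a \<noteq> 0"
  define w where "w = (\<lambda>a. if a < d then v a else 0)"
  have "\<exists>a<Suc d. w a \<noteq> 0" using v by (auto simp: w_def intro: less_SucI)
  then have "0 < (\<Sum>a<Suc d. \<Sum>b<Suc d. A a b * w a * w b)" using assms unfolding spd_def by blast
  then show "0 < (\<Sum>a<d. \<Sum>b<d. A a b * v a * v b)" by (simp add: w_def)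
qed (use assms in \<open>auto simp: spd_def\<close>)

text \<open>The Schur complement is the value of the quadratic form at the vector (- u, 1), where u
  solves A u = (last column of A).\<close>

lemma spd_schur_pos:
  assumes A: "spd (Suc d) A" and B: "is_inverse d A B"
  shows "A d d - (\<Sum>a<d. A d a * (\<Sum>c<d. B a c * A c d)) > 0"
proof -
  define u where "u = (\<lambda>a. \<Sum>c<d. B a c * A c d)"
  define v where "v = (\<lambda>a. if a < d then - u a else 1)"
  have sym: "A a b = A b a" if "a \<le> d" "b \<le> d" for a b using A that by (auto simp: spd_def)
  have Au: "(\<Sum>b<d. A a b * u b) = A a d" if "a < d" for a
    unfolding u_def matrix_mult_assoc[symmetric] using B that by (simp add: is_inverse_def sum_delta_left)
  have "\<exists>a<Suc d. v a \<noteq> 0" by (auto simp: v_def intro!: exI[of _ d])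
  then have "0 < (\<Sum>a<Suc d. \<Sum>b<Suc d. A a b * v a * v b)" using A unfolding spd_def by blast
  also have "\<dots> = (\<Sum>a<d. u a * (\<Sum>b<d. A a b * u b)) - (\<Sum>a<d. A a d * u a) - (\<Sum>b<d. A d b * u b) + A d d"
    by (simp add: v_def sum.distrib sum_negf sum_subtractf sum_distrib_left sum_distrib_right mult_ac)
  also have "(\<Sum>a<d. u a * (\<Sum>b<d. A a b * u b)) = (\<Sum>a<d. A a d * u a)"
    by (rule sum.cong[OF refl]) (metis Au lessThan_iff mult.commute)
  finally show ?thesis by (simp add: u_def)
qed

text \<open>Block elimination is verified for the right inverse only; both matrices are symmetric,
  so transposition gives the left inverse.\<close>

lemma spd_inv: "spd d A \<Longrightarrow> is_inverse d A (spd_inv d A)"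
proof (induction d)
  case (Suc d)
  define B where "B = spd_inv d A"
  define u where "u = (\<lambda>a. \<Sum>c<d. B a c * A c d)"
  define s where "s = A d d - (\<Sum>a<d. A d a * u a)"
  have B: "is_inverse d A B" using Suc spd_Suc by (auto simp: B_def)
  have s: "s > 0" using spd_schur_pos[OF Suc.prems B] by (simp add: s_def u_def)
  have sym: "A a b = A b a" if "a < Suc d" "b < Suc d" for a b using Suc.prems that by (auto simp: spd_def)
  define C where "C = spd_inv (Suc d) A"
  have C: "C a b = (if a < d then (if b < d then B a b + u a * u b * inverse s else - u a * inverse s)
         else if b < d then - u b * inverse s else inverse s)" for a b
    by (simp add: C_def Let_def s_def u_def B_def)
  have Au: "(\<Sum>b<d. A a b * u b) = A a d" if "a < d" for a
    unfolding u_def matrix_mult_assoc[symmetric] using B that by (simp add: is_inverse_def sum_delta_left)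
  have uA: "(\<Sum>c<d. A d c * B c b) = u b" for b
    unfolding u_def B_def by (rule sum.cong) (auto simp: spd_inv_sym[of d A _ b] sym mult.commute)
  have AB: "(\<Sum>c<d. A a c * B c b) = (if a = b then 1 else 0)" if "a < d" "b < d" for a b
    using B that by (simp add: is_inverse_def)
  have R: "(\<Sum>c<Suc d. A a c * C c b) = (if a = b then 1 else 0)" if "a < Suc d" "b < Suc d" for a b
  proof (cases "b < d")
    case True
    have "(\<Sum>c<Suc d. A a c * C c b) =
      (\<Sum>c<d. A a c * B c b) + (\<Sum>c<d. A a c * u c) * (u b * inverse s) - A a d * u b * inverse s"
      using True by (simp add: C sum.distrib distrib_left sum_distrib_left sum_distrib_right mult_ac)
    also have "\<dots> = (if a = b then 1 else 0)"
    proof (cases "a < d")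
      case False
      then have [simp]: "a = d" using that by simp
      have e: "(\<Sum>c<d. A d c * u c) = A d d - s" by (simp add: s_def)
      have "u b + (A d d - s) * (u b * inverse s) - A d d * u b * inverse s = u b - u b * (s * inverse s)"
        by (simp add: algebra_simps)
      then show ?thesis unfolding \<open>a = d\<close> uA e using True s by simp
    qed (use True in \<open>simp add: AB Au\<close>)
    finally show ?thesis .
  next
    case False
    then have [simp]: "b = d" using that by simp
    have "(\<Sum>c<Suc d. A a c * C c b) = (A a d - (\<Sum>c<d. A a c * u c)) * inverse s"
      by (simp add: C sum_negf sum_distrib_left sum_distrib_right algebra_simps)
    also have "\<dots> = (if a = b then 1 else 0)"
    proof (cases "a < d")
      case False
      then have [simp]: "a = d" using that by simp
      show ?thesis using s by (simp flip: s_def)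
    qed (simp add: Au)
    finally show ?thesis .
  qed
  have "(\<Sum>c<Suc d. C a c * A c b) = (if a = b then 1 else 0)" if "a < Suc d" "b < Suc d" for a b
  proof -
    have "(\<Sum>c<Suc d. C a c * A c b) = (\<Sum>c<Suc d. A b c * C c a)"
      by (rule sum.cong) (use that in \<open>auto simp: sym[of _ b] C_def spd_inv_sym[of "Suc d" A a] simp del: spd_inv.simps\<close>)
    then show ?thesis using R[of b a] that by auto
  qed
  with R show ?case unfolding is_inverse_def C_def[symmetric] by blast
qed (simp add: is_inverse_def)

section \<open>The pointwise Laplacian and its transformation law\<close>

text \<open>
  The Laplacian at a point in terms of numbers: \<open>B\<close> is the inverse metric, \<open>D a b c\<close> stands for
  \<open>\<partial>\<^sub>a g\<^sub>b\<^sub>c\<close>, and \<open>H\<close>, \<open>G\<close> stand for the second and first partial derivatives of the function.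
\<close>

definition lap_data :: "nat \<Rightarrow> (nat \<Rightarrow> nat \<Rightarrow> real) \<Rightarrow> (nat \<Rightarrow> nat \<Rightarrow> nat \<Rightarrow> real) \<Rightarrow>
    (nat \<Rightarrow> nat \<Rightarrow> real) \<Rightarrow> (nat \<Rightarrow> real) \<Rightarrow> real" where
  "lap_data d B D H G = (\<Sum>a<d. \<Sum>b<d. B a b * H a b) -
    (\<Sum>c<d. \<Sum>e<d. B c e * ((\<Sum>a<d. \<Sum>b<d. B a b * (D a b e + D b a e - D e a b)) / 2) * G c)"

lemma sum_swap2:
  "(\<Sum>a\<in>A. \<Sum>b\<in>B. \<Sum>u\<in>U. \<Sum>w\<in>W. f a b u w) = (\<Sum>u\<in>U. \<Sum>w\<in>W. \<Sum>a\<in>A. \<Sum>b\<in>B. (f a b u w :: real))"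
proof -
  have "(\<Sum>a\<in>A. \<Sum>b\<in>B. \<Sum>u\<in>U. \<Sum>w\<in>W. f a b u w) = (\<Sum>a\<in>A. \<Sum>u\<in>U. \<Sum>b\<in>B. \<Sum>w\<in>W. f a b u w)"
    by (intro sum.cong refl sum.swap)
  also have "\<dots> = (\<Sum>u\<in>U. \<Sum>a\<in>A. \<Sum>b\<in>B. \<Sum>w\<in>W. f a b u w)" by (rule sum.swap)
  also have "\<dots> = (\<Sum>u\<in>U. \<Sum>a\<in>A. \<Sum>w\<in>W. \<Sum>b\<in>B. f a b u w)" by (intro sum.cong refl sum.swap)
  also have "\<dots> = (\<Sum>u\<in>U. \<Sum>w\<in>W. \<Sum>a\<in>A. \<Sum>b\<in>B. f a b u w)" by (intro sum.cong refl sum.swap)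
  finally show ?thesis .
qed

lemma laplacian_in_eq_lap_data:
  "laplacian_in M i f p = lap_data (mdim M) (\<lambda>a b. ginv M i a b p)
     (\<lambda>a b c. pd M i a (gcomp M i b c) p) (\<lambda>a b. pd M i a (pd M i b f) p) (\<lambda>c. pd M i c f p)"
proof -
  define d where "d = mdim M"
  define B where "B = (\<lambda>a b. ginv M i a b p)"
  define D where "D = (\<lambda>a b c. pd M i a (gcomp M i b c) p)"
  define G where "G = (\<lambda>c. pd M i c f p)"
  have "(\<Sum>a<d. \<Sum>b<d. B a b * (\<Sum>c<d. (\<Sum>e<d. B c e * (D a b e + D b a e - D e a b)) / 2 * G c)) =
    (\<Sum>a<d. \<Sum>b<d. \<Sum>c<d. \<Sum>e<d. B a b * (B c e * (D a b e + D b a e - D e a b) / 2 * G c))"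
    by (simp add: sum_distrib_left sum_distrib_right sum_divide_distrib)
  also have "\<dots> = (\<Sum>c<d. \<Sum>e<d. \<Sum>a<d. \<Sum>b<d. B a b * (B c e * (D a b e + D b a e - D e a b) / 2 * G c))"
    by (rule sum_swap2)
  also have "\<dots> = (\<Sum>c<d. \<Sum>e<d. B c e * ((\<Sum>a<d. \<Sum>b<d. B a b * (D a b e + D b a e - D e a b)) / 2) * G c)"
    by (simp add: sum_distrib_left sum_distrib_right sum_divide_distrib mult_ac)
  finally show ?thesis
    unfolding laplacian_in_def christoffel_def lap_data_def right_diff_distrib sum_subtractf
    by (simp only: B_def D_def G_def d_def)
qed

lemma contraction_sym:
  assumes "\<And>a b. a < d \<Longrightarrow> b < d \<Longrightarrow> B a b = B b (a::nat)"
  shows "(\<Sum>a<d. \<Sum>b<d. B a b * F a b) = (\<Sum>a<d. \<Sum>b<d. B a b * (F b a :: real))"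
  by (subst sum.swap) (intro sum.cong refl, use assms in auto)

text \<open>Pushing B forward by J is adjoint to pulling a covariant 2-tensor back by J.\<close>

lemma contraction_push:
  assumes "\<And>v w. v < d \<Longrightarrow> w < d \<Longrightarrow> B' v w = (\<Sum>a<d. \<Sum>b<d. B a b * J v a * J w (b::nat))"
  shows "(\<Sum>a<d. \<Sum>b<d. B a b * (\<Sum>v<d. \<Sum>w<d. X v w * J v a * J w b)) = (\<Sum>v<d. \<Sum>w<d. B' v w * (X v w :: real))"
proof -
  have "(\<Sum>a<d. \<Sum>b<d. B a b * (\<Sum>v<d. \<Sum>w<d. X v w * J v a * J w b)) =
    (\<Sum>a<d. \<Sum>b<d. \<Sum>v<d. \<Sum>w<d. B a b * (X v w * J v a * J w b))" by (simp add: sum_distrib_left)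
  also have "\<dots> = (\<Sum>v<d. \<Sum>w<d. \<Sum>a<d. \<Sum>b<d. B a b * (X v w * J v a * J w b))" by (rule sum_swap2)
  also have "\<dots> = (\<Sum>v<d. \<Sum>w<d. (\<Sum>a<d. \<Sum>b<d. B a b * J v a * J w b) * X v w)"
    by (simp add: sum_distrib_left sum_distrib_right mult_ac)
  also have "\<dots> = (\<Sum>v<d. \<Sum>w<d. B' v w * X v w)"
    by (intro sum.cong refl) (use assms in auto)
  finally show ?thesis .
qed

text \<open>\<open>J\<close> is the Jacobian of a change of coordinates and \<open>S\<close> consists of the second derivatives.\<close>

lemma lap_data_change:
  fixes d :: nat
  assumes Bsym: "\<And>a b. a < d \<Longrightarrow> b < d \<Longrightarrow> B a b = B b a"
    and gsym: "\<And>a b. a < d \<Longrightarrow> b < d \<Longrightarrow> g' a b = g' b a"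
    and Ssym: "\<And>c a b. c < d \<Longrightarrow> a < d \<Longrightarrow> b < d \<Longrightarrow> S c a b = S c b a"
    and inv: "\<And>v u. v < d \<Longrightarrow> u < d \<Longrightarrow> (\<Sum>w<d. B' v w * g' w u) = (if v = u then 1 else 0)"
    and B': "\<And>v w. v < d \<Longrightarrow> w < d \<Longrightarrow> B' v w = (\<Sum>a<d. \<Sum>b<d. B a b * J v a * J w b)"
    and D: "\<And>a b e. a < d \<Longrightarrow> b < d \<Longrightarrow> e < d \<Longrightarrow> D a b e = (\<Sum>u<d. \<Sum>w<d.
       (\<Sum>v<d. D' v u w * J v a) * J u b * J w e + g' u w * (S u a b * J w e + J u b * S w a e))"
    and H: "\<And>a b. a < d \<Longrightarrow> b < d \<Longrightarrow> H a b = (\<Sum>c<d. (\<Sum>e<d. H' e c * J e a) * J c b + G' c * S c a b)"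
    and G: "\<And>a. a < d \<Longrightarrow> G a = (\<Sum>c<d. G' c * J c a)"
  shows "lap_data d B D H G = lap_data d B' D' H' G'"
proof -
  have B'sym: "B' v w = B' w v" if "v < d" "w < d" for v w
    unfolding B'[OF that] B'[OF that(2,1)] mult.assoc
    by (subst contraction_sym[OF Bsym]) (simp_all add: mult_ac)
  \<comment> \<open>\<open>\<eta>\<close> is the inhomogeneous term: it enters the contraction of
    the Hessian and that of the Christoffel symbols, and the two contributions cancel at the
    end.\<close>
  define \<eta> where "\<eta> = (\<lambda>u. \<Sum>a<d. \<Sum>b<d. B a b * S u a b)"
  define S1 where "S1 = (\<lambda>e. \<Sum>a<d. \<Sum>b<d. B a b * D a b e)"
  define S2 where "S2 = (\<lambda>e. \<Sum>a<d. \<Sum>b<d. B a b * D e a b)"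
  define T1 where "T1 = (\<lambda>e. \<Sum>a<d. \<Sum>b<d. B' a b * D' a b e)"
  define T2 where "T2 = (\<lambda>e. \<Sum>a<d. \<Sum>b<d. B' a b * D' e a b)"
  \<comment> \<open>\<open>Z\<close> occurs once in \<open>S1\<close> and twice in
    \<open>S2\<close>, so it drops out of the combination \<open>S1 - S2 / 2\<close> that the
    Christoffel symbols contain.\<close>
  define Z where "Z = (\<lambda>e. \<Sum>a<d. \<Sum>b<d. B a b * (\<Sum>u<d. \<Sum>w<d. g' u w * (J u b * S w a e)))"
  have V: "(\<Sum>a<d. \<Sum>b<d. B a b * (D a b e + D b a e - D e a b)) / 2 = S1 e - S2 e / 2" for e
  proof -
    have "(\<Sum>a<d. \<Sum>b<d. B a b * D b a e) = S1 e"
      unfolding S1_def by (rule contraction_sym[OF Bsym, symmetric])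
    then show ?thesis
      by (simp add: S1_def S2_def distrib_left right_diff_distrib sum.distrib sum_subtractf)
  qed
  have V': "(\<Sum>a<d. \<Sum>b<d. B' a b * (D' a b e + D' b a e - D' e a b)) / 2 = T1 e - T2 e / 2" for e
  proof -
    have "(\<Sum>a<d. \<Sum>b<d. B' a b * D' b a e) = T1 e"
      unfolding T1_def by (rule contraction_sym[OF B'sym, symmetric])
    then show ?thesis
      by (simp add: T1_def T2_def distrib_left right_diff_distrib sum.distrib sum_subtractf)
  qed
  have S1: "S1 e = (\<Sum>w<d. J w e * (T1 w + (\<Sum>u<d. \<eta> u * g' u w))) + Z e" if "e < d" for e
  proof -
    have "S1 e = (\<Sum>a<d. \<Sum>b<d. B a b * (\<Sum>v<d. \<Sum>u<d. (\<Sum>w<d. D' v u w * J w e) * J v a * J u b))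
      + (\<Sum>a<d. \<Sum>b<d. B a b * (\<Sum>u<d. \<Sum>w<d. g' u w * J w e * S u a b)) + Z e"
    proof -
      have "D a b e = (\<Sum>v<d. \<Sum>u<d. (\<Sum>w<d. D' v u w * J w e) * J v a * J u b) +
        (\<Sum>u<d. \<Sum>w<d. g' u w * J w e * S u a b) + (\<Sum>u<d. \<Sum>w<d. g' u w * (J u b * S w a e))"
        if ab: "a < d" "b < d" for a b
      proof -
        have "(\<Sum>u<d. \<Sum>w<d. (\<Sum>v<d. D' v u w * J v a) * J u b * J w e) =
           (\<Sum>u<d. \<Sum>w<d. \<Sum>v<d. D' v u w * J v a * J u b * J w e)" by (simp add: sum_distrib_right)
        also have "\<dots> = (\<Sum>u<d. \<Sum>v<d. \<Sum>w<d. D' v u w * J v a * J u b * J w e)"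
          by (intro sum.cong refl sum.swap)
        also have "\<dots> = (\<Sum>v<d. \<Sum>u<d. \<Sum>w<d. D' v u w * J v a * J u b * J w e)"
          by (rule sum.swap)
        also have "\<dots> = (\<Sum>v<d. \<Sum>u<d. (\<Sum>w<d. D' v u w * J w e) * J v a * J u b)"
          by (simp add: sum_distrib_left sum_distrib_right mult_ac)
        finally show ?thesis
          unfolding D[OF ab \<open>e < d\<close>] by (simp add: distrib_left sum.distrib mult_ac)
      qed
      then show ?thesis by (simp add: S1_def Z_def distrib_left sum.distrib)
    qed
    also have "(\<Sum>a<d. \<Sum>b<d. B a b * (\<Sum>v<d. \<Sum>u<d. (\<Sum>w<d. D' v u w * J w e) * J v a * J u b))
       = (\<Sum>v<d. \<Sum>u<d. B' v u * (\<Sum>w<d. D' v u w * J w e))"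
      by (rule contraction_push[OF B'])
    also have "\<dots> = (\<Sum>w<d. J w e * T1 w)"
    proof -
      have "(\<Sum>v<d. \<Sum>u<d. B' v u * (\<Sum>w<d. D' v u w * J w e)) = (\<Sum>v<d. \<Sum>w<d. \<Sum>u<d. B' v u * (D' v u w * J w e))"
        unfolding sum_distrib_left by (intro sum.cong refl sum.swap)
      also have "\<dots> = (\<Sum>w<d. \<Sum>v<d. \<Sum>u<d. B' v u * (D' v u w * J w e))" by (rule sum.swap)
      finally show ?thesis by (simp add: T1_def sum_distrib_left sum_distrib_right mult_ac)
    qed
    also have "(\<Sum>a<d. \<Sum>b<d. B a b * (\<Sum>u<d. \<Sum>w<d. g' u w * J w e * S u a b)) =
      (\<Sum>w<d. J w e * (\<Sum>u<d. \<eta> u * g' u w))"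
    proof -
      have "(\<Sum>a<d. \<Sum>b<d. B a b * (\<Sum>u<d. \<Sum>w<d. g' u w * J w e * S u a b)) =
         (\<Sum>a<d. \<Sum>b<d. \<Sum>u<d. \<Sum>w<d. B a b * (g' u w * J w e * S u a b))" by (simp add: sum_distrib_left)
      also have "\<dots> = (\<Sum>u<d. \<Sum>w<d. \<Sum>a<d. \<Sum>b<d. B a b * (g' u w * J w e * S u a b))" by (rule sum_swap2)
      also have "\<dots> = (\<Sum>w<d. \<Sum>u<d. \<Sum>a<d. \<Sum>b<d. B a b * (g' u w * J w e * S u a b))" by (rule sum.swap)
      finally show ?thesis by (simp add: \<eta>_def sum_distrib_left sum_distrib_right mult_ac)
    qed
    finally show ?thesis by (simp add: distrib_left sum.distrib)
  qed
  have S2: "S2 e = (\<Sum>w<d. J w e * T2 w) + 2 * Z e" if "e < d" for e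
  proof -
    have "D e a b = (\<Sum>u<d. \<Sum>w<d. (\<Sum>v<d. D' v u w * J v e) * J u a * J w b) +
        (\<Sum>u<d. \<Sum>w<d. g' u w * (J u a * S w b e)) + (\<Sum>u<d. \<Sum>w<d. g' u w * (J u b * S w a e))"
        if ab: "a < d" "b < d" for a b
    proof -
      have "(\<Sum>u<d. \<Sum>w<d. g' u w * (S u e a * J w b)) = (\<Sum>w<d. \<Sum>u<d. g' u w * (S u e a * J w b))"
        by (rule sum.swap)
      also have "\<dots> = (\<Sum>u<d. \<Sum>w<d. g' u w * (J u b * S w a e))"
        by (intro sum.cong refl) (use gsym Ssym[OF _ \<open>e < d\<close> ab(1)] in \<open>auto simp: mult_ac\<close>)
      finally have 1: "(\<Sum>u<d. \<Sum>w<d. g' u w * (S u e a * J w b)) = \<dots>" .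
      have 2: "(\<Sum>u<d. \<Sum>w<d. g' u w * (J u a * S w e b)) = (\<Sum>u<d. \<Sum>w<d. g' u w * (J u a * S w b e))"
        by (intro sum.cong refl) (use Ssym[OF _ \<open>e < d\<close> ab(2)] in auto)
      show ?thesis unfolding D[OF \<open>e < d\<close> ab] distrib_left sum.distrib 1 2 by simp
    qed
    then have "S2 e = (\<Sum>a<d. \<Sum>b<d. B a b * (\<Sum>u<d. \<Sum>w<d. (\<Sum>v<d. D' v u w * J v e) * J u a * J w b))
      + (\<Sum>a<d. \<Sum>b<d. B a b * (\<Sum>u<d. \<Sum>w<d. g' u w * (J u a * S w b e))) + Z e"
      by (simp add: S2_def Z_def distrib_left sum.distrib)
    also have "(\<Sum>a<d. \<Sum>b<d. B a b * (\<Sum>u<d. \<Sum>w<d. g' u w * (J u a * S w b e))) = Z e"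
      unfolding Z_def by (rule contraction_sym[OF Bsym])
    also have "(\<Sum>a<d. \<Sum>b<d. B a b * (\<Sum>u<d. \<Sum>w<d. (\<Sum>v<d. D' v u w * J v e) * J u a * J w b)) =
      (\<Sum>u<d. \<Sum>w<d. B' u w * (\<Sum>v<d. D' v u w * J v e))" by (rule contraction_push[OF B'])
    also have "\<dots> = (\<Sum>w<d. J w e * T2 w)"
    proof -
      have "(\<Sum>v<d. \<Sum>u<d. B' v u * (\<Sum>w<d. D' w v u * J w e)) = (\<Sum>v<d. \<Sum>w<d. \<Sum>u<d. B' v u * (D' w v u * J w e))"
        unfolding sum_distrib_left by (intro sum.cong refl sum.swap)
      also have "\<dots> = (\<Sum>w<d. \<Sum>v<d. \<Sum>u<d. B' v u * (D' w v u * J w e))" by (rule sum.swap)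
      finally show ?thesis by (simp add: T2_def sum_distrib_left sum_distrib_right mult_ac)
    qed
    finally show ?thesis by simp
  qed
  \<comment> \<open>\<open>Y\<close> is the contracted Christoffel covector in the new coordinates
    plus \<open>\<eta>\<close> lowered by the metric; raising the index again below recovers
    \<open>\<eta>\<close>.\<close>
  define Y where "Y = (\<lambda>w. T1 w - T2 w / 2 + (\<Sum>u<d. \<eta> u * g' u w))"
  have VY: "S1 e - S2 e / 2 = (\<Sum>w<d. J w e * Y w)" if "e < d" for e
  proof -
    have "(\<Sum>w<d. J w e * T2 w / 2) = (\<Sum>w<d. J w e * T2 w) / 2" by (simp only: sum_divide_distrib)
    then have 1: "(\<Sum>w<d. J w e * Y w) = (\<Sum>w<d. J w e * T1 w) - (\<Sum>w<d. J w e * T2 w) / 2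
      + (\<Sum>w<d. J w e * (\<Sum>u<d. \<eta> u * g' u w))"
      by (simp add: Y_def distrib_left right_diff_distrib sum.distrib sum_subtractf)
    have 2: "S1 e = (\<Sum>w<d. J w e * T1 w) + (\<Sum>w<d. J w e * (\<Sum>u<d. \<eta> u * g' u w)) + Z e"
      unfolding S1[OF that] by (simp only: distrib_left sum.distrib)
    show ?thesis using 1 2 S2[OF that] by argo
  qed
  have HH: "(\<Sum>a<d. \<Sum>b<d. B a b * H a b) = (\<Sum>c<d. \<Sum>e<d. B' c e * H' c e) + (\<Sum>c<d. G' c * \<eta> c)"
  proof -
    have "H a b = (\<Sum>e<d. \<Sum>c<d. H' e c * J e a * J c b) + (\<Sum>c<d. \<Sum>u<1::nat. G' c * S c a b)"
      if "a < d" "b < d" for a b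
      unfolding H[OF that] sum.distrib sum_distrib_right by (subst sum.swap) simp
    then have "(\<Sum>a<d. \<Sum>b<d. B a b * H a b) =
      (\<Sum>a<d. \<Sum>b<d. B a b * (\<Sum>e<d. \<Sum>c<d. H' e c * J e a * J c b)) +
      (\<Sum>a<d. \<Sum>b<d. \<Sum>c<d. \<Sum>u<1::nat. B a b * (G' c * S c a b))"
      by (simp add: distrib_left sum.distrib sum_distrib_left)
    also have "(\<Sum>a<d. \<Sum>b<d. \<Sum>c<d. \<Sum>u<1::nat. B a b * (G' c * S c a b)) =
      (\<Sum>c<d. \<Sum>u<1::nat. \<Sum>a<d. \<Sum>b<d. B a b * (G' c * S c a b))" by (rule sum_swap2)
    also have "(\<Sum>a<d. \<Sum>b<d. B a b * (\<Sum>e<d. \<Sum>c<d. H' e c * J e a * J c b)) = (\<Sum>e<d. \<Sum>c<d. B' e c * H' e c)"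
      by (rule contraction_push[OF B'])
    also have "(\<Sum>c<d. \<Sum>u<1::nat. \<Sum>a<d. \<Sum>b<d. B a b * (G' c * S c a b)) = (\<Sum>c<d. G' c * \<eta> c)"
      by (simp add: \<eta>_def sum_distrib_left mult_ac)
    finally show ?thesis .
  qed
  have "(\<Sum>c<d. \<Sum>e<d. B c e * (S1 e - S2 e / 2) * G c) =
     (\<Sum>c<d. \<Sum>e<d. B c e * (\<Sum>v<d. \<Sum>w<d. (G' v * Y w) * J v c * J w e))"
    by (intro sum.cong refl) (simp add: VY G sum_product mult_ac)
  also have "\<dots> = (\<Sum>v<d. \<Sum>w<d. B' v w * (G' v * Y w))" by (rule contraction_push[OF B'])
  also have "\<dots> = (\<Sum>v<d. \<Sum>w<d. B' v w * (T1 w - T2 w / 2) * G' v + G' v * (B' v w * (\<Sum>u<d. \<eta> u * g' u w)))"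
    by (intro sum.cong refl) (simp add: Y_def algebra_simps)
  also have "\<dots> = (\<Sum>v<d. \<Sum>w<d. B' v w * (T1 w - T2 w / 2) * G' v) +
      (\<Sum>v<d. G' v * (\<Sum>w<d. B' v w * (\<Sum>u<d. \<eta> u * g' u w)))"
    by (simp only: sum.distrib sum_distrib_left)
  also have "(\<Sum>v<d. G' v * (\<Sum>w<d. B' v w * (\<Sum>u<d. \<eta> u * g' u w))) = (\<Sum>v<d. G' v * \<eta> v)"
  proof (intro sum.cong refl, goal_cases)
    case (1 v)
    then have v: "v < d" by simp
    have "(\<Sum>u<d. \<eta> u * g' u w) = (\<Sum>u<d. g' w u * \<eta> u)" if "w < d" for w
      by (rule sum.cong[OF refl]) (metis gsym that lessThan_iff mult.commute)
    then have "(\<Sum>w<d. B' v w * (\<Sum>u<d. \<eta> u * g' u w)) = (\<Sum>w<d. B' v w * (\<Sum>u<d. g' w u * \<eta> u))"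
      by simp
    also have "\<dots> = (\<Sum>u<d. (\<Sum>w<d. B' v w * g' w u) * \<eta> u)"
      by (rule matrix_mult_assoc[symmetric, where A = B' and B = g' and C = "\<lambda>u (_::nat). \<eta> u"])
    also have "\<dots> = \<eta> v" using v by (simp add: inv sum_delta_left)
    finally show ?case by simp
  qed
  finally show ?thesis unfolding lap_data_def V V' HH by simp
qed

section \<open>The chain rule and the symmetry of second derivatives\<close>

text \<open>Coordinates from \<open>d\<close> on are fixed to 0, so only finitely many radii of an
  open box in the product topology have to be minimised.\<close>

lemma Euclidean_space_box:
  assumes "openin (Euclidean_space d) S" "y0 \<in> S"
  shows "\<exists>\<delta>>0. \<forall>y. (\<forall>c\<ge>d. y c = 0) \<and> (\<forall>c<d. \<bar>y c - y0 c\<bar> < \<delta>) \<longrightarrow> y \<in> S"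
proof -
  obtain T where T: "openin (powertop_real UNIV) T" "S = T \<inter> {x. \<forall>i\<ge>d. x i = 0}"
    using assms(1) unfolding Euclidean_space_def openin_subtopology by auto
  have "y0 \<in> T" using assms(2) T by auto
  then obtain U where U: "\<forall>i. open (U i)" "y0 \<in> Pi\<^sub>E UNIV U" "Pi\<^sub>E UNIV U \<subseteq> T"
    using T(1) unfolding openin_product_topology_alt by auto
  have "\<exists>\<delta>>0. \<forall>z. \<bar>z - y0 i\<bar> < \<delta> \<longrightarrow> z \<in> U i" for i
  proof -
    have "y0 i \<in> U i" using U(2) by auto
    with U(1) obtain e where "e > 0" "ball (y0 i) e \<subseteq> U i" by (meson open_contains_ball)
    then show ?thesis by (intro exI[of _ e]) (auto simp: dist_real_def abs_minus_commute subset_iff)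
  qed
  then obtain \<delta> where \<delta>: "\<And>i. \<delta> i > 0" "\<And>i z. \<bar>z - y0 i\<bar> < \<delta> i \<Longrightarrow> z \<in> U i" by metis
  \<comment> \<open>The entry 1 keeps the set nonempty when d = 0.\<close>
  define \<epsilon> where "\<epsilon> = Min (insert 1 (\<delta> ` {..<d}))"
  have "\<epsilon> > 0" unfolding \<epsilon>_def using \<delta>(1) by (subst Min_gr_iff) auto
  moreover have "y \<in> S" if y: "\<forall>c\<ge>d. y c = 0" "\<forall>c<d. \<bar>y c - y0 c\<bar> < \<epsilon>" for y
  proof -
    have "y i \<in> U i" for i
    proof (cases "i < d")
      case True
      then have "\<epsilon> \<le> \<delta> i" unfolding \<epsilon>_def by (intro Min_le) auto
      with y True have "\<bar>y i - y0 i\<bar> < \<delta> i" by force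
      then show ?thesis by (rule \<delta>(2))
    next
      case False
      then have "y i = y0 i" using y assms(2) T(2) by auto
      then show ?thesis using U(2) by auto
    qed
    then have "y \<in> Pi\<^sub>E UNIV U" by auto
    with U(3) y show ?thesis by (auto simp: T(2))
  qed
  ultimately show ?thesis by blast
qed

lemma riemannian_chart:
  assumes "riemannian_manifold X" "i \<in> chart_index X"
  shows "openin (mtop X) (chart_dom X i)"
    "homeomorphic_map (subtopology (mtop X) (chart_dom X i))
         (subtopology (Euclidean_space (mdim X)) (coord X i ` chart_dom X i)) (coord X i)"
    "openin (Euclidean_space (mdim X)) (coord X i ` chart_dom X i)"
  using assms unfolding riemannian_manifold_def by auto

lemma chart_inj:
  assumes "riemannian_manifold X" "i \<in> chart_index X"
  shows "inj_on (coord X i) (chart_dom X i)"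
  using homeomorphic_imp_injective_map[OF riemannian_chart(2)[OF assms]]
    openin_subset[OF riemannian_chart(1)[OF assms]]
  by (simp add: topspace_subtopology Int_absorb1)

lemma chart_box:
  assumes X: "riemannian_manifold X" "i \<in> chart_index X"
    and A: "openin (mtop X) A" "A \<subseteq> chart_dom X i" "p \<in> A"
  shows "\<exists>\<delta>>0. \<forall>y. (\<forall>c\<ge>mdim X. y c = 0) \<and> (\<forall>c<mdim X. \<bar>y c - coord X i p c\<bar> < \<delta>) \<longrightarrow> y \<in> coord X i ` A"
proof -
  have "openin (subtopology (mtop X) (chart_dom X i)) A"
    using A by (metis openin_subtopology_Int2 inf.absorb_iff2 openin_subtopology)
  then have "openin (subtopology (Euclidean_space (mdim X)) (coord X i ` chart_dom X i)) (coord X i ` A)"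
    using riemannian_chart(2)[OF X] homeomorphic_imp_open_map open_map_def by metis
  then have "openin (Euclidean_space (mdim X)) (coord X i ` A)"
    using riemannian_chart(3)[OF X] openin_trans_full by blast
  from Euclidean_space_box[OF this] A(3) show ?thesis by blast
qed

lemma chart_line_open:
  assumes X: "riemannian_manifold X" "i \<in> chart_index X"
    and A: "openin (mtop X) A" "A \<subseteq> chart_dom X i"
  shows "line_open X i A"
  unfolding line_open_def
proof (intro conjI ballI allI impI)
  show "inj_on (coord X i) (chart_dom X i)" by (rule chart_inj[OF X])
next
  fix p a assume p: "p \<in> A" and a: "mdim X \<le> a"
  have "coord X i p \<in> topspace (Euclidean_space (mdim X))"
    using openin_subset[OF riemannian_chart(3)[OF X]] p A(2) by auto
  with a show "coord X i p a = 0" by (simp add: topspace_Euclidean_space)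
next
  fix p a assume p: "p \<in> A" and a: "a < mdim X"
  have z: "coord X i p c = 0" if "c \<ge> mdim X" for c
    using openin_subset[OF riemannian_chart(3)[OF X]] p A(2) that by (auto simp: topspace_Euclidean_space)
  obtain \<delta> where \<delta>: "\<delta> > 0" "\<And>y. (\<forall>c\<ge>mdim X. y c = 0) \<Longrightarrow> (\<forall>c<mdim X. \<bar>y c - coord X i p c\<bar> < \<delta>) \<Longrightarrow> y \<in> coord X i ` A"
    using chart_box[OF X A p] by blast
  have "(coord X i p)(a := s) \<in> coord X i ` A" if "dist s (coord X i p a) < \<delta>" for s
    using that \<delta>(1) z a by (intro \<delta>(2)) (auto simp: dist_real_def)
  then show "\<forall>\<^sub>F s in nhds (coord X i p a). (coord X i p)(a := s) \<in> coord X i ` A"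
    unfolding eventually_nhds_metric using \<delta>(1) by blast
qed (use A in auto)

lemma openin_cont_ball:
  assumes "openin T A" "continuous_map (subtopology T A) euclideanreal F"
  shows "openin T {q \<in> A. \<bar>F q - c\<bar> < e}"
proof -
  have "openin (subtopology T A) {q \<in> topspace (subtopology T A). F q \<in> ball c e}"
    by (rule openin_continuous_map_preimage[OF assms(2)]) (simp add: open_openin[symmetric])
  moreover have "{q \<in> topspace (subtopology T A). F q \<in> ball c e} = {q \<in> A. \<bar>F q - c\<bar> < e}"
    using openin_subset[OF assms(1)] by (auto simp: dist_real_def abs_minus_commute)
  ultimately show ?thesis using openin_trans_full assms(1) by metis
qed

lemma mvt_segment:
  fixes f :: "real \<Rightarrow> real"
  assumes "\<And>x. x \<in> closed_segment a b \<Longrightarrow> (f has_real_derivative f' x) (at x)"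
  shows "\<exists>z\<in>closed_segment a b. f b - f a = (b - a) * f' z"
proof (cases a b rule: linorder_cases)
  case less
  from MVT2[OF this, of f f'] assms obtain z where "a < z" "z < b" "f b - f a = (b - a) * f' z"
    by (auto simp: closed_segment_eq_real_ivl)
  then show ?thesis by (auto simp: closed_segment_eq_real_ivl)
next
  case greater
  from MVT2[OF this, of f f'] assms obtain z where "b < z" "z < a" "f a - f b = (a - b) * f' z"
    by (auto simp: closed_segment_eq_real_ivl)
  then show ?thesis by (auto simp: closed_segment_eq_real_ivl algebra_simps intro!: bexI[of _ z])
qed auto

text \<open>Continuous partial derivatives give total differentiability: the coordinates are moved
  one at a time, and on each segment the mean value theorem yields a partial derivative that differs
  by at most e from the one at p.\<close>

lemma chart_linear_approx:
  assumes X: "riemannian_manifold X" "i \<in> chart_index X"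
    and A: "openin (mtop X) A" "A \<subseteq> chart_dom X i" and p: "p \<in> A"
    and f: "\<And>q c. q \<in> A \<Longrightarrow> c < mdim X \<Longrightarrow> has_pd X i c f q (pd X i c f q)"
      "\<And>c. c < mdim X \<Longrightarrow> continuous_map (subtopology (mtop X) A) euclideanreal (pd X i c f)"
    and e: "e > 0"
  shows "\<exists>\<delta>>0. \<forall>q\<in>A. (\<forall>c<mdim X. \<bar>coord X i q c - coord X i p c\<bar> < \<delta>) \<longrightarrow>
     \<bar>f q - f p - (\<Sum>c<mdim X. pd X i c f p * (coord X i q c - coord X i p c))\<bar>
       \<le> e * (\<Sum>c<mdim X. \<bar>coord X i q c - coord X i p c\<bar>)"
proof -
  define d where "d = mdim X"
  define x where "x = coord X i"
  \<comment> \<open>The neighbourhood on which every partial derivative is within e of its value at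
    p; a coordinate box inside it will contain all segments used.\<close>
  define B where "B = {q \<in> A. \<forall>c<d. \<bar>pd X i c f q - pd X i c f p\<bar> < e}"
  have lo: "line_open X i A" by (rule chart_line_open[OF X A])
  have "openin (mtop X) (A \<inter> (\<Inter>c<d. {q \<in> A. \<bar>pd X i c f q - pd X i c f p\<bar> < e}))"
    if "d > 0"
    using that A f(2) by (intro openin_Int openin_INT2) (auto intro!: openin_cont_ball simp: d_def)
  then have "openin (mtop X) B"
    using A(1) by (cases "d = 0") (auto simp: B_def elim!: back_subst[of "openin (mtop X)"])
  then obtain \<delta> where \<delta>: "\<delta> > 0" "\<And>y. (\<forall>c\<ge>d. y c = 0) \<Longrightarrow> (\<forall>c<d. \<bar>y c - x p c\<bar> < \<delta>) \<Longrightarrow> y \<in> x ` B"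
  proof -
    assume *: "\<And>\<delta>. 0 < \<delta> \<Longrightarrow> (\<And>y. \<forall>c\<ge>d. y c = 0 \<Longrightarrow> \<forall>c<d. \<bar>y c - x p c\<bar> < \<delta> \<Longrightarrow> y \<in> x ` B) \<Longrightarrow> thesis"
    have "p \<in> B" "B \<subseteq> chart_dom X i" using p e A by (auto simp: B_def)
    from chart_box[OF X \<open>openin (mtop X) B\<close> this(2,1)] show thesis
      using * unfolding d_def x_def by blast
  qed
  have x0: "x q c = 0" if "q \<in> A" "c \<ge> d" for q c
    using lo that by (auto simp: line_open_def x_def d_def)
  \<comment> \<open>Induction on the number m of leading coordinates in which q may differ from
    p.\<close>
  have main: "\<bar>f q - f p - (\<Sum>c<m. pd X i c f p * (x q c - x p c))\<bar> \<le> e * (\<Sum>c<m. \<bar>x q c - x p c\<bar>)"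
    if "m \<le> d" "q \<in> A" "\<forall>c<d. \<bar>x q c - x p c\<bar> < \<delta>" "\<forall>c\<ge>m. x q c = x p c" for m q
    using that
  proof (induction m arbitrary: q)
    case 0
    then have "x q = x p" by auto
    then have "q = p" using chart_inj[OF X] 0 p A by (auto simp: x_def inj_on_def)
    then show ?case by simp
  next
    case (Suc m)
    \<comment> \<open>Resetting coordinate m to its value at p gives the point q' for the induction
      hypothesis; q is reached from q' along a single coordinate line.\<close>
    have "(x q)(m := x p m) \<in> x ` B" using Suc.prems x0 \<delta>(1) by (intro \<delta>(2)) (auto)
    then obtain q' where q': "q' \<in> B" "x q' = (x q)(m := x p m)" by (metis imageE)
    have q'A: "q' \<in> A" using q' by (auto simp: B_def)
    have IH: "\<bar>f q' - f p - (\<Sum>c<m. pd X i c f p * (x q' c - x p c))\<bar> \<le> e * (\<Sum>c<m. \<bar>x q' c - x p c\<bar>)"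
      using Suc.prems q' q'A \<delta>(1) by (intro Suc.IH) (auto simp: le_less_Suc_eq)
    define \<phi> where "\<phi> = (\<lambda>s. f (coord_line X i m q' s))"
    define r where "r = (\<lambda>s. coord_line X i m q' s)"
    have r: "r s \<in> B" "x (r s) = (x q')(m := s)" if "s \<in> closed_segment (x p m) (x q m)" for s
    proof -
      have "\<bar>s - x p m\<bar> \<le> \<bar>x q m - x p m\<bar>"
        using that by (auto simp: closed_segment_eq_real_ivl split: if_splits)
      also have "\<dots> < \<delta>" using Suc.prems by auto
      finally have "(x q')(m := s) \<in> x ` B" unfolding q' using Suc.prems x0 by (intro \<delta>(2)) auto
      then obtain z where z: "z \<in> B" "x z = (x q')(m := s)" by (metis imageE)
      moreover have "r s = z" unfolding r_def using z by (intro coord_lineI[OF lo]) (auto simp: x_def B_def)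
      ultimately show "r s \<in> B" "x (r s) = (x q')(m := s)" by auto
    qed
    have "(\<phi> has_real_derivative pd X i m f (r s)) (at s)" if "s \<in> closed_segment (x p m) (x q m)" for s
    proof -
      have "has_pd X i m f (r s) (pd X i m f (r s))"
        using f(1) r[OF that] Suc.prems by (auto simp: B_def d_def)
      moreover have "coord_line X i m (r s) = coord_line X i m q'"
        using r(2)[OF that] by (auto simp: coord_line_def x_def)
      ultimately show ?thesis using r(2)[OF that] by (simp add: has_pd_def \<phi>_def x_def)
    qed
    from mvt_segment[OF this] obtain s where s: "s \<in> closed_segment (x p m) (x q m)"
       "\<phi> (x q m) - \<phi> (x p m) = (x q m - x p m) * pd X i m f (r s)" by blast
    have "coord_line X i m q' (x q m) = q"
      by (rule coord_lineI[OF lo]) (use Suc.prems q' in \<open>auto simp: x_def\<close>)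
    moreover have "coord_line X i m q' (x p m) = q'"
      by (rule coord_lineI[OF lo]) (use q' q'A in \<open>auto simp: x_def\<close>)
    ultimately have fq: "f q = f q' + (x q m - x p m) * pd X i m f (r s)"
      using s(2) by (simp add: \<phi>_def)
    have "\<bar>pd X i m f (r s) - pd X i m f p\<bar> \<le> e"
      using r(1)[OF s(1)] Suc.prems by (auto simp: B_def Suc_le_eq intro!: less_imp_le)
    from mult_left_mono[OF this, of "\<bar>x q m - x p m\<bar>"]
    have "\<bar>(x q m - x p m) * (pd X i m f (r s) - pd X i m f p)\<bar> \<le> e * \<bar>x q m - x p m\<bar>"
      by (simp add: abs_mult mult.commute)
    moreover have "(\<Sum>c<m. pd X i c f p * (x q' c - x p c)) = (\<Sum>c<m. pd X i c f p * (x q c - x p c))"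
      "(\<Sum>c<m. \<bar>x q' c - x p c\<bar>) = (\<Sum>c<m. \<bar>x q c - x p c\<bar>)"
      by (auto intro!: sum.cong simp: q')
    moreover have "f q - f p - (\<Sum>c<Suc m. pd X i c f p * (x q c - x p c)) =
      (f q' - f p - (\<Sum>c<m. pd X i c f p * (x q c - x p c))) + (x q m - x p m) * (pd X i m f (r s) - pd X i m f p)"
      by (simp add: fq algebra_simps)
    ultimately show ?case using IH by (simp add: distrib_left)
  qed
  show ?thesis
  proof (intro exI[of _ \<delta>] conjI ballI impI \<delta>(1))
    fix q assume "q \<in> A" "\<forall>c<mdim X. \<bar>coord X i q c - coord X i p c\<bar> < \<delta>"
    with main[of d q] x0 p show "\<bar>f q - f p - (\<Sum>c<mdim X. pd X i c f p * (coord X i q c - coord X i p c))\<bar>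
       \<le> e * (\<Sum>c<mdim X. \<bar>coord X i q c - coord X i p c\<bar>)"
      by (auto simp: x_def d_def)
  qed
qed

text \<open>The curve need only be differentiable at s0 in coordinates, which is what is known of a
  coordinate line of a different chart.\<close>

lemma chart_chain_rule:
  assumes X: "riemannian_manifold X" "i \<in> chart_index X"
    and A: "openin (mtop X) A" "A \<subseteq> chart_dom X i" and p: "\<gamma> s0 \<in> A"
    and f: "smooth_in X i A f"
    and \<gamma>: "\<forall>\<^sub>F s in nhds s0. \<gamma> s \<in> A"
      "\<And>c. c < mdim X \<Longrightarrow> ((\<lambda>s. coord X i (\<gamma> s) c) has_real_derivative \<gamma>' c) (at s0)"
  shows "((\<lambda>s. f (\<gamma> s)) has_real_derivative (\<Sum>c<mdim X. pd X i c f (\<gamma> s0) * \<gamma>' c)) (at s0)"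
proof -
  define d where "d = mdim X"
  define D where "D = (\<lambda>c. pd X i c f (\<gamma> s0))"
  define Q where "Q = (\<lambda>c s. (coord X i (\<gamma> s) c - coord X i (\<gamma> s0) c) / (s - s0))"
  have Q: "(Q c \<longlongrightarrow> \<gamma>' c) (at s0)" if "c < d" for c
    using \<gamma>(2)[of c] that unfolding has_field_derivative_iff Q_def d_def by simp
  define R where "R = (\<lambda>s. (f (\<gamma> s) - f (\<gamma> s0)) / (s - s0) - (\<Sum>c<d. D c * Q c s))"
  define K where "K = (\<Sum>c<d. \<bar>\<gamma>' c\<bar>)"
  have K: "((\<lambda>s. \<Sum>c<d. \<bar>Q c s\<bar>) \<longlongrightarrow> K) (at s0)"
    unfolding K_def by (intro tendsto_sum tendsto_rabs Q) auto
  have "K \<ge> 0" by (auto simp: K_def intro: sum_nonneg)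
  have "(R \<longlongrightarrow> 0) (at s0)"
  proof (rule tendstoI)
    fix e :: real assume "e > 0"
    \<comment> \<open>The sum of the absolute difference quotients tends to K and is eventually
      below K + 1, so the error is eventually below e' (K + 1) = e.\<close>
    define e' where "e' = e / (K + 1)"
    have "e' > 0" using \<open>e > 0\<close> \<open>K \<ge> 0\<close> by (simp add: e'_def)
    obtain \<delta> where \<delta>: "\<delta> > 0" "\<And>q. q \<in> A \<Longrightarrow> (\<forall>c<d. \<bar>coord X i q c - coord X i (\<gamma> s0) c\<bar> < \<delta>) \<Longrightarrow>
       \<bar>f q - f (\<gamma> s0) - (\<Sum>c<d. D c * (coord X i q c - coord X i (\<gamma> s0) c))\<bar>
       \<le> e' * (\<Sum>c<d. \<bar>coord X i q c - coord X i (\<gamma> s0) c\<bar>)"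
      using chart_linear_approx[OF X A p smooth_in_has_pd[OF f] smooth_in_continuous[OF smooth_in_pd[OF _ f]] \<open>e' > 0\<close>]
      unfolding D_def d_def by blast
    have "\<forall>\<^sub>F s in at s0. \<bar>coord X i (\<gamma> s) c - coord X i (\<gamma> s0) c\<bar> < \<delta>" if "c < d" for c
    proof -
      have "((\<lambda>s. coord X i (\<gamma> s) c) \<longlongrightarrow> coord X i (\<gamma> s0) c) (at s0)"
        using DERIV_isCont[OF \<gamma>(2)] that unfolding isCont_def d_def by blast
      from tendstoD[OF this \<delta>(1)] show ?thesis by (simp add: dist_real_def)
    qed
    then have "\<forall>\<^sub>F s in at s0. \<forall>c\<in>{..<d}. \<bar>coord X i (\<gamma> s) c - coord X i (\<gamma> s0) c\<bar> < \<delta>"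
      by (intro eventually_ball_finite) auto
    moreover have "\<forall>\<^sub>F s in at s0. \<gamma> s \<in> A"
      using \<gamma>(1) by (simp add: eventually_at_filter eventually_mono)
    moreover have "\<forall>\<^sub>F s in at s0. (\<Sum>c<d. \<bar>Q c s\<bar>) < K + 1"
      using K by (rule order_tendstoD) simp
    moreover have "\<forall>\<^sub>F s in at s0. s \<noteq> s0" by (simp add: eventually_at_filter)
    ultimately show "\<forall>\<^sub>F s in at s0. dist (R s) 0 < e"
    proof eventually_elim
      case (elim s)
      have "R s = (f (\<gamma> s) - f (\<gamma> s0) - (\<Sum>c<d. D c * (coord X i (\<gamma> s) c - coord X i (\<gamma> s0) c))) / (s - s0)"
        unfolding R_def Q_def
          diff_divide_distrib[of "f (\<gamma> s) - f (\<gamma> s0)" "\<Sum>c<d. D c * (coord X i (\<gamma> s) c - coord X i (\<gamma> s0) c)"]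
        by (simp only: sum_divide_distrib times_divide_eq_right)
      then have "\<bar>R s\<bar> = \<bar>f (\<gamma> s) - f (\<gamma> s0) - (\<Sum>c<d. D c * (coord X i (\<gamma> s) c - coord X i (\<gamma> s0) c))\<bar> / \<bar>s - s0\<bar>"
        by simp
      also have "\<dots> \<le> (e' * (\<Sum>c<d. \<bar>coord X i (\<gamma> s) c - coord X i (\<gamma> s0) c\<bar>)) / \<bar>s - s0\<bar>"
        using elim by (intro divide_right_mono \<delta>(2)) auto
      also have "\<dots> = e' * (\<Sum>c<d. \<bar>Q c s\<bar>)" by (simp only: Q_def abs_divide sum_divide_distrib[symmetric] times_divide_eq_right)
      also have "\<dots> < e' * (K + 1)" using elim \<open>e' > 0\<close> by simp
      also have "\<dots> = e" using \<open>K \<ge> 0\<close> by (simp add: e'_def)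
      finally show ?case by simp
    qed
  qed
  moreover have "((\<lambda>s. \<Sum>c<d. D c * Q c s) \<longlongrightarrow> (\<Sum>c<d. D c * \<gamma>' c)) (at s0)"
    by (intro tendsto_sum tendsto_mult tendsto_const Q) auto
  ultimately have "((\<lambda>s. R s + (\<Sum>c<d. D c * Q c s)) \<longlongrightarrow> 0 + (\<Sum>c<d. D c * \<gamma>' c)) (at s0)"
    by (rule tendsto_add)
  then show ?thesis unfolding has_field_derivative_iff by (simp add: R_def D_def d_def)
qed

section \<open>Symmetry of second derivatives\<close>

lemma mixed_difference:
  fixes \<phi> :: "real \<Rightarrow> real \<Rightarrow> real"
  assumes h: "h > 0" "k > 0"
    and 1: "\<And>s t. s \<in> {s0..s0+h} \<Longrightarrow> t \<in> {t0..t0+k} \<Longrightarrow> ((\<lambda>t. \<phi> s t) has_real_derivative \<phi>1 s t) (at t)"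
    and 2: "\<And>s t. s \<in> {s0..s0+h} \<Longrightarrow> t \<in> {t0..t0+k} \<Longrightarrow> ((\<lambda>s. \<phi>1 s t) has_real_derivative \<phi>2 s t) (at s)"
  shows "\<exists>s\<in>{s0..s0+h}. \<exists>t\<in>{t0..t0+k}.
     \<phi> (s0 + h) (t0 + k) - \<phi> (s0 + h) t0 - \<phi> s0 (t0 + k) + \<phi> s0 t0 = h * k * \<phi>2 s t"
proof -
  have "((\<lambda>t. \<phi> (s0 + h) t - \<phi> s0 t) has_real_derivative (\<phi>1 (s0 + h) t - \<phi>1 s0 t)) (at t)"
    if "t \<in> {t0..t0+k}" for t
    using that h by (intro DERIV_diff 1) auto
  then have "\<exists>z>t0. z < t0 + k \<and> \<phi> (s0 + h) (t0 + k) - \<phi> s0 (t0 + k) - (\<phi> (s0 + h) t0 - \<phi> s0 t0)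
     = (t0 + k - t0) * (\<phi>1 (s0 + h) z - \<phi>1 s0 z)"
    using h by (intro MVT2) auto
  then obtain t where t': "t0 < t" "t < t0 + k" and
    t2: "\<phi> (s0 + h) (t0 + k) - \<phi> s0 (t0 + k) - (\<phi> (s0 + h) t0 - \<phi> s0 t0) = k * (\<phi>1 (s0 + h) t - \<phi>1 s0 t)"
    by auto
  note t = atLeastAtMost_iff[THEN iffD2, OF conjI[OF t'[THEN less_imp_le]]] t2
  have "\<exists>z>s0. z < s0 + h \<and> \<phi>1 (s0 + h) t - \<phi>1 s0 t = (s0 + h - s0) * \<phi>2 z t"
    using h t(1) by (intro MVT2 2) auto
  then obtain s where s': "s0 < s" "s < s0 + h" and s2: "\<phi>1 (s0 + h) t - \<phi>1 s0 t = h * \<phi>2 s t" by auto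
  note s = atLeastAtMost_iff[THEN iffD2, OF conjI[OF s'[THEN less_imp_le]]] s2
  show ?thesis by (rule bexI[OF _ s(1)], rule bexI[OF _ t(1)]) (use s t in \<open>simp add: algebra_simps\<close>)
qed

text \<open>The second difference over a square of side h equals h^2 times either mixed derivative,
  each taken at some point of the square. Continuity puts both within e/2 of their values at
  p.\<close>

lemma pd_commute:
  assumes X: "riemannian_manifold X" "i \<in> chart_index X"
    and A: "openin (mtop X) A" "A \<subseteq> chart_dom X i" and p: "p \<in> A"
    and f: "smooth_in X i A f" and ab: "a < mdim X" "b < mdim X"
  shows "pd X i a (pd X i b f) p = pd X i b (pd X i a f) p"
proof (cases "a = b")
  case False
  define F1 where "F1 = pd X i a (pd X i b f)"
  define F2 where "F2 = pd X i b (pd X i a f)"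
  have lo: "line_open X i A" by (rule chart_line_open[OF X A])
  have c1: "continuous_map (subtopology (mtop X) A) euclideanreal F1"
    and c2: "continuous_map (subtopology (mtop X) A) euclideanreal F2"
    unfolding F1_def F2_def using f ab by (auto intro!: smooth_in_continuous smooth_in_pd)
  have "\<bar>F1 p - F2 p\<bar> \<le> 0 + e" if e: "e > 0" for e
  proof -
    define B where "B = {q \<in> A. \<bar>F1 q - F1 p\<bar> < e / 2} \<inter> {q \<in> A. \<bar>F2 q - F2 p\<bar> < e / 2}"
    have "openin (mtop X) B" unfolding B_def by (intro openin_Int openin_cont_ball A c1 c2)
    moreover have "p \<in> B" "B \<subseteq> A" using p e by (auto simp: B_def)
    ultimately obtain \<delta> where \<delta>: "\<delta> > 0"
      "\<And>y. (\<forall>c\<ge>mdim X. y c = 0) \<Longrightarrow> (\<forall>c<mdim X. \<bar>y c - coord X i p c\<bar> < \<delta>) \<Longrightarrow> y \<in> coord X i ` B"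
      using chart_box[OF X, of B p] A(2) by blast
    \<comment> \<open>Half of \<delta> keeps the closed square inside the open box.\<close>
    define h where "h = \<delta> / 2"
    have h: "h > 0" using \<delta> by (simp add: h_def)
    define s0 where "s0 = coord X i p a"
    define t0 where "t0 = coord X i p b"
    define y where "y = (\<lambda>s t. (coord X i p)(a := s, b := t))"
    define P where "P = (\<lambda>s t. inv_into (chart_dom X i) (coord X i) (y s t))"
    have P: "P s t \<in> B" "coord X i (P s t) = y s t" if "s \<in> {s0..s0+h}" "t \<in> {t0..t0+h}" for s t
    proof -
      have "y s t \<in> coord X i ` B"
        using that ab h lo p unfolding y_def line_open_def
        by (intro \<delta>(2)) (auto simp: s0_def t0_def h_def)
      then obtain q where q: "q \<in> B" "coord X i q = y s t" by (metis imageE)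
      then have "P s t = q" unfolding P_def using chart_inj[OF X] \<open>B \<subseteq> A\<close> A(2)
        by (metis inv_into_f_f subset_iff)
      with q show "P s t \<in> B" "coord X i (P s t) = y s t" by auto
    qed
    have D: "((\<lambda>s. g (P s t)) has_real_derivative pd X i a g (P s t)) (at s)"
       "((\<lambda>t. g (P s t)) has_real_derivative pd X i b g (P s t)) (at t)"
      if st: "s \<in> {s0..s0+h}" "t \<in> {t0..t0+h}" and g: "smooth_in X i A g" for s t g
    proof -
      have "has_pd X i a g (P s t) (pd X i a g (P s t))" "has_pd X i b g (P s t) (pd X i b g (P s t))"
        using smooth_in_has_pd[OF g] P(1)[OF st] \<open>B \<subseteq> A\<close> ab by auto
      moreover have "coord_line X i a (P s t) = (\<lambda>s. P s t)" "coord_line X i b (P s t) = P s"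
      proof -
        have "(y s t)(a := s') = y s' t" "(y s t)(b := s') = y s s'" for s'
          using False by (auto simp: y_def fun_eq_iff)
        then show "coord_line X i a (P s t) = (\<lambda>s. P s t)" "coord_line X i b (P s t) = P s"
          unfolding coord_line_def P(2)[OF st] by (simp_all add: P_def)
      qed
      moreover have "coord X i (P s t) a = s" "coord X i (P s t) b = t"
        unfolding P(2)[OF st] using False by (auto simp: y_def)
      ultimately show "((\<lambda>s. g (P s t)) has_real_derivative pd X i a g (P s t)) (at s)"
       "((\<lambda>t. g (P s t)) has_real_derivative pd X i b g (P s t)) (at t)"
        by (simp_all add: has_pd_def)
    qed
    obtain s t where 1: "s \<in> {s0..s0+h}" "t \<in> {t0..t0+h}"
      "f (P (s0 + h) (t0 + h)) - f (P (s0 + h) t0) - f (P s0 (t0 + h)) + f (P s0 t0) = h * h * F1 (P s t)"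
      using mixed_difference[OF h h, of s0 t0 "\<lambda>s t. f (P s t)" "\<lambda>s t. pd X i b f (P s t)" "\<lambda>s t. F1 (P s t)"]
        D(2)[OF _ _ f] D(1)[OF _ _ smooth_in_pd[OF ab(2) f]] by (auto simp: F1_def)
    obtain t' s' where 2: "t' \<in> {t0..t0+h}" "s' \<in> {s0..s0+h}"
      "f (P (s0 + h) (t0 + h)) - f (P s0 (t0 + h)) - f (P (s0 + h) t0) + f (P s0 t0) = h * h * F2 (P s' t')"
      using mixed_difference[OF h h, of t0 s0 "\<lambda>t s. f (P s t)" "\<lambda>t s. pd X i a f (P s t)" "\<lambda>t s. F2 (P s t)"]
        D(1)[OF _ _ f] D(2)[OF _ _ smooth_in_pd[OF ab(1) f]] by (auto simp: F2_def)
    have "h * h * F1 (P s t) = h * h * F2 (P s' t')" using 1(3) 2(3) by linarith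
    then have "F1 (P s t) = F2 (P s' t')" using h by simp
    moreover have "\<bar>F1 (P s t) - F1 p\<bar> < e / 2" "\<bar>F2 (P s' t') - F2 p\<bar> < e / 2"
      using P(1)[OF 1(1,2)] P(1)[OF 2(2,1)] by (auto simp: B_def)
    ultimately show ?thesis by linarith
  qed
  then have "\<bar>F1 p - F2 p\<bar> \<le> 0" by (rule field_le_epsilon)
  then show ?thesis by (simp add: F1_def F2_def)
qed simp

section \<open>Chart independence and smoothness of the Laplacian\<close>

text \<open>From g = J^t g' J and J K = 1 follows J^t g' = g K, whence (J B J^t) g' = J B g K = J K
  = 1. The product in the other order follows by symmetry.\<close>

lemma is_inverse_pullback:
  assumes B: "is_inverse d g B" and Bsym: "\<And>a b. a < d \<Longrightarrow> b < d \<Longrightarrow> B a b = B b a"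
    and g'sym: "\<And>a b. a < d \<Longrightarrow> b < d \<Longrightarrow> g' a b = g' b a"
    and g: "\<And>a b. a < d \<Longrightarrow> b < d \<Longrightarrow> g a b = (\<Sum>c<d. \<Sum>e<d. g' c e * J c a * J e b)"
    and JK: "\<And>a b. a < d \<Longrightarrow> b < d \<Longrightarrow> (\<Sum>c<d. J a c * K c b) = (if a = b then 1 else 0)"
  shows "is_inverse d g' (\<lambda>v w. \<Sum>a<d. \<Sum>b<d. B a b * J v a * J w b)"
proof -
  define M where "M = (\<lambda>v w. \<Sum>a<d. \<Sum>b<d. B a b * J v a * J w b)"
  have Msym: "M v w = M w v" if "v < d" "w < d" for v w
    unfolding M_def mult.assoc by (subst contraction_sym[OF Bsym]) (simp_all add: mult_ac)
  define L where "L = (\<lambda>b x. \<Sum>w<d. J w b * g' w x)"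
  have 1: "L b u = (\<Sum>e<d. g b e * K e u)" if "b < d" "u < d" for b u
  proof -
    have "(\<Sum>e<d. g b e * K e u) = (\<Sum>e<d. (\<Sum>x<d. L b x * J x e) * K e u)"
    proof (intro sum.cong refl arg_cong2[where f = "(*)"], goal_cases)
      case (1 e)
      then have "g b e = (\<Sum>c<d. \<Sum>e'<d. g' c e' * J c b * J e' e)" using that by (auto intro: g)
      also have "\<dots> = (\<Sum>e'<d. \<Sum>c<d. g' c e' * J c b * J e' e)" by (rule sum.swap)
      finally show ?case by (simp add: L_def sum_distrib_left sum_distrib_right mult_ac)
    qed
    also have "\<dots> = L b u" unfolding matrix_mult_assoc using that by (simp add: JK sum_delta_left)
    finally show ?thesis by simp
  qed
  have left: "(\<Sum>w<d. M v w * g' w u) = (if v = u then 1 else 0)" if vu: "v < d" "u < d" for v u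
  proof -
    have "(\<Sum>w<d. M v w * g' w u) = (\<Sum>w<d. (\<Sum>a<d. J v a * (\<Sum>b<d. B a b * J w b)) * g' w u)"
      by (simp add: M_def sum_distrib_left sum_distrib_right mult_ac)
    also have "\<dots> = (\<Sum>a<d. J v a * (\<Sum>w<d. (\<Sum>b<d. B a b * J w b) * g' w u))"
      by (rule matrix_mult_assoc[where B = "\<lambda>a w. \<Sum>b<d. B a b * J w b"])
    also have "\<dots> = (\<Sum>a<d. J v a * (\<Sum>b<d. B a b * L b u))"
      unfolding L_def by (simp only: matrix_mult_assoc[where B = "\<lambda>b w. J w b"])
    also have "\<dots> = (\<Sum>a<d. J v a * (\<Sum>b<d. B a b * (\<Sum>e<d. g b e * K e u)))"
      using vu by (simp add: 1)
    also have "\<dots> = (\<Sum>a<d. J v a * (\<Sum>e<d. (\<Sum>b<d. B a b * g b e) * K e u))"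
      by (simp only: matrix_mult_assoc)
    also have "\<dots> = (\<Sum>a<d. J v a * K a u)"
      using B vu by (simp add: is_inverse_def sum_delta_left)
    finally show ?thesis using vu by (simp add: JK)
  qed
  have "(\<Sum>w<d. g' v w * M w u) = (if v = u then 1 else 0)" if vu: "v < d" "u < d" for v u
  proof -
    have "(\<Sum>w<d. g' v w * M w u) = (\<Sum>w<d. M u w * g' w v)"
      by (rule sum.cong) (use vu in \<open>auto simp: g'sym[of v] Msym[of _ u] mult.commute\<close>)
    then show ?thesis using left[OF vu(2,1)] by auto
  qed
  with left show ?thesis unfolding is_inverse_def M_def[symmetric] by blast
qed

lemma riemannian_metric:
  assumes X: "riemannian_manifold X" "i \<in> chart_index X"
  shows "a < mdim X \<Longrightarrow> b < mdim X \<Longrightarrow> smooth_in X i (chart_dom X i) (gcomp X i a b)"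
    "p \<in> chart_dom X i \<Longrightarrow> spd (mdim X) (\<lambda>a b. gcomp X i a b p)"
    "p \<in> chart_dom X i \<Longrightarrow> a < mdim X \<Longrightarrow> b < mdim X \<Longrightarrow>
       ginv X i a b p = spd_inv (mdim X) (\<lambda>a b. gcomp X i a b p) a b"
    "p \<in> chart_dom X i \<Longrightarrow> is_inverse (mdim X) (\<lambda>a b. gcomp X i a b p) (\<lambda>a b. ginv X i a b p)"
proof -
  show "a < mdim X \<Longrightarrow> b < mdim X \<Longrightarrow> smooth_in X i (chart_dom X i) (gcomp X i a b)"
    using X unfolding riemannian_manifold_def by blast
  have spd: "spd (mdim X) (\<lambda>a b. gcomp X i a b p)" if "p \<in> chart_dom X i" for p
    using X that unfolding riemannian_manifold_def spd_def by blast
  then show "p \<in> chart_dom X i \<Longrightarrow> spd (mdim X) (\<lambda>a b. gcomp X i a b p)" .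
  have eq: "ginv X i a b p = spd_inv (mdim X) (\<lambda>a b. gcomp X i a b p) a b"
    if "p \<in> chart_dom X i" "a < mdim X" "b < mdim X" for p a b
    unfolding ginv_def by (rule matrix_inverse_eq[OF spd_inv[OF spd]]) (use that in auto)
  then show "p \<in> chart_dom X i \<Longrightarrow> a < mdim X \<Longrightarrow> b < mdim X \<Longrightarrow>
       ginv X i a b p = spd_inv (mdim X) (\<lambda>a b. gcomp X i a b p) a b" .
  show "is_inverse (mdim X) (\<lambda>a b. gcomp X i a b p) (\<lambda>a b. ginv X i a b p)" if p: "p \<in> chart_dom X i"
    using spd_inv[OF spd[OF p]] by (simp add: is_inverse_def eq[OF p])
qed

lemma riemannian_transition:
  assumes "riemannian_manifold X" "i \<in> chart_index X" "j \<in> chart_index X"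
  shows "a < mdim X \<Longrightarrow> smooth_in X i (chart_dom X i \<inter> chart_dom X j) (\<lambda>p. coord X j p a)"
    "p \<in> chart_dom X i \<inter> chart_dom X j \<Longrightarrow> a < mdim X \<Longrightarrow> b < mdim X \<Longrightarrow>
       gcomp X i a b p = (\<Sum>c<mdim X. \<Sum>e<mdim X. gcomp X j c e p *
          pd X i a (\<lambda>q. coord X j q c) p * pd X i b (\<lambda>q. coord X j q e) p)"
proof -
  from assms(1) have 1: "\<forall>i\<in>chart_index X. \<forall>j\<in>chart_index X. \<forall>a<mdim X.
       smooth_in X i (chart_dom X i \<inter> chart_dom X j) (\<lambda>p. coord X j p a)"
    unfolding riemannian_manifold_def by (elim conjE) assumption
  from assms(1) have 2: "\<forall>i\<in>chart_index X. \<forall>j\<in>chart_index X. \<forall>p\<in>chart_dom X i \<inter> chart_dom X j.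
       \<forall>a<mdim X. \<forall>b<mdim X.
         gcomp X i a b p =
           (\<Sum>c<mdim X. \<Sum>e<mdim X. gcomp X j c e p *
              pd X i a (\<lambda>q. coord X j q c) p * pd X i b (\<lambda>q. coord X j q e) p)"
    unfolding riemannian_manifold_def by (elim conjE) assumption
  show "a < mdim X \<Longrightarrow> smooth_in X i (chart_dom X i \<inter> chart_dom X j) (\<lambda>p. coord X j p a)"
    using 1 assms by blast
  show "p \<in> chart_dom X i \<inter> chart_dom X j \<Longrightarrow> a < mdim X \<Longrightarrow> b < mdim X \<Longrightarrow>
       gcomp X i a b p = (\<Sum>c<mdim X. \<Sum>e<mdim X. gcomp X j c e p *
          pd X i a (\<lambda>q. coord X j q c) p * pd X i b (\<lambda>q. coord X j q e) p)"
    using 2 assms by blast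
qed

text \<open>The chain rule is applied to a coordinate line of chart i, read as a curve in chart
  j.\<close>

lemma transition_has_pd:
  assumes X: "riemannian_manifold X" "i \<in> chart_index X" "j \<in> chart_index X"
    and h: "smooth_in X j (chart_dom X i \<inter> chart_dom X j) h"
    and q: "q \<in> chart_dom X i \<inter> chart_dom X j" and a: "a < mdim X"
  shows "has_pd X i a h q (\<Sum>c<mdim X. pd X j c h q * pd X i a (\<lambda>r. coord X j r c) q)"
proof -
  let ?A = "chart_dom X i \<inter> chart_dom X j"
  have A: "openin (mtop X) ?A" by (intro openin_Int riemannian_chart(1) X)
  have lo: "line_open X i ?A" by (rule chart_line_open[OF X(1,2) A]) auto
  have sm: "smooth_in X i ?A (\<lambda>r. coord X j r c)" if "c < mdim X" for c
    using riemannian_transition(1)[OF X that] .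
  have self: "coord_line X i a q (coord X i q a) = q" by (rule coord_line_self[OF lo q])
  have "((\<lambda>s. h (coord_line X i a q s)) has_real_derivative
     (\<Sum>c<mdim X. pd X j c h (coord_line X i a q (coord X i q a)) * pd X i a (\<lambda>r. coord X j r c) q)) (at (coord X i q a))"
  proof (rule chart_chain_rule[OF X(1,3) A _ _ h])
    show "\<forall>\<^sub>F s in nhds (coord X i q a). coord_line X i a q s \<in> ?A"
      using line_open_eventually[OF lo q a] by (rule eventually_mono) auto
    show "((\<lambda>s. coord X j (coord_line X i a q s) c) has_real_derivative pd X i a (\<lambda>r. coord X j r c) q)
      (at (coord X i q a))" if "c < mdim X" for c
      using smooth_in_has_pd[OF sm[OF that] q a] by (simp add: has_pd_def)
  qed (use self q in auto)
  then show ?thesis by (simp add: has_pd_def self)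
qed

lemma laplacian_in_chart_change:
  assumes X: "riemannian_manifold X" "i \<in> chart_index X" "j \<in> chart_index X"
    and f: "smooth_in X j (chart_dom X i \<inter> chart_dom X j) f"
    and p: "p \<in> chart_dom X i \<inter> chart_dom X j"
  shows "laplacian_in X i f p = laplacian_in X j f p"
proof -
  let ?A = "chart_dom X i \<inter> chart_dom X j"
  let ?d = "mdim X"
  have A: "openin (mtop X) ?A" by (intro openin_Int riemannian_chart(1) X)
  have lo: "line_open X i ?A" "line_open X j ?A"
    by (auto intro!: chart_line_open[OF X(1) _ A] X)
  have sm: "smooth_in X i ?A (\<lambda>r. coord X j r c)" if "c < mdim X" for c
    using riemannian_transition(1)[OF X that] .
  define J where "J = (\<lambda>c a q. pd X i a (\<lambda>r. coord X j r c) q)"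
  define K where "K = (\<lambda>c a q. pd X j a (\<lambda>r. coord X i r c) q)"
  define S where "S = (\<lambda>c a b. pd X i a (J c b) p)"
  have chain: "has_pd X i a h q (\<Sum>c<?d. pd X j c h q * J c a q)" if "smooth_in X j ?A h" "q \<in> ?A" "a < ?d" for h q a
    using transition_has_pd[OF X that] by (simp add: J_def)
  have smJ: "smooth_in X i ?A (J c b)" if "c < ?d" "b < ?d" for b c
    unfolding J_def by (intro smooth_in_pd sm that)
  have JS: "has_pd X i a (J c b) p (S c a b)" if "a < ?d" "b < ?d" "c < ?d" for a b c
    unfolding S_def using smooth_in_has_pd[OF smJ p] that by blast
  have g_smooth: "smooth_in X j ?A (gcomp X j u w)" if "u < ?d" "w < ?d" for u w
    using smooth_in_mono[OF _ riemannian_metric(1)[OF X(1,3) that]] by blast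
  have g_trans: "gcomp X i a b q = (\<Sum>c<?d. \<Sum>e<?d. gcomp X j c e q * J c a q * J e b q)"
    if "q \<in> ?A" "a < ?d" "b < ?d" for q a b
    using riemannian_transition(2)[OF X that] by (simp add: J_def)
  have gsym: "gcomp X j a b p = gcomp X j b a p" if "a < ?d" "b < ?d" for a b
    using riemannian_metric(2)[OF X(1,3)] p that by (auto simp: spd_def)
  have Bsym: "ginv X i a b p = ginv X i b a p" if "a < ?d" "b < ?d" for a b
    using riemannian_metric(3)[OF X(1,2)] p that spd_inv_sym by auto
  \<comment> \<open>The Jacobians of the two transitions are inverse to each other: the coordinate
    function a of chart j is differentiated in chart j by the chain rule through chart i.\<close>
  have KJ: "(\<Sum>c<?d. J a c p * K c b p) = (if a = b then 1 else 0)" if "a < ?d" "b < ?d" for a b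
  proof -
    have "has_pd X j b (\<lambda>r. coord X j r a) p (\<Sum>c<?d. J a c p * K c b p)"
      using transition_has_pd[OF X(1,3,2), of "\<lambda>r. coord X j r a" p b] sm that p
      by (simp add: J_def K_def Int_commute)
    from has_pd_imp_pd[OF this] has_pd_imp_pd[OF has_pd_coord[OF lo(2) p that(2), of a]]
    show ?thesis by auto
  qed
  have inv': "is_inverse ?d (\<lambda>a b. gcomp X j a b p) (\<lambda>v w. \<Sum>a<?d. \<Sum>b<?d. ginv X i a b p * J v a p * J w b p)"
  proof (rule is_inverse_pullback)
    show "is_inverse ?d (\<lambda>a b. gcomp X i a b p) (\<lambda>a b. ginv X i a b p)"
      using riemannian_metric(4)[OF X(1,2)] p by auto
    show "gcomp X i a b p = (\<Sum>c<?d. \<Sum>e<?d. gcomp X j c e p * J c a p * J e b p)" if "a < ?d" "b < ?d" for a b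
      using g_trans[OF p that] .
    show "(\<Sum>c<?d. J a c p * K c b p) = (if a = b then 1 else 0)" if "a < ?d" "b < ?d" for a b
      using KJ[OF that] .
  qed (use Bsym gsym in auto)
  have inv: "is_inverse ?d (\<lambda>a b. gcomp X j a b p) (\<lambda>a b. ginv X j a b p)"
    using riemannian_metric(4)[OF X(1,3)] p by auto
  have "lap_data ?d (\<lambda>a b. ginv X i a b p) (\<lambda>a b c. pd X i a (gcomp X i b c) p)
        (\<lambda>a b. pd X i a (pd X i b f) p) (\<lambda>c. pd X i c f p) =
      lap_data ?d (\<lambda>a b. ginv X j a b p) (\<lambda>a b c. pd X j a (gcomp X j b c) p)
        (\<lambda>a b. pd X j a (pd X j b f) p) (\<lambda>c. pd X j c f p)"
  proof (rule lap_data_change[where J = "\<lambda>c a. J c a p" and S = S and g' = "\<lambda>a b. gcomp X j a b p"])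
    show "S c a b = S c b a" if "c < ?d" "a < ?d" "b < ?d" for a b c
      unfolding S_def J_def by (rule pd_commute[OF X(1,2) A _ p sm]) (use that in auto)
    show "(\<Sum>w<?d. ginv X j v w p * gcomp X j w u p) = (if v = u then 1 else 0)" if "v < ?d" "u < ?d" for u v
      using inv that by (auto simp: is_inverse_def)
    show "ginv X j v w p = (\<Sum>a<?d. \<Sum>b<?d. ginv X i a b p * J v a p * J w b p)" if "v < ?d" "w < ?d" for v w
      using is_inverse_unique[OF inv inv' that] .
    show "pd X i c f p = (\<Sum>a<?d. pd X j a f p * J a c p)" if "c < ?d" for c
      by (rule has_pd_imp_pd[OF chain[OF f p that]])
    show "pd X i a (pd X i b f) p =
        (\<Sum>c<?d. (\<Sum>e<?d. pd X j e (pd X j c f) p * J e a p) * J c b p + pd X j c f p * S c a b)"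
      if ab: "a < ?d" "b < ?d" for a b
    proof -
      have "pd X i b f q = (\<Sum>c<?d. pd X j c f q * J c b q)" if "q \<in> ?A" for q
        by (rule has_pd_imp_pd[OF chain[OF f that ab(2)]])
      then have "pd X i a (pd X i b f) p = pd X i a (\<lambda>q. \<Sum>c<?d. pd X j c f q * J c b q) p"
        by (rule pd_cong[OF lo(1) p ab(1)])
      also have "\<dots> = (\<Sum>c<?d. (\<Sum>e<?d. pd X j e (pd X j c f) p * J e a p) * J c b p + pd X j c f p * S c a b)"
        using ab by (intro has_pd_imp_pd[OF has_pd_sum] has_pd_mult[OF lo(1) p] chain smooth_in_pd f p JS) auto
      finally show ?thesis .
    qed
    \<comment> \<open>This is the derivative of the transformation law of the metric; the terms with
      \<open>S\<close> come from differentiating the Jacobians.\<close>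
    show "pd X i a (gcomp X i b e) p = (\<Sum>u<?d. \<Sum>w<?d.
       (\<Sum>v<?d. pd X j v (gcomp X j u w) p * J v a p) * J u b p * J w e p
         + gcomp X j u w p * (S u a b * J w e p + J u b p * S w a e))"
      if abe: "a < ?d" "b < ?d" "e < ?d" for a b e
    proof -
      have "pd X i a (gcomp X i b e) p = pd X i a (\<lambda>q. \<Sum>u<?d. \<Sum>w<?d. gcomp X j u w q * J u b q * J w e q) p"
        by (rule pd_cong[OF lo(1) p abe(1)]) (use g_trans abe in auto)
      also have "\<dots> = (\<Sum>u<?d. \<Sum>w<?d.
         ((\<Sum>v<?d. pd X j v (gcomp X j u w) p * J v a p) * J u b p + gcomp X j u w p * S u a b) * J w e p
          + gcomp X j u w p * J u b p * S w a e)"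
        using abe by (intro has_pd_imp_pd[OF has_pd_sum] has_pd_sum has_pd_mult[OF lo(1) p] chain g_smooth p JS) auto
      finally show ?thesis by (simp add: algebra_simps)
    qed
  qed (use Bsym gsym in auto)
  then show ?thesis by (simp only: laplacian_in_eq_lap_data)
qed

text \<open>Removes the pointwise choice in \<open>laplacian\<close>: near a point the Laplacian
  becomes one coordinate expression, which can be differentiated again.\<close>

lemma laplacian_eq_in:
  assumes X: "riemannian_manifold X" "i \<in> chart_index X" and f: "smooth_fun X f" and p: "p \<in> chart_dom X i"
  shows "laplacian X f p = laplacian_in X i f p"
proof -
  define j where "j = (SOME i. i \<in> chart_index X \<and> p \<in> chart_dom X i)"
  have j: "j \<in> chart_index X \<and> p \<in> chart_dom X j"
    unfolding j_def by (rule someI[of _ i]) (use X p in auto)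
  have "smooth_in X i (chart_dom X i) f" using f X by (auto simp: smooth_fun_def)
  then have "smooth_in X i (chart_dom X j \<inter> chart_dom X i) f" by (rule smooth_in_mono[rotated]) auto
  then have "laplacian_in X j f p = laplacian_in X i f p"
    using laplacian_in_chart_change X j p by (metis IntI)
  then show ?thesis by (simp add: laplacian_def j_def)
qed

section \<open>Smoothness of the inverse metric and of the Laplacian\<close>

text \<open>The recursion for the inverse consists of sums, products and reciprocals of Schur
  complements, and these are positive.\<close>

lemma smooth_in_spd_inv:
  assumes lo: "line_open M i A"
  shows "(\<And>p. p \<in> A \<Longrightarrow> spd d (\<lambda>a b. g a b p)) \<Longrightarrow>
    (\<And>a b. a < d \<Longrightarrow> b < d \<Longrightarrow> smooth_in M i A (g a b)) \<Longrightarrow>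
    smooth_in M i A (\<lambda>p. spd_inv d (\<lambda>a b. g a b p) a b)"
proof (induction d arbitrary: a b)
  case 0
  then show ?case by (simp add: smooth_in_const)
next
  case (Suc d)
  have spd: "spd d (\<lambda>a b. g a b p)" if "p \<in> A" for p using Suc.prems(1)[OF that] by (rule spd_Suc)
  have IH: "smooth_in M i A (\<lambda>p. spd_inv d (\<lambda>a b. g a b p) a b)" for a b
    using Suc spd by auto
  have u: "smooth_in M i A (\<lambda>p. \<Sum>c<d. spd_inv d (\<lambda>a b. g a b p) a c * g c d p)" for a
    by (intro smooth_in_sum smooth_in_mult IH Suc.prems lo) auto
  have nz: "g d d p - (\<Sum>a<d. g d a p * (\<Sum>c<d. spd_inv d (\<lambda>a b. g a b p) a c * g c d p)) \<noteq> 0" if "p \<in> A" for p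
    using spd_schur_pos[OF Suc.prems(1)[OF that] spd_inv[OF spd[OF that]]] by simp
  have s: "smooth_in M i A (\<lambda>p. inverse (g d d p - (\<Sum>a<d. g d a p * (\<Sum>c<d. spd_inv d (\<lambda>a b. g a b p) a c * g c d p))))"
    by (intro smooth_in_inverse[OF lo nz] smooth_in_diff smooth_in_sum smooth_in_mult lo u Suc.prems) auto
  show ?case
    using smooth_in_mult[OF lo u s] smooth_in_uminus[OF lo smooth_in_mult[OF lo u s]]
      smooth_in_add[OF lo IH smooth_in_mult[OF lo smooth_in_mult[OF lo u u] s]] s
    by (cases "a < d"; cases "b < d") (simp_all add: Let_def)
qed

lemma smooth_in_laplacian_in:
  assumes X: "riemannian_manifold X" "i \<in> chart_index X" and f: "smooth_in X i (chart_dom X i) f"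
  shows "smooth_in X i (chart_dom X i) (laplacian_in X i f)"
proof -
  have lo: "line_open X i (chart_dom X i)" by (rule chart_line_open[OF X riemannian_chart(1)[OF X]]) auto
  have ginv: "smooth_in X i (chart_dom X i) (ginv X i a b)" if "a < mdim X" "b < mdim X" for a b
    by (rule smooth_in_cong[OF lo _ smooth_in_spd_inv[OF lo, of "mdim X" "gcomp X i" a b]])
      (use riemannian_metric[OF X] that in auto)
  have chr: "smooth_in X i (chart_dom X i) (christoffel X i c a b)" if "a < mdim X" "b < mdim X" "c < mdim X" for a b c
  proof (rule smooth_in_cong[OF lo])
    show "smooth_in X i (chart_dom X i) (\<lambda>p. 1 / 2 * (\<Sum>e<mdim X. ginv X i c e p *
     (pd X i a (gcomp X i b e) p + pd X i b (gcomp X i a e) p - pd X i e (gcomp X i a b) p)))"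
      using that by (intro smooth_in_mult[OF lo] smooth_in_sum[OF lo] smooth_in_add[OF lo]
        smooth_in_diff[OF lo] smooth_in_const smooth_in_pd ginv riemannian_metric(1)[OF X]) auto
  qed (simp add: christoffel_def)
  show ?thesis
    unfolding laplacian_in_def[abs_def]
    by (intro smooth_in_sum[OF lo] smooth_in_mult[OF lo] smooth_in_diff[OF lo] ginv smooth_in_pd f chr) auto
qed

lemma smooth_fun_laplacian:
  assumes X: "riemannian_manifold X" and f: "smooth_fun X f"
  shows "smooth_fun X (laplacian X f)"
  unfolding smooth_fun_def
proof
  fix i assume i: "i \<in> chart_index X"
  have lo: "line_open X i (chart_dom X i)" by (rule chart_line_open[OF X i riemannian_chart(1)[OF X i]]) auto
  have "smooth_in X i (chart_dom X i) (laplacian_in X i f)"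
    using f i by (intro smooth_in_laplacian_in X) (auto simp: smooth_fun_def)
  then show "smooth_in X i (chart_dom X i) (laplacian X f)"
    by (rule smooth_in_cong[OF lo, rotated]) (use laplacian_eq_in[OF X i f] in auto)
qed

section \<open>Charts of the sphere, of products and of the ambient space\<close>

lemma round_sphere_simps [simp]:
  "mdim (round_sphere l) = l" "chart_index (round_sphere l) = UNIV" "mtop (round_sphere l) = nsphere l"
  "chart_dom (round_sphere l) N = {x \<in> topspace (nsphere l). x l \<noteq> pole_sign N}"
  "coord (round_sphere l) = stereographic l"
  by (simp_all add: round_sphere_def)

lemma topspace_nsphere: "topspace (nsphere l) = {x. (\<forall>i\<ge>Suc l. x i = 0) \<and> (\<Sum>i\<le>l. (x i)\<^sup>2) = 1}"
  by (auto simp: nsphere_def topspace_Euclidean_space)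

text \<open>The second intersection of the sphere with the line through the pole and the point y of
  the equatorial hyperplane.\<close>

definition stereographic_inv :: "nat \<Rightarrow> bool \<Rightarrow> (nat \<Rightarrow> real) \<Rightarrow> nat \<Rightarrow> real" where
  "stereographic_inv l N y = (\<lambda>a. let r = (\<Sum>c<l. (y c)\<^sup>2) in
     if a < l then 2 * y a / (r + 1) else if a = l then pole_sign N * (r - 1) / (r + 1) else 0)"

lemma pole_sign_square: "pole_sign N * pole_sign N = 1"
  by (simp add: pole_sign_def)

lemma stereographic_inv_left:
  assumes x: "x \<in> chart_dom (round_sphere l) N"
  shows "stereographic_inv l N (stereographic l N x) = x"
proof -
  define \<sigma> where "\<sigma> = pole_sign N"
  define u where "u = 1 - \<sigma> * x l"
  define r where "r = (\<Sum>c<l. (stereographic l N x c)\<^sup>2)"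
  have \<sigma>: "\<sigma> * \<sigma> = 1" by (simp add: \<sigma>_def pole_sign_square)
  have u: "u \<noteq> 0"
  proof
    assume "u = 0"
    then have "\<sigma> * x l = 1" by (simp add: u_def)
    then have "\<sigma> * \<sigma> * x l = \<sigma>" by (simp add: mult.assoc)
    then show False using x by (simp add: \<sigma>) (simp add: \<sigma>_def)
  qed
  have sp: "(\<Sum>c<l. (x c)\<^sup>2) + (x l)\<^sup>2 = 1" "x i = 0" if "i > l" for i
    using x that by (auto simp: topspace_nsphere lessThan_Suc_atMost[symmetric])
  have sp1: "(\<Sum>c<l. (x c)\<^sup>2) = 1 - (x l)\<^sup>2" using sp(1)[of "Suc l"] by simp
  have "r = (\<Sum>c<l. (x c)\<^sup>2) / u\<^sup>2"
    by (simp add: r_def stereographic_def power_divide sum_divide_distrib u_def \<sigma>_def)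
  moreover have "(x l)\<^sup>2 = (\<sigma> * x l)\<^sup>2" using \<sigma> by (simp add: power2_eq_square mult.assoc mult.left_commute)
  moreover have "1 - (\<sigma> * x l)\<^sup>2 = u * (2 - u)" by (simp add: u_def power2_eq_square algebra_simps)
  ultimately have "r = u * (2 - u) / u\<^sup>2" by (simp only: sp1)
  then have r: "r = (2 - u) / u" using u by (simp add: power2_eq_square)
  then have r1: "r + 1 = 2 / u" using u by (simp add: field_simps)
  have "r - 1 = 2 * (\<sigma> * x l) / u" using u by (simp add: r field_simps u_def)
  then have rm: "\<sigma> * (r - 1) / (r + 1) = x l" unfolding r1 using u \<sigma> by (simp add: field_simps)
  show ?thesis
  proof
    fix a
    show "stereographic_inv l N (stereographic l N x) a = x a"
      unfolding stereographic_inv_def r_def[symmetric] Let_def r1 using rm sp(2)[of a] u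
      by (auto simp: r1 stereographic_def u_def[symmetric] \<sigma>_def[symmetric])
  qed
qed

lemma stereographic_inv_right:
  assumes y: "\<forall>c\<ge>l. y c = 0"
  shows "stereographic_inv l N y \<in> chart_dom (round_sphere l) N" "stereographic l N (stereographic_inv l N y) = y"
proof -
  define \<sigma> where "\<sigma> = pole_sign N"
  define r where "r = (\<Sum>c<l. (y c)\<^sup>2)"
  have \<sigma>: "\<sigma> * \<sigma> = 1" by (simp add: \<sigma>_def pole_sign_square)
  have r0: "r \<ge> 0" by (simp add: r_def sum_nonneg)
  define x where "x = stereographic_inv l N y"
  have x: "x a = (if a < l then 2 * y a / (r + 1) else if a = l then \<sigma> * (r - 1) / (r + 1) else 0)" for a
    by (simp add: x_def stereographic_inv_def r_def \<sigma>_def Let_def)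
  have "(\<Sum>c<l. (x c)\<^sup>2) = 4 * r / (r + 1)\<^sup>2"
    by (simp add: x power_divide power_mult_distrib sum_distrib_left sum_divide_distrib r_def)
  moreover have "(x l)\<^sup>2 = (r - 1)\<^sup>2 / (r + 1)\<^sup>2"
    using \<sigma> by (simp add: x power_divide power_mult_distrib) (simp add: power2_eq_square)
  ultimately have "(\<Sum>c\<le>l. (x c)\<^sup>2) = (4 * r + (r - 1)\<^sup>2) / (r + 1)\<^sup>2"
    by (simp add: lessThan_Suc_atMost[symmetric] add_divide_distrib)
  also have "4 * r + (r - 1)\<^sup>2 = (r + 1)\<^sup>2" by (simp add: power2_eq_square algebra_simps)
  finally have s: "(\<Sum>c\<le>l. (x c)\<^sup>2) = 1" using r0 by simp
  have xl: "1 - \<sigma> * x l = 2 / (r + 1)"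
  proof -
    have "\<sigma> * x l = (r - 1) / (r + 1)" using \<sigma> by (simp add: x mult.assoc[symmetric])
    then show ?thesis using r0 by (simp add: field_simps)
  qed
  then have "1 - \<sigma> * x l \<noteq> 0" using r0 by simp
  then have "x l \<noteq> \<sigma>" using \<sigma> by auto
  with s show "stereographic_inv l N y \<in> chart_dom (round_sphere l) N"
    by (auto simp: topspace_nsphere x \<sigma>_def simp flip: x_def)
  show "stereographic l N (stereographic_inv l N y) = y"
    using y xl r0 unfolding x_def[symmetric] stereographic_def \<sigma>_def[symmetric]
    by (auto simp: x)
qed

text \<open>Stereographic coordinates fill all of R^l, so a point remains in the chart however one
  coordinate is changed.\<close>

lemma sphere_line_open: "line_open (round_sphere l) N (chart_dom (round_sphere l) N)"
  unfolding line_open_def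
proof (intro conjI ballI allI impI)
  show "inj_on (coord (round_sphere l) N) (chart_dom (round_sphere l) N)"
    by (rule inj_on_inverseI[of _ "stereographic_inv l N"]) (use stereographic_inv_left in auto)
next
  fix p a assume p: "p \<in> chart_dom (round_sphere l) N" and a: "a < mdim (round_sphere l)"
  have "(coord (round_sphere l) N p)(a := s) \<in> coord (round_sphere l) N ` chart_dom (round_sphere l) N" for s
    using stereographic_inv_right[of l "(stereographic l N p)(a := s)" N] a
    by (intro image_eqI[of _ _ "stereographic_inv l N ((stereographic l N p)(a := s))"]) (auto simp: stereographic_def)
  then show "\<forall>\<^sub>F s in nhds (coord (round_sphere l) N p a).
      (coord (round_sphere l) N p)(a := s) \<in> coord (round_sphere l) N ` chart_dom (round_sphere l) N"
    by simp
qed (auto simp: stereographic_def)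

text \<open>What the ambient computation uses of the metric of a factor, one chart at a time. For X
  it follows from the manifold axioms, for the sphere from the explicit formula.\<close>

definition metric_ok :: "('a, 'i) mfd \<Rightarrow> 'i \<Rightarrow> bool" where
  "metric_ok M i \<longleftrightarrow> line_open M i (chart_dom M i) \<and> (\<forall>p\<in>chart_dom M i.
     is_inverse (mdim M) (\<lambda>a b. gcomp M i a b p) (\<lambda>a b. ginv M i a b p) \<and>
     (\<forall>a<mdim M. \<forall>b<mdim M. gcomp M i a b p = gcomp M i b a p \<and>
       (\<forall>c<mdim M. has_pd M i c (gcomp M i a b) p (pd M i c (gcomp M i a b) p))))"

lemma riemannian_metric_ok:
  assumes X: "riemannian_manifold X" "i \<in> chart_index X"
  shows "metric_ok X i"
  unfolding metric_ok_def
  using riemannian_metric[OF X] chart_line_open[OF X riemannian_chart(1)[OF X]]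
  by (auto simp: spd_def intro: smooth_in_has_pd)

lemma sphere_metric_ok: "metric_ok (round_sphere l) N"
  unfolding metric_ok_def
proof (intro conjI ballI allI impI sphere_line_open)
  fix p assume p: "p \<in> chart_dom (round_sphere l) N"
  define r where "r = (\<lambda>x. 1 + (\<Sum>c<l. stereographic l N x c * stereographic l N x c))"
  have g: "gcomp (round_sphere l) N a b = (\<lambda>x. (if a = b then 4 else 0) * (inverse (r x) * inverse (r x)))" for a b
    by (auto simp: round_sphere_def r_def power2_eq_square fun_eq_iff field_simps)
  have r: "r x > 0" for x
    unfolding r_def by (intro add_pos_nonneg sum_nonneg) auto
  let ?\<phi> = "4 * (inverse (r p) * inverse (r p))"
  have "is_inverse l (\<lambda>a b. gcomp (round_sphere l) N a b p) (\<lambda>a b. if a = b then inverse ?\<phi> else 0)"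
  proof -
    have *: "(\<Sum>c<l. ((if a = c then 4 else 0) * u) * (if c = b then w else 0)) = (if a = b then 4 * u * w else 0)"
      "(\<Sum>c<l. (if a = c then w else 0) * ((if c = b then 4 else 0) * u)) = (if a = b then w * (4 * u) else 0)"
      if "a < l" "b < l" for a b and u w :: real
    proof -
      have "(\<Sum>c<l. ((if a = c then 4 else 0) * u) * (if c = b then w else 0)) =
        (\<Sum>c<l. (if a = c then 1 else 0) * (if c = b then 4 * u * w else 0))"
        "(\<Sum>c<l. (if a = c then w else 0) * ((if c = b then 4 else 0) * u)) =
        (\<Sum>c<l. (if a = c then 1 else 0) * (if c = b then w * (4 * u) else 0))"
        by (intro sum.cong; auto)+
      then show "(\<Sum>c<l. ((if a = c then 4 else 0) * u) * (if c = b then w else 0)) = (if a = b then 4 * u * w else 0)"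
        "(\<Sum>c<l. (if a = c then w else 0) * ((if c = b then 4 else 0) * u)) = (if a = b then w * (4 * u) else 0)"
        using that by (simp_all only: sum_delta_left)
    qed
    have "4 * (inverse (r p) * inverse (r p)) * inverse ?\<phi> = 1" "inverse ?\<phi> * (4 * (inverse (r p) * inverse (r p))) = 1"
      using r[of p] by (intro right_inverse left_inverse; simp)+
    then show ?thesis unfolding is_inverse_def g by (simp add: *)
  qed
  then have *: "ginv (round_sphere l) N a b p = (if a = b then inverse ?\<phi> else 0)" if "a < l" "b < l" for a b
    using that unfolding ginv_def by (simp add: matrix_inverse_eq)
  with \<open>is_inverse l _ _\<close> show "is_inverse (mdim (round_sphere l)) (\<lambda>a b. gcomp (round_sphere l) N a b p)
     (\<lambda>a b. ginv (round_sphere l) N a b p)"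
    unfolding is_inverse_def by simp
  fix a b assume ab: "a < mdim (round_sphere l)" "b < mdim (round_sphere l)"
  show "gcomp (round_sphere l) N a b p = gcomp (round_sphere l) N b a p" by (simp add: g)
  fix c assume c: "c < mdim (round_sphere l)"
  note lo = sphere_line_open[of l N]
  have co: "has_pd (round_sphere l) N c (\<lambda>q. stereographic l N q e) p (if c = e then 1 else 0)" for e
    using has_pd_coord[OF lo p c, of e] by simp
  let ?y = "\<lambda>e. stereographic l N p e"
  \<comment> \<open>Only the existence of the derivative of r matters, so \<open>D\<close> keeps the
    shape that the derivative rules produce.\<close>
  define D where "D = 0 + (\<Sum>e<l. (if c = e then 1 else 0) * ?y e + ?y e * (if c = e then 1 else 0))"
  have D: "has_pd (round_sphere l) N c r p D"
    unfolding r_def D_def by (intro has_pd_add has_pd_const has_pd_sum has_pd_mult[OF lo p] co)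
  let ?E = "- D * (inverse (r p) * inverse (r p))"
  have "has_pd (round_sphere l) N c (gcomp (round_sphere l) N a b) p
     ((if a = b then 4 else 0) * (?E * inverse (r p) + inverse (r p) * ?E))"
    unfolding g using r[of p]
    by (intro has_pd_cmult has_pd_mult[OF lo p] has_pd_inverse[OF lo p] D) auto
  then show "has_pd (round_sphere l) N c (gcomp (round_sphere l) N a b) p
      (pd (round_sphere l) N c (gcomp (round_sphere l) N a b) p)"
    using has_pd_imp_pd by metis
qed

section \<open>Charts of a product\<close>

lemma warped_product_simps [simp]:
  "mdim (warped_product X v F) = mdim X + mdim F"
  "mtop (warped_product X v F) = prod_topology (mtop X) (mtop F)"
  "chart_index (warped_product X v F) = chart_index X \<times> chart_index F"
  "chart_dom (warped_product X v F) (i, j) = chart_dom X i \<times> chart_dom F j"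
  "coord (warped_product X v F) (i, j) (x, z) = (\<lambda>a. if a < mdim X then coord X i x a else coord F j z (a - mdim X))"
  "gcomp (warped_product X v F) = block_metric X F (\<lambda>_. 1) (\<lambda>x. (v x)\<^sup>2)"
  by (simp_all add: warped_product_def fun_eq_iff)

context
  fixes X :: "('a, 'i) mfd" and F :: "('b, 'j) mfd" and v :: "'a \<Rightarrow> real" and i :: 'i and j :: 'j
  assumes lX: "line_open X i (chart_dom X i)" and lF: "line_open F j (chart_dom F j)"
begin

lemma product_line_open:
  "line_open (warped_product X v F) (i, j) (chart_dom (warped_product X v F) (i, j))"
  unfolding line_open_def
proof (intro conjI ballI allI impI)
  let ?W = "warped_product X v F"
  show "inj_on (coord ?W (i, j)) (chart_dom ?W (i, j))"
  proof (rule inj_onI)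
    fix p q assume "p \<in> chart_dom ?W (i, j)" "q \<in> chart_dom ?W (i, j)" and e: "coord ?W (i, j) p = coord ?W (i, j) q"
    then obtain x z x' z' where p: "p = (x, z)" "q = (x', z')" "x \<in> chart_dom X i" "x' \<in> chart_dom X i"
      "z \<in> chart_dom F j" "z' \<in> chart_dom F j" by auto
    have e': "(if a < mdim X then coord X i x a else coord F j z (a - mdim X)) =
       (if a < mdim X then coord X i x' a else coord F j z' (a - mdim X))" for a
      using fun_cong[OF e, of a] by (simp add: p)
    \<comment> \<open>The product coordinates record only the first \<open>mdim X\<close>
      coordinates of x; the remaining ones vanish by \<open>line_open\<close>.\<close>
    have "coord X i x a = coord X i x' a" for a
    proof (cases "a < mdim X")
      case False
      then show ?thesis using lX p by (auto simp: line_open_def)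
    qed (use e'[of a] in simp)
    then have "coord X i x = coord X i x'" by blast
    moreover have "coord F j z a = coord F j z' a" for a using e'[of "mdim X + a"] by simp
    then have "coord F j z = coord F j z'" by blast
    ultimately show "p = q" using lX lF p unfolding line_open_def inj_on_def by blast
  qed
  fix p a assume pd: "p \<in> chart_dom ?W (i, j)"
  then obtain x z where p: "p = (x, z)" "x \<in> chart_dom X i" "z \<in> chart_dom F j" by auto
  show "coord ?W (i, j) p a = 0" if "mdim ?W \<le> a"
    using that p lF by (auto simp: line_open_def)
  show "\<forall>\<^sub>F s in nhds (coord ?W (i, j) p a).
      (coord ?W (i, j) p)(a := s) \<in> coord ?W (i, j) ` chart_dom ?W (i, j)" if a: "a < mdim ?W"
  proof (cases "a < mdim X")
    case True
    have "\<forall>\<^sub>F s in nhds (coord X i x a). (coord X i x)(a := s) \<in> coord X i ` chart_dom X i"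
      using lX p True by (auto simp: line_open_def)
    then have "\<forall>\<^sub>F s in nhds (coord X i x a). (coord ?W (i, j) p)(a := s) \<in> coord ?W (i, j) ` chart_dom ?W (i, j)"
    proof (rule eventually_mono)
      fix s assume "(coord X i x)(a := s) \<in> coord X i ` chart_dom X i"
      then obtain x' where "x' \<in> chart_dom X i" "coord X i x' = (coord X i x)(a := s)" by auto
      then show "(coord ?W (i, j) p)(a := s) \<in> coord ?W (i, j) ` chart_dom ?W (i, j)"
        using p True by (intro image_eqI[of _ _ "(x', z)"]) (auto simp: fun_eq_iff)
    qed
    then show ?thesis using True by (simp add: p)
  next
    case False
    define b where "b = a - mdim X"
    have b: "a = mdim X + b" "b < mdim F" using False a by (auto simp: b_def)
    have "\<forall>\<^sub>F s in nhds (coord F j z b). (coord F j z)(b := s) \<in> coord F j ` chart_dom F j"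
      using lF p b by (auto simp: line_open_def)
    then have "\<forall>\<^sub>F s in nhds (coord F j z b). (coord ?W (i, j) p)(a := s) \<in> coord ?W (i, j) ` chart_dom ?W (i, j)"
    proof (rule eventually_mono)
      fix s assume "(coord F j z)(b := s) \<in> coord F j ` chart_dom F j"
      then obtain z' where "z' \<in> chart_dom F j" "coord F j z' = (coord F j z)(b := s)" by auto
      then show "(coord ?W (i, j) p)(a := s) \<in> coord ?W (i, j) ` chart_dom ?W (i, j)"
        using p unfolding b(1) by (intro image_eqI[of _ _ "(x, z')"]) (auto simp: fun_eq_iff)
    qed
    then show ?thesis by (simp add: p b)
  qed
qed (rule subset_refl)

lemma product_has_pd:
  assumes x: "x \<in> chart_dom X i" and z: "z \<in> chart_dom F j"
  shows "a < mdim X \<Longrightarrow> has_pd (warped_product X v F) (i, j) a f (x, z) D \<longleftrightarrow> has_pd X i a (\<lambda>x. f (x, z)) x D"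
    "b < mdim F \<Longrightarrow> has_pd (warped_product X v F) (i, j) (mdim X + b) f (x, z) D \<longleftrightarrow> has_pd F j b (\<lambda>z. f (x, z)) z D"
proof -
  let ?W = "warped_product X v F"
  show "has_pd ?W (i, j) a f (x, z) D \<longleftrightarrow> has_pd X i a (\<lambda>x. f (x, z)) x D" if a: "a < mdim X"
  proof -
    have "\<forall>\<^sub>F s in nhds (coord X i x a). coord_line ?W (i, j) a (x, z) s = (coord_line X i a x s, z)"
      using line_open_eventually[OF lX x a]
      by (rule eventually_mono) (use z a in \<open>auto intro!: coord_lineI[OF product_line_open] simp: fun_eq_iff\<close>)
    then have "\<forall>\<^sub>F s in nhds (coord X i x a). f (coord_line ?W (i, j) a (x, z) s) = f (coord_line X i a x s, z)"
      by (rule eventually_mono) simp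
    then show ?thesis unfolding has_pd_def using a by (intro DERIV_cong_ev) auto
  qed
  show "has_pd ?W (i, j) (mdim X + b) f (x, z) D \<longleftrightarrow> has_pd F j b (\<lambda>z. f (x, z)) z D" if b: "b < mdim F"
  proof -
    have "\<forall>\<^sub>F s in nhds (coord F j z b). coord_line ?W (i, j) (mdim X + b) (x, z) s = (x, coord_line F j b z s)"
      using line_open_eventually[OF lF z b]
      by (rule eventually_mono) (use x in \<open>auto intro!: coord_lineI[OF product_line_open] simp: fun_eq_iff\<close>)
    then have "\<forall>\<^sub>F s in nhds (coord F j z b). f (coord_line ?W (i, j) (mdim X + b) (x, z) s) = f (x, coord_line F j b z s)"
      by (rule eventually_mono) simp
    then show ?thesis unfolding has_pd_def using b by (intro DERIV_cong_ev) auto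
  qed
qed

text \<open>\<open>deriv\<close> is a choice over the derivative predicate, so equivalent predicates
  give equal values even where no derivative exists.\<close>

lemma product_pd:
  assumes x: "x \<in> chart_dom X i" and z: "z \<in> chart_dom F j"
  shows "a < mdim X \<Longrightarrow> pd (warped_product X v F) (i, j) a f (x, z) = pd X i a (\<lambda>x. f (x, z)) x"
    "b < mdim F \<Longrightarrow> pd (warped_product X v F) (i, j) (mdim X + b) f (x, z) = pd F j b (\<lambda>z. f (x, z)) z"
  using product_has_pd[OF x z, of _ f] unfolding pd_def deriv_def has_pd_def by auto

text \<open>Derivatives along X of a pulled back function are pulled back again, and those along F
  are zero.\<close>

lemma ck_pullback:
  "ck X i (chart_dom X i) r h \<Longrightarrow>
   ck (warped_product X v F) (i, j) (chart_dom (warped_product X v F) (i, j)) r (\<lambda>(x, z). h x)"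
proof (induction r arbitrary: h)
  let ?W = "warped_product X v F"
  have c: "continuous_map (subtopology (mtop ?W) (chart_dom ?W (i, j))) euclideanreal (\<lambda>(x, z). h x)"
    if "continuous_map (subtopology (mtop X) (chart_dom X i)) euclideanreal h" for h
  proof -
    have "continuous_map (subtopology (mtop ?W) (chart_dom ?W (i, j))) (subtopology (mtop X) (chart_dom X i)) fst"
      by (auto simp: continuous_map_in_subtopology continuous_map_from_subtopology continuous_map_fst)
    from continuous_map_compose[OF this that] show ?thesis by (simp add: comp_def case_prod_unfold)
  qed
  {
    case 0
    then show ?case using c by simp
  next
    case (Suc r)
    have "ck ?W (i, j) (chart_dom ?W (i, j)) r (pd ?W (i, j) a (\<lambda>(x, z). h x)) \<and>
      (\<forall>p\<in>chart_dom ?W (i, j). \<exists>D. has_pd ?W (i, j) a (\<lambda>(x, z). h x) p D)" if a: "a < mdim ?W" for a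
    proof (cases "a < mdim X")
      case True
      have "ck ?W (i, j) (chart_dom ?W (i, j)) r (\<lambda>(x, z). pd X i a h x)"
        using Suc True by auto
      then have "ck ?W (i, j) (chart_dom ?W (i, j)) r (pd ?W (i, j) a (\<lambda>(x, z). h x))"
        by (rule ck_cong[OF product_line_open, rotated]) (auto simp: product_pd True)
      moreover have "\<forall>p\<in>chart_dom ?W (i, j). \<exists>D. has_pd ?W (i, j) a (\<lambda>(x, z). h x) p D"
      proof (intro ballI exI)
        fix p assume "p \<in> chart_dom ?W (i, j)"
        then show "has_pd ?W (i, j) a (\<lambda>(x, z). h x) p (pd X i a h (fst p))"
          using Suc.prems True by (auto simp: product_has_pd)
      qed
      ultimately show ?thesis by blast
    next
      case False
      define b where "b = a - mdim X"
      have b: "a = mdim X + b" "b < mdim F" using False a by (auto simp: b_def)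
      have "ck ?W (i, j) (chart_dom ?W (i, j)) r (pd ?W (i, j) a (\<lambda>(x, z). h x))"
        by (rule ck_cong[OF product_line_open, rotated, OF ck_const[of _ _ _ _ 0]])
          (use b in \<open>auto simp: product_pd pd_const\<close>)
      moreover have "\<forall>p\<in>chart_dom ?W (i, j). \<exists>D. has_pd ?W (i, j) a (\<lambda>(x, z). h x) p D"
      proof (intro ballI exI)
        fix p assume "p \<in> chart_dom ?W (i, j)"
        then show "has_pd ?W (i, j) a (\<lambda>(x, z). h x) p 0"
          unfolding b(1) using has_pd_const b(2) by (auto simp: product_has_pd)
      qed
      ultimately show ?thesis by blast
    qed
    moreover have "\<exists>D. has_pd M i a f p D \<Longrightarrow> has_pd M i a f p (pd M i a f p)"
      for M :: "('a \<times> 'b, 'i \<times> 'j) mfd" and i a f p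
      using has_pd_imp_pd by metis
    ultimately show ?case unfolding ck.simps using c Suc.prems by (meson ck_continuous)
  }
qed

end

lemma smooth_fun_pullback:
  assumes "\<And>i. i \<in> chart_index X \<Longrightarrow> line_open X i (chart_dom X i)"
    "\<And>j. j \<in> chart_index F \<Longrightarrow> line_open F j (chart_dom F j)" "smooth_fun X h"
  shows "smooth_fun (warped_product X v F) (\<lambda>(x, z). h x)"
  unfolding smooth_fun_def
proof
  fix ij assume "ij \<in> chart_index (warped_product X v F)"
  then obtain i j where ij: "ij = (i, j)" "i \<in> chart_index X" "j \<in> chart_index F" by auto
  show "smooth_in (warped_product X v F) ij (chart_dom (warped_product X v F) ij) (\<lambda>(x, z). h x)"
    using assms ij ck_pullback[OF assms(1)[OF ij(2)] assms(2)[OF ij(3)]]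
    by (auto simp: smooth_in_iff_ck smooth_fun_def simp del: warped_product_simps)
qed

section \<open>The ambient Laplacian\<close>

lemma sum_lessThan_add: "(\<Sum>a<m + n. f a) = (\<Sum>a<m. f a) + (\<Sum>a<(n::nat). f (m + a) :: real)"
  by (induction n) (simp_all add: add_ac)

lemma sum_lessThan_add2: "(\<Sum>a<n + 2. f a) = f 0 + f 1 + (\<Sum>a<(n::nat). f (a + 2) :: real)"
  using sum_lessThan_add[of f 2 n] by (simp add: numeral_2_eq_2 add.commute)

lemma lap_data_linear:
  "lap_data d B D (\<lambda>a b. \<Sum>j\<in>S. u j * H j a b) (\<lambda>c. \<Sum>j\<in>S. u j * G j c) = (\<Sum>j\<in>S. u j * lap_data d B D (H j) (G j))"
proof -
  define V where "V = (\<lambda>e. (\<Sum>a<d. \<Sum>b<d. B a b * (D a b e + D b a e - D e a b)) / 2)"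
  have "(\<Sum>a<d. \<Sum>b<d. B a b * (\<Sum>j\<in>S. u j * H j a b)) = (\<Sum>a<d. \<Sum>j\<in>S. \<Sum>b<d. B a b * (u j * H j a b))"
    unfolding sum_distrib_left by (intro sum.cong refl sum.swap)
  also have "\<dots> = (\<Sum>j\<in>S. \<Sum>a<d. \<Sum>b<d. B a b * (u j * H j a b))" by (rule sum.swap)
  finally have 1: "(\<Sum>a<d. \<Sum>b<d. B a b * (\<Sum>j\<in>S. u j * H j a b)) = \<dots>" .
  have "(\<Sum>c<d. \<Sum>e<d. B c e * V e * (\<Sum>j\<in>S. u j * G j c)) = (\<Sum>c<d. \<Sum>j\<in>S. \<Sum>e<d. B c e * V e * (u j * G j c))"
    unfolding sum_distrib_left by (intro sum.cong refl sum.swap)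
  also have "\<dots> = (\<Sum>j\<in>S. \<Sum>c<d. \<Sum>e<d. B c e * V e * (u j * G j c))" by (rule sum.swap)
  finally have 2: "(\<Sum>c<d. \<Sum>e<d. B c e * V e * (\<Sum>j\<in>S. u j * G j c)) = \<dots>" .
  have V: "(\<Sum>a<d. \<Sum>b<d. B a b * (D a b e + D b a e - D e a b)) / 2 = V e" for e
    by (simp add: V_def)
  show ?thesis
    unfolding lap_data_def V 1 2
    by (simp add: right_diff_distrib sum_subtractf sum_distrib_left mult_ac)
qed

text \<open>A constant factor of the metric cancels in the Christoffel symbols; only the contraction
  with the inverse metric scales.\<close>

lemma lap_data_scale:
  assumes "\<alpha> \<noteq> 0"
  shows "lap_data d (\<lambda>a b. B a b / \<alpha>) (\<lambda>a b c. \<alpha> * D a b c) H G = lap_data d B D H G / \<alpha>"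
proof -
  have "(\<Sum>a<d. \<Sum>b<d. B a b / \<alpha> * (\<alpha> * D a b e + \<alpha> * D b a e - \<alpha> * D e a b)) =
    (\<Sum>a<d. \<Sum>b<d. B a b * (D a b e + D b a e - D e a b))" for e
    using assms by (intro sum.cong refl) (simp add: field_simps)
  then show ?thesis
    unfolding lap_data_def diff_divide_distrib by (simp only: sum_divide_distrib) (simp add: sum_divide_distrib)
qed

lemma lap_data_block:
  assumes B: "\<And>a b. a < d1 \<Longrightarrow> b < d1 \<Longrightarrow> B a b = B1 a b" "\<And>a b. a < d2 \<Longrightarrow> b < d2 \<Longrightarrow> B (d1 + a) (d1 + b) = B2 a b"
    "\<And>a b. a < d1 \<Longrightarrow> b < d2 \<Longrightarrow> B a (d1 + b) = 0" "\<And>a b. a < d1 \<Longrightarrow> b < d2 \<Longrightarrow> B (d1 + b) a = 0"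
    and D: "\<And>a b c. a < d1 \<Longrightarrow> b < d1 \<Longrightarrow> c < d1 \<Longrightarrow> D a b c = D1 a b c"
    "\<And>a b c. a < d2 \<Longrightarrow> b < d2 \<Longrightarrow> c < d2 \<Longrightarrow> D (d1 + a) (d1 + b) (d1 + c) = D2 a b c"
    "\<And>a b c. a < d1 \<Longrightarrow> b < d1 \<Longrightarrow> c < d2 \<Longrightarrow> D (d1 + c) a b = 0"
    "\<And>a b c. a < d1 \<Longrightarrow> b < d1 \<Longrightarrow> c < d2 \<Longrightarrow> D a b (d1 + c) = 0"
    "\<And>a b c. a < d2 \<Longrightarrow> b < d2 \<Longrightarrow> c < d1 \<Longrightarrow> D c (d1 + a) (d1 + b) = 0"
    "\<And>a b c. a < d2 \<Longrightarrow> b < d2 \<Longrightarrow> c < d1 \<Longrightarrow> D (d1 + a) (d1 + b) c = 0"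
  shows "lap_data (d1 + d2) B D H G = lap_data d1 B1 D1 H G +
    lap_data d2 B2 D2 (\<lambda>a b. H (d1 + a) (d1 + b)) (\<lambda>a. G (d1 + a))"
  unfolding lap_data_def sum_lessThan_add using assms by (simp add: sum.distrib)

text \<open>At t = 1 the (t, \<rho>) block ((2\<rho>, 1), (1, 0)) has inverse ((0, 1), (1,
  -2\<rho>)). The first order terms come from the lowered contracted Christoffel symbol
  \<open>V\<close>: the slice contributes - N to \<open>V 0\<close>, as the t-derivative of t^2 g is
  2 g there, and - \<tau>/2 to \<open>V 1\<close>, where \<tau> is the trace of the
  \<rho>-derivative of g.\<close>

lemma lap_data_ambient:
  assumes B: "B' 0 0 = 0" "B' 0 1 = 1" "B' 1 0 = 1" "B' 1 1 = - 2 * \<rho>"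
    "\<And>a. a < N \<Longrightarrow> B' 0 (a + 2) = 0 \<and> B' 1 (a + 2) = 0 \<and> B' (a + 2) 0 = 0 \<and> B' (a + 2) 1 = 0"
    "\<And>a b. a < N \<Longrightarrow> b < N \<Longrightarrow> B' (a + 2) (b + 2) = B a b"
    and D: "D' 0 0 1 = 1" "D' 0 1 0 = 1" "D' 0 1 1 = 0"
     "D' 1 0 0 = 2" "D' 1 0 1 = 0" "D' 1 1 0 = 0" "D' 1 1 1 = 0"
     "\<And>a. a < N \<Longrightarrow> D' (a + 2) 0 1 = 0 \<and> D' (a + 2) 1 0 = 0 \<and> D' (a + 2) 1 1 = 0"
     "\<And>a. a < N \<Longrightarrow> D' 0 1 (a + 2) = 0 \<and> D' 1 0 (a + 2) = 0 \<and> D' 1 1 (a + 2) = 0"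
     "\<And>a b. a < N \<Longrightarrow> b < N \<Longrightarrow> D' (a + 2) (b + 2) 0 = 0 \<and> D' (a + 2) (b + 2) 1 = 0"
     "\<And>a b. a < N \<Longrightarrow> b < N \<Longrightarrow> D' 0 (a + 2) (b + 2) = 2 * g a b \<and> D' 1 (a + 2) (b + 2) = g' a b"
     "\<And>a b c. a < N \<Longrightarrow> b < N \<Longrightarrow> c < N \<Longrightarrow> D' (a + 2) (b + 2) (c + 2) = D a b c"
    and tr: "(\<Sum>a<N. \<Sum>b<N. B a b * g a b) = real N"
  shows "lap_data (N + 2) B' D' H G = H 0 1 + H 1 0 - 2 * \<rho> * H 1 1 +
     lap_data N B D (\<lambda>a b. H (a + 2) (b + 2)) (\<lambda>a. G (a + 2)) +
     (\<Sum>a<N. \<Sum>b<N. B a b * g' a b) / 2 * G 0 +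
     (real N - 2 - \<rho> * (\<Sum>a<N. \<Sum>b<N. B a b * g' a b)) * G 1"
proof -
  note BD = B[simplified] D[simplified]
  define \<tau> where "\<tau> = (\<Sum>a<N. \<Sum>b<N. B a b * g' a b)"
  define V where "V = (\<lambda>e. (\<Sum>a<N + 2. \<Sum>b<N + 2. B' a b * (D' a b e + D' b a e - D' e a b)) / 2)"
  have V0: "V 0 = 2 - real N"
  proof -
    have "(\<Sum>a<N + 2. \<Sum>b<N + 2. B' a b * (D' a b 0 + D' b a 0 - D' 0 a b)) = 4 + (\<Sum>a<N. \<Sum>b<N. B a b * (- 2 * g a b))"
      unfolding sum_lessThan_add2 by (simp add: BD)
    also have "(\<Sum>a<N. \<Sum>b<N. B a b * (- 2 * g a b)) = - 2 * real N"
      unfolding tr[symmetric] sum_distrib_left by (simp add: mult_ac)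
    finally show ?thesis by (simp add: V_def)
  qed
  have V1: "V 1 = - \<tau> / 2"
  proof -
    have "(\<Sum>a<N + 2. \<Sum>b<N + 2. B' a b * (D' a b 1 + D' b a 1 - D' 1 a b)) = (\<Sum>a<N. \<Sum>b<N. B a b * (- g' a b))"
      unfolding sum_lessThan_add2 by (simp add: BD)
    also have "\<dots> = - \<tau>" by (simp add: \<tau>_def sum_negf)
    finally show ?thesis by (simp add: V_def)
  qed
  have V2: "V (e + 2) = (\<Sum>a<N. \<Sum>b<N. B a b * (D a b e + D b a e - D e a b)) / 2" if "e < N" for e
    unfolding V_def sum_lessThan_add2 using that by (simp add: BD)
  have 1: "(\<Sum>a<N + 2. \<Sum>b<N + 2. B' a b * H a b) =
     H 0 1 + H 1 0 - 2 * \<rho> * H 1 1 + (\<Sum>a<N. \<Sum>b<N. B a b * H (a + 2) (b + 2))"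
    unfolding sum_lessThan_add2 by (simp add: BD)
  have 2: "(\<Sum>c<N + 2. \<Sum>e<N + 2. B' c e * V e * G c) =
     V 1 * G 0 + (V 0 - 2 * \<rho> * V 1) * G 1 +
     (\<Sum>c<N. \<Sum>e<N. B c e * V (e + 2) * G (c + 2))"
    unfolding sum_lessThan_add2 by (simp add: BD algebra_simps)
  have 3: "(\<Sum>c<N. \<Sum>e<N. B c e * V (e + 2) * G (c + 2)) =
     (\<Sum>c<N. \<Sum>e<N. B c e * ((\<Sum>a<N. \<Sum>b<N. B a b * (D a b e + D b a e - D e a b)) / 2) * G (c + 2))"
    by (intro sum.cong refl) (simp only: V2 lessThan_iff)
  have V: "(\<Sum>a<N + 2. \<Sum>b<N + 2. B' a b * (D' a b e + D' b a e - D' e a b)) / 2 = V e" for e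
    by (simp only: V_def)
  show ?thesis
    unfolding lap_data_def V 1 2 3 unfolding V0 V1 \<tau>_def[symmetric]
    by (simp add: algebra_simps)
qed

lemma ambient_is_inverse:
  assumes B: "is_inverse N g B"
    and g': "g' 0 0 = 2 * \<rho>" "g' 0 1 = 1" "g' 1 0 = 1" "g' 1 1 = 0"
    "\<And>a. g' 0 (a + 2) = 0" "\<And>a. g' 1 (a + 2) = 0" "\<And>a. g' (a + 2) 0 = 0" "\<And>a. g' (a + 2) 1 = 0"
    "\<And>a b. g' (a + 2) (b + 2) = g a b"
    and B': "B' 0 0 = 0" "B' 0 1 = 1" "B' 1 0 = 1" "B' 1 1 = - 2 * \<rho>"
    "\<And>a. B' 0 (a + 2) = 0" "\<And>a. B' 1 (a + 2) = 0" "\<And>a. B' (a + 2) 0 = 0" "\<And>a. B' (a + 2) 1 = 0"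
    "\<And>a b. B' (a + 2) (b + 2) = B a b"
  shows "is_inverse (N + 2) g' B'"
  unfolding is_inverse_def sum_lessThan_add2
proof (intro allI impI)
  fix a b assume a: "a < N + 2" and b: "b < N + 2"
  have cases: "c = 0 \<or> c = 1 \<or> (\<exists>d<N. c = d + 2)" if "c < N + 2" for c
    using that by presburger
  show "g' a 0 * B' 0 b + g' a 1 * B' 1 b + (\<Sum>c<N. g' a (c + 2) * B' (c + 2) b) = (if a = b then 1 else 0) \<and>
     B' a 0 * g' 0 b + B' a 1 * g' 1 b + (\<Sum>c<N. B' a (c + 2) * g' (c + 2) b) = (if a = b then 1 else 0)"
    using cases[OF a] cases[OF b] B
    by (elim disjE exE conjE) (simp_all only: g' B', simp_all add: is_inverse_def)
qed

section \<open>Charts and Laplacian of the ambient space\<close>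

lemma ambient_space_simps [simp]:
  "mdim (ambient_space M gr) = mdim M + 2"
  "chart_index (ambient_space M gr) = chart_index M"
  "chart_dom (ambient_space M gr) i = {0<..} \<times> {-2<..<2} \<times> chart_dom M i"
  "coord (ambient_space M gr) i (t, \<rho>, p) = case_nat t (case_nat \<rho> (coord M i p))"
  by (simp_all add: ambient_space_def)

lemma case_nat_upd:
  "(case_nat t (case_nat \<rho> y))(0 := s) = case_nat s (case_nat \<rho> y)"
  "(case_nat t (case_nat \<rho> y))(Suc 0 := s) = case_nat t (case_nat s y)"
  "(case_nat t (case_nat \<rho> y))(Suc (Suc a) := s) = case_nat t (case_nat \<rho> (y(a := s)))"
  by (auto simp: fun_eq_iff split: nat.split)

lemma case_nat_eq_iff: "case_nat t y = case_nat t' y' \<longleftrightarrow> t = t' \<and> y = y'"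
  by (auto simp: fun_eq_iff split: nat.splits)

context
  fixes M :: "('a, 'i) mfd" and gr :: "real \<Rightarrow> 'i \<Rightarrow> nat \<Rightarrow> nat \<Rightarrow> 'a \<Rightarrow> real" and i :: 'i
  assumes lM: "line_open M i (chart_dom M i)"
begin

lemma ambient_line_open:
  "line_open (ambient_space M gr) i (chart_dom (ambient_space M gr) i)"
  unfolding line_open_def
proof (intro conjI ballI allI impI)
  let ?A = "ambient_space M gr"
  have inj: "inj_on (coord M i) (chart_dom M i)" using lM by (auto simp: line_open_def)
  show "inj_on (coord ?A i) (chart_dom ?A i)"
    by (rule inj_onI) (auto simp: case_nat_eq_iff dest: inj_onD[OF inj])
  fix P a assume "P \<in> chart_dom ?A i"
  then obtain t \<rho> p where P: "P = (t, \<rho>, p)" "t > 0" "\<bar>\<rho>\<bar> < 2" "p \<in> chart_dom M i" by auto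
  show "coord ?A i P a = 0" if "mdim ?A \<le> a"
    using that lM P by (auto simp: line_open_def split: nat.split)
  show "\<forall>\<^sub>F s in nhds (coord ?A i P a). (coord ?A i P)(a := s) \<in> coord ?A i ` chart_dom ?A i"
    if a: "a < mdim ?A"
  proof -
    consider "a = 0" | "a = 1" | b where "a = Suc (Suc b)" "b < mdim M"
      using a by (cases a; cases "a - 1") auto
    then show ?thesis
    proof cases
      case 1
      have "\<forall>\<^sub>F s in nhds t. s \<in> {0<..}" using P by (intro eventually_nhds_in_open) auto
      then have "\<forall>\<^sub>F s in nhds t. (coord ?A i P)(a := s) \<in> coord ?A i ` chart_dom ?A i"
        by (rule eventually_mono) (use P 1 in \<open>auto simp: case_nat_upd intro!: image_eqI[of _ _ "(_, \<rho>, p)"]\<close>)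
      then show ?thesis by (simp add: 1 P)
    next
      case 2
      have "\<forall>\<^sub>F s in nhds \<rho>. s \<in> {-2<..<2}" using P by (intro eventually_nhds_in_open) auto
      then have "\<forall>\<^sub>F s in nhds \<rho>. (coord ?A i P)(a := s) \<in> coord ?A i ` chart_dom ?A i"
        by (rule eventually_mono) (use P 2 in \<open>auto simp: case_nat_upd intro!: image_eqI[of _ _ "(t, _, p)"]\<close>)
      then show ?thesis by (simp add: 2 P)
    next
      case 3
      have "\<forall>\<^sub>F s in nhds (coord M i p b). (coord M i p)(b := s) \<in> coord M i ` chart_dom M i"
        using lM P 3 by (auto simp: line_open_def)
      then have "\<forall>\<^sub>F s in nhds (coord M i p b). (coord ?A i P)(a := s) \<in> coord ?A i ` chart_dom ?A i"
      proof (rule eventually_mono)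
        fix s assume "(coord M i p)(b := s) \<in> coord M i ` chart_dom M i"
        then obtain q where "q \<in> chart_dom M i" "coord M i q = (coord M i p)(b := s)" by auto
        then show "(coord ?A i P)(a := s) \<in> coord ?A i ` chart_dom ?A i"
          using P 3 by (intro image_eqI[of _ _ "(t, \<rho>, q)"]) (auto simp: case_nat_upd)
      qed
      then show ?thesis by (simp add: 3 P)
    qed
  qed
qed (rule subset_refl)

lemma ambient_has_pd:
  assumes t: "t > 0" and \<rho>: "\<bar>\<rho>\<bar> < 2" and p: "p \<in> chart_dom M i"
  shows "has_pd (ambient_space M gr) i 0 f (t, \<rho>, p) D \<longleftrightarrow> ((\<lambda>s. f (s, \<rho>, p)) has_real_derivative D) (at t)"
    "has_pd (ambient_space M gr) i 1 f (t, \<rho>, p) D \<longleftrightarrow> ((\<lambda>s. f (t, s, p)) has_real_derivative D) (at \<rho>)"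
    "a < mdim M \<Longrightarrow> has_pd (ambient_space M gr) i (a + 2) f (t, \<rho>, p) D \<longleftrightarrow> has_pd M i a (\<lambda>q. f (t, \<rho>, q)) p D"
proof -
  let ?A = "ambient_space M gr"
  have "\<forall>\<^sub>F s in nhds t. s \<in> {0<..}" using t by (intro eventually_nhds_in_open) auto
  then have "\<forall>\<^sub>F s in nhds t. f (coord_line ?A i 0 (t, \<rho>, p) s) = f (s, \<rho>, p)"
    by (rule eventually_mono)
      (use \<rho> p in \<open>auto intro!: arg_cong[of _ _ f] coord_lineI[OF ambient_line_open] simp: case_nat_upd\<close>)
  then show "has_pd ?A i 0 f (t, \<rho>, p) D \<longleftrightarrow> ((\<lambda>s. f (s, \<rho>, p)) has_real_derivative D) (at t)"
    unfolding has_pd_def by (intro DERIV_cong_ev) auto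
  have "\<forall>\<^sub>F s in nhds \<rho>. s \<in> {-2<..<2}" using \<rho> by (intro eventually_nhds_in_open) auto
  then have "\<forall>\<^sub>F s in nhds \<rho>. f (coord_line ?A i 1 (t, \<rho>, p) s) = f (t, s, p)"
    by (rule eventually_mono)
      (use t p in \<open>auto intro!: arg_cong[of _ _ f] coord_lineI[OF ambient_line_open] simp: case_nat_upd\<close>)
  then show "has_pd ?A i 1 f (t, \<rho>, p) D \<longleftrightarrow> ((\<lambda>s. f (t, s, p)) has_real_derivative D) (at \<rho>)"
    unfolding has_pd_def by (intro DERIV_cong_ev) auto
  assume a: "a < mdim M"
  have "\<forall>\<^sub>F s in nhds (coord M i p a). f (coord_line ?A i (a + 2) (t, \<rho>, p) s) = f (t, \<rho>, coord_line M i a p s)"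
    using line_open_eventually[OF lM p a]
    by (rule eventually_mono)
      (use t \<rho> in \<open>auto intro!: arg_cong[of _ _ f] coord_lineI[OF ambient_line_open] simp: case_nat_upd\<close>)
  then show "has_pd ?A i (a + 2) f (t, \<rho>, p) D \<longleftrightarrow> has_pd M i a (\<lambda>q. f (t, \<rho>, q)) p D"
    unfolding has_pd_def by (intro DERIV_cong_ev) auto
qed

lemma ambient_gcomp:
  "gcomp (ambient_space M gr) i 0 0 (t, \<rho>, p) = 2 * \<rho>" "gcomp (ambient_space M gr) i 0 1 (t, \<rho>, p) = t"
  "gcomp (ambient_space M gr) i 1 0 (t, \<rho>, p) = t" "gcomp (ambient_space M gr) i 1 1 (t, \<rho>, p) = 0"
  "gcomp (ambient_space M gr) i 0 (a + 2) (t, \<rho>, p) = 0" "gcomp (ambient_space M gr) i 1 (a + 2) (t, \<rho>, p) = 0"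
  "gcomp (ambient_space M gr) i (a + 2) 0 (t, \<rho>, p) = 0" "gcomp (ambient_space M gr) i (a + 2) 1 (t, \<rho>, p) = 0"
  "gcomp (ambient_space M gr) i (a + 2) (b + 2) (t, \<rho>, p) = t\<^sup>2 * gr \<rho> i a b p"
  by (simp_all add: ambient_space_def)

lemma ambient_ginv:
  assumes B: "is_inverse (mdim M) (\<lambda>a b. gr \<rho> i a b p) B" and a: "a < mdim M + 2" and b: "b < mdim M + 2"
  shows "ginv (ambient_space M gr) i a b (1, \<rho>, p) =
    (if a < 2 \<and> b < 2 then (if a = 0 \<and> b = 0 then 0 else if a = 1 \<and> b = 1 then - 2 * \<rho> else 1)
     else if 2 \<le> a \<and> 2 \<le> b then B (a - 2) (b - 2) else 0)"
    (is "_ = ?B a b")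
proof -
  have "is_inverse (mdim M + 2) (\<lambda>a b. gcomp (ambient_space M gr) i a b (1, \<rho>, p)) ?B"
    by (rule ambient_is_inverse[OF B, where \<rho> = \<rho>]) (simp_all add: ambient_gcomp ambient_gcomp[simplified])
  then show ?thesis unfolding ginv_def using a b by (simp add: matrix_inverse_eq)
qed

text \<open>Homogeneity turns each t-derivative at t = 1 into the factor s. The two mixed second
  derivatives thus give 2 s d/d\<rho>, which joins the first order term with coefficient N -
  2.\<close>

lemma ambient_laplacian_in:
  fixes k :: nat and f :: "nat \<Rightarrow> 'a \<Rightarrow> real"
  defines "s \<equiv> - real (mdim M) / 2 + real k"
  assumes \<rho>: "\<bar>\<rho>\<bar> < 2" and p: "p \<in> chart_dom M i"
    and B: "is_inverse (mdim M) (\<lambda>a b. gr \<rho> i a b p) B"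
    and sym: "\<And>a b. a < mdim M \<Longrightarrow> b < mdim M \<Longrightarrow> gr \<rho> i a b p = gr \<rho> i b a p"
    and g': "\<And>a b. a < mdim M \<Longrightarrow> b < mdim M \<Longrightarrow> ((\<lambda>r. gr r i a b p) has_real_derivative g' a b) (at \<rho>)"
    and D: "\<And>a b c. a < mdim M \<Longrightarrow> b < mdim M \<Longrightarrow> c < mdim M \<Longrightarrow> has_pd M i a (gr \<rho> i b c) p (D a b c)"
    and f1: "\<And>j q a. j \<le> k \<Longrightarrow> q \<in> chart_dom M i \<Longrightarrow> a < mdim M \<Longrightarrow> has_pd M i a (f j) q (pd M i a (f j) q)"
    and f2: "\<And>j a b. j \<le> k \<Longrightarrow> a < mdim M \<Longrightarrow> b < mdim M \<Longrightarrow>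
        has_pd M i a (pd M i b (f j)) p (pd M i a (pd M i b (f j)) p)"
  shows "laplacian_in (ambient_space M gr) i (homogeneous_ext M k f) (1, \<rho>, p) =
     (2 * s - 2 + real (mdim M) - \<rho> * (\<Sum>a<mdim M. \<Sum>b<mdim M. B a b * g' a b)) * (\<Sum>j\<le>k. f j p * (real j * \<rho> ^ (j - 1)))
     - 2 * \<rho> * (\<Sum>j\<le>k. f j p * (real j * (real (j - 1) * \<rho> ^ (j - 1 - 1))))
     + s / 2 * (\<Sum>a<mdim M. \<Sum>b<mdim M. B a b * g' a b) * (\<Sum>j\<le>k. f j p * \<rho> ^ j)
     + (\<Sum>j\<le>k. \<rho> ^ j * lap_data (mdim M) B D (\<lambda>a b. pd M i a (pd M i b (f j)) p) (\<lambda>a. pd M i a (f j) p))"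
proof -
  let ?A = "ambient_space M gr"
  let ?N = "mdim M"
  define u where "u = homogeneous_ext M k f"
  have u: "u (t, r, q) = t powr s * (\<Sum>j\<le>k. f j q * r ^ j)" for t r q
    by (simp add: u_def homogeneous_ext_def s_def)
  have P: "(1, \<rho>, p) \<in> chart_dom ?A i" using \<rho> p by auto
  note cong = pd_cong[OF ambient_line_open P]
  have h0: "has_pd ?A i 0 u (t, r, q) (s * t powr (s - 1) * (\<Sum>j\<le>k. f j q * r ^ j))"
    if "t > 0" "\<bar>r\<bar> < 2" "q \<in> chart_dom M i" for t r q
    unfolding ambient_has_pd[OF that] u using that by (auto intro!: derivative_eq_intros)
  have h1: "has_pd ?A i 1 u (t, r, q) (t powr s * (\<Sum>j\<le>k. f j q * (real j * r ^ (j - 1))))"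
    if "t > 0" "\<bar>r\<bar> < 2" "q \<in> chart_dom M i" for t r q
    unfolding ambient_has_pd[OF that] u by (auto intro!: derivative_eq_intros sum.cong simp: mult_ac)
  have h2: "has_pd ?A i (a + 2) u (t, r, q) (t powr s * (\<Sum>j\<le>k. r ^ j * pd M i a (f j) q))"
    if "t > 0" "\<bar>r\<bar> < 2" "q \<in> chart_dom M i" "a < ?N" for t r q a
    unfolding ambient_has_pd(3)[OF that] u mult.commute[of "f _ _"]
    by (intro has_pd_cmult has_pd_sum f1) (use that in auto)
  have G0: "pd ?A i 0 u (1, \<rho>, p) = s * (\<Sum>j\<le>k. f j p * \<rho> ^ j)"
    using has_pd_imp_pd[OF h0[OF _ \<rho> p, of 1]] by simp
  have G1: "pd ?A i 1 u (1, \<rho>, p) = (\<Sum>j\<le>k. f j p * (real j * \<rho> ^ (j - 1)))"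
    using has_pd_imp_pd[OF h1[OF _ \<rho> p, of 1]] by simp
  have G2: "pd ?A i (a + 2) u (1, \<rho>, p) = (\<Sum>j\<le>k. \<rho> ^ j * pd M i a (f j) p)" if "a < ?N" for a
    using has_pd_imp_pd[OF h2[OF _ \<rho> p that, of 1]] by simp
  have H01: "pd ?A i 0 (pd ?A i 1 u) (1, \<rho>, p) = s * (\<Sum>j\<le>k. f j p * (real j * \<rho> ^ (j - 1)))"
  proof -
    have "pd ?A i 0 (pd ?A i 1 u) (1, \<rho>, p) =
      pd ?A i 0 (\<lambda>(t, r, q). t powr s * (\<Sum>j\<le>k. f j q * (real j * r ^ (j - 1)))) (1, \<rho>, p)"
      by (rule cong) (auto intro!: has_pd_imp_pd h1[simplified])
    also have "\<dots> = s * (\<Sum>j\<le>k. f j p * (real j * \<rho> ^ (j - 1)))"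
      by (rule has_pd_imp_pd, subst ambient_has_pd[OF _ \<rho> p]) (auto intro!: derivative_eq_intros)
    finally show ?thesis .
  qed
  have H10: "pd ?A i 1 (pd ?A i 0 u) (1, \<rho>, p) = s * (\<Sum>j\<le>k. f j p * (real j * \<rho> ^ (j - 1)))"
  proof -
    have "pd ?A i 1 (pd ?A i 0 u) (1, \<rho>, p) =
      pd ?A i 1 (\<lambda>(t, r, q). s * t powr (s - 1) * (\<Sum>j\<le>k. f j q * r ^ j)) (1, \<rho>, p)"
      by (rule cong) (auto intro!: has_pd_imp_pd h0)
    also have "\<dots> = s * (\<Sum>j\<le>k. f j p * (real j * \<rho> ^ (j - 1)))"
      by (rule has_pd_imp_pd, subst ambient_has_pd[OF _ \<rho> p])
        (auto intro!: derivative_eq_intros sum.cong arg_cong[of _ _ "(*) s"] simp: mult_ac)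
    finally show ?thesis .
  qed
  \<comment> \<open>The truncated subtractions are harmless: the coefficient is 0 for j = 0 and for
    j = 1.\<close>
  have H11: "pd ?A i 1 (pd ?A i 1 u) (1, \<rho>, p) = (\<Sum>j\<le>k. f j p * (real j * (real (j - 1) * \<rho> ^ (j - 1 - 1))))"
  proof -
    have "pd ?A i 1 (pd ?A i 1 u) (1, \<rho>, p) =
      pd ?A i 1 (\<lambda>(t, r, q). t powr s * (\<Sum>j\<le>k. f j q * (real j * r ^ (j - 1)))) (1, \<rho>, p)"
      by (rule cong) (auto intro!: has_pd_imp_pd h1[simplified])
    also have "\<dots> = (\<Sum>j\<le>k. f j p * (real j * (real (j - 1) * \<rho> ^ (j - 1 - 1))))"
    proof -
      have "((\<lambda>r. \<Sum>j\<le>k. f j p * (real j * r ^ (j - 1))) has_real_derivative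
         (\<Sum>j\<le>k. f j p * (real j * (real (j - 1) * \<rho> ^ (j - 1 - Suc 0))))) (at \<rho>)"
        by (intro DERIV_sum DERIV_cmult DERIV_pow)
      then show ?thesis by (intro has_pd_imp_pd, subst ambient_has_pd[OF _ \<rho> p]) simp_all
    qed
    finally show ?thesis .
  qed
  have H22: "pd ?A i (a + 2) (pd ?A i (b + 2) u) (1, \<rho>, p) = (\<Sum>j\<le>k. \<rho> ^ j * pd M i a (pd M i b (f j)) p)"
    if ab: "a < ?N" "b < ?N" for a b
  proof -
    have "pd ?A i (a + 2) (pd ?A i (b + 2) u) (1, \<rho>, p) =
      pd ?A i (a + 2) (\<lambda>(t, r, q). t powr s * (\<Sum>j\<le>k. r ^ j * pd M i b (f j) q)) (1, \<rho>, p)"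
      by (rule cong) (use ab in \<open>auto intro!: has_pd_imp_pd h2[simplified]\<close>)
    also have "\<dots> = 1 powr s * (\<Sum>j\<le>k. \<rho> ^ j * pd M i a (pd M i b (f j)) p)"
      by (rule has_pd_imp_pd, subst ambient_has_pd(3)[OF _ \<rho> p ab(1)], simp, simp only: prod.case,
          intro has_pd_cmult has_pd_sum f2) (use ab in auto)
    finally show ?thesis by simp
  qed
  have pdg: "pd ?A i c (gcomp ?A i a b) (1, \<rho>, p) = pd ?A i c h (1, \<rho>, p)"
    if "\<And>t r q. gcomp ?A i a b (t, r, q) = h (t, r, q)" for a b c h
    using that by (intro arg_cong[of _ _ "\<lambda>h. pd ?A i c h _"]) (auto simp: fun_eq_iff)
  note gI = has_pd_imp_pd[OF iffD2[OF ambient_has_pd(1)[OF zero_less_one \<rho> p]]]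
    has_pd_imp_pd[OF iffD2[OF ambient_has_pd(2)[OF zero_less_one \<rho> p]]]
    has_pd_imp_pd[OF iffD2[OF ambient_has_pd(3)[OF zero_less_one \<rho> p]]]
  define D' where "D' = (\<lambda>a b c. pd ?A i a (gcomp ?A i b c) (1, \<rho>, p))"
  have D1: "D' 0 0 1 = 1" "D' 0 1 0 = 1" "D' 0 1 1 = 0" "D' 1 0 0 = 2" "D' 1 0 1 = 0" "D' 1 1 0 = 0" "D' 1 1 1 = 0"
    unfolding D'_def by (rule gI; simp add: ambient_gcomp ambient_gcomp[simplified]; auto intro!: derivative_eq_intros)+
  have D2: "D' (a + 2) 0 1 = 0 \<and> D' (a + 2) 1 0 = 0 \<and> D' (a + 2) 1 1 = 0" if "a < ?N" for a
    unfolding D'_def by (intro conjI; rule gI(3)[OF that]; simp add: ambient_gcomp ambient_gcomp[simplified] has_pd_const)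
  have D3: "D' 0 1 (a + 2) = 0 \<and> D' 1 0 (a + 2) = 0 \<and> D' 1 1 (a + 2) = 0" if "a < ?N" for a
    unfolding D'_def by (intro conjI; rule gI; simp add: ambient_gcomp ambient_gcomp[simplified])
  have D4: "D' (a + 2) (b + 2) 0 = 0 \<and> D' (a + 2) (b + 2) 1 = 0" if "a < ?N" "b < ?N" for a b
    unfolding D'_def by (intro conjI; rule gI(3)[OF that(1)]; simp add: ambient_gcomp ambient_gcomp[simplified] has_pd_const)
  have D5: "D' 0 (a + 2) (b + 2) = 2 * gr \<rho> i a b p \<and> D' 1 (a + 2) (b + 2) = g' a b" if "a < ?N" "b < ?N" for a b
    unfolding D'_def
  proof (intro conjI gI)
    show "((\<lambda>s. gcomp ?A i (a + 2) (b + 2) (s, \<rho>, p)) has_real_derivative 2 * gr \<rho> i a b p) (at 1)"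
      unfolding ambient_gcomp by (rule DERIV_cong[OF DERIV_mult[OF DERIV_pow DERIV_const]]) simp
    show "((\<lambda>s. gcomp ?A i (a + 2) (b + 2) (1, s, p)) has_real_derivative g' a b) (at \<rho>)"
      unfolding ambient_gcomp using g'[OF that] by simp
  qed
  have D6: "D' (a + 2) (b + 2) (c + 2) = D a b c" if "a < ?N" "b < ?N" "c < ?N" for a b c
    unfolding D'_def by (rule gI(3)[OF that(1)]) (use D[OF that] in \<open>simp add: ambient_gcomp[simplified]\<close>)
  have tr: "(\<Sum>a<?N. \<Sum>b<?N. B a b * gr \<rho> i a b p) = real ?N"
    by (rule is_inverse_trace[OF B sym])
  define B' where "B' = (\<lambda>a b. ginv ?A i a b (1, \<rho>, p))"
  have B': "B' a b = (if a < 2 \<and> b < 2 then (if a = 0 \<and> b = 0 then 0 else if a = 1 \<and> b = 1 then - 2 * \<rho> else 1)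
     else if 2 \<le> a \<and> 2 \<le> b then B (a - 2) (b - 2) else 0)" if "a < ?N + 2" "b < ?N + 2" for a b
    unfolding B'_def by (rule ambient_ginv[OF B that])
  define H where "H = (\<lambda>a b. pd ?A i a (pd ?A i b u) (1, \<rho>, p))"
  define G where "G = (\<lambda>c. pd ?A i c u (1, \<rho>, p))"
  have "laplacian_in ?A i u (1, \<rho>, p) = lap_data (?N + 2) B' D' H G"
    unfolding laplacian_in_eq_lap_data B'_def D'_def H_def G_def by simp
  also have "\<dots> = H 0 1 + H 1 0 - 2 * \<rho> * H 1 1 +
     lap_data ?N B D (\<lambda>a b. H (a + 2) (b + 2)) (\<lambda>a. G (a + 2)) +
     (\<Sum>a<?N. \<Sum>b<?N. B a b * g' a b) / 2 * G 0 +
     (real ?N - 2 - \<rho> * (\<Sum>a<?N. \<Sum>b<?N. B a b * g' a b)) * G 1"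
    by (rule lap_data_ambient[OF _ _ _ _ _ _ D1 D2 D3 D4 D5 D6 tr]) (simp_all add: B')
  also have "lap_data ?N B D (\<lambda>a b. H (a + 2) (b + 2)) (\<lambda>a. G (a + 2)) =
     lap_data ?N B D (\<lambda>a b. \<Sum>j\<le>k. \<rho> ^ j * pd M i a (pd M i b (f j)) p) (\<lambda>a. \<Sum>j\<le>k. \<rho> ^ j * pd M i a (f j) p)"
    unfolding lap_data_def by (simp add: H_def G_def H22[simplified] G2[simplified])
  also have "\<dots> = (\<Sum>j\<le>k. \<rho> ^ j * lap_data ?N B D (\<lambda>a b. pd M i a (pd M i b (f j)) p) (\<lambda>a. pd M i a (f j) p))"
    by (rule lap_data_linear)
  finally show ?thesis
    unfolding u_def[symmetric] H_def G_def H01 H10 H11 G0 G1 by (simp add: algebra_simps)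
qed

end

section \<open>The ambient Laplacian over a product\<close>

lemma lap_data_cong:
  assumes "\<And>a b. a < d \<Longrightarrow> b < d \<Longrightarrow> H a b = H' a b" "\<And>a. a < d \<Longrightarrow> G a = G' a"
  shows "lap_data d B D H G = lap_data d B D H' G'"
  unfolding lap_data_def using assms by simp

lemma is_inverse_block:
  assumes A: "is_inverse d1 A1 B1" "is_inverse d2 A2 B2"
    and "\<And>a b. a < d1 \<Longrightarrow> b < d1 \<Longrightarrow> A a b = A1 a b \<and> B a b = B1 a b"
    "\<And>a b. a < d2 \<Longrightarrow> b < d2 \<Longrightarrow> A (d1 + a) (d1 + b) = A2 a b \<and> B (d1 + a) (d1 + b) = B2 a b"
    "\<And>a b. a < d1 \<Longrightarrow> b < d2 \<Longrightarrow> A a (d1 + b) = 0 \<and> A (d1 + b) a = 0 \<and> B a (d1 + b) = 0 \<and> B (d1 + b) a = 0"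
  shows "is_inverse (d1 + d2) A B"
  unfolding is_inverse_def sum_lessThan_add
proof (intro allI impI)
  fix a b assume a: "a < d1 + d2" and b: "b < d1 + d2"
  have cases: "c < d1 \<or> (\<exists>e<d2. c = d1 + e)" if "c < d1 + d2" for c
    using that by presburger
  show "(\<Sum>c<d1. A a c * B c b) + (\<Sum>c<d2. A a (d1 + c) * B (d1 + c) b) = (if a = b then 1 else 0) \<and>
      (\<Sum>c<d1. B a c * A c b) + (\<Sum>c<d2. B a (d1 + c) * A (d1 + c) b) = (if a = b then 1 else 0)"
    using cases[OF a] cases[OF b] A assms(3-5)
    by (elim disjE exE conjE) (auto simp: is_inverse_def)
qed

lemma is_inverse_scale:
  "is_inverse d A B \<Longrightarrow> \<alpha> \<noteq> 0 \<Longrightarrow> is_inverse d (\<lambda>a b. \<alpha> * A a b) (\<lambda>a b. B a b / \<alpha>)"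
  by (simp add: is_inverse_def)

text \<open>For fixed \<rho> the two blocks of the metric are constant multiples of the factor
  metrics, so the slice Laplacian is a weighted sum of the factor Laplacians. The degree s = k - N/2
  makes 2 s - 2 + N equal to 2 k - 2, independently of the dimensions.\<close>

lemma product_ambient_laplacian_in:
  fixes X :: "('a, 'i) mfd" and F :: "('b, 'j) mfd" and f :: "nat \<Rightarrow> 'a \<times> 'b \<Rightarrow> real" and k :: nat
  defines "W \<equiv> warped_product X (\<lambda>_. 1) F"
  assumes X: "metric_ok X i" and F: "metric_ok F j" and x: "x \<in> chart_dom X i" and z: "z \<in> chart_dom F j"
    and \<rho>: "\<bar>\<rho>\<bar> < 2"
    and f: "\<And>m. m \<le> k \<Longrightarrow> smooth_in W (i, j) (chart_dom W (i, j)) (f m)"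
    and gr: "\<And>r. gr r = block_metric X F (\<lambda>_. (1 - r / 2)\<^sup>2) (\<lambda>_. (1 + r / 2)\<^sup>2)"
  defines "\<tau> \<equiv> real (mdim F) * inverse (1 + \<rho> / 2) - real (mdim X) * inverse (1 - \<rho> / 2)"
  defines "s \<equiv> real k - (real (mdim X) + real (mdim F)) / 2"
  shows "laplacian_in (ambient_space W gr) (i, j) (homogeneous_ext W k f) (1, \<rho>, x, z) =
     (2 * real k - 2 - \<rho> * \<tau>) * (\<Sum>m\<le>k. f m (x, z) * (real m * \<rho> ^ (m - 1)))
     - 2 * \<rho> * (\<Sum>m\<le>k. f m (x, z) * (real m * (real (m - 1) * \<rho> ^ (m - 1 - 1))))
     + s / 2 * \<tau> * (\<Sum>m\<le>k. f m (x, z) * \<rho> ^ m)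
     + (inverse (1 - \<rho> / 2))\<^sup>2 * (\<Sum>m\<le>k. laplacian_in X i (\<lambda>x'. f m (x', z)) x * \<rho> ^ m)
     + (inverse (1 + \<rho> / 2))\<^sup>2 * (\<Sum>m\<le>k. laplacian_in F j (\<lambda>z'. f m (x, z')) z * \<rho> ^ m)"
proof -
  define n where "n = mdim X"
  define l where "l = mdim F"
  define \<alpha> where "\<alpha> = (1 - \<rho> / 2)\<^sup>2"
  define \<beta> where "\<beta> = (1 + \<rho> / 2)\<^sup>2"
  have nz: "1 - \<rho> / 2 \<noteq> 0" "1 + \<rho> / 2 \<noteq> 0" using \<rho> by auto
  then have ab: "\<alpha> \<noteq> 0" "\<beta> \<noteq> 0" by (auto simp: \<alpha>_def \<beta>_def)
  have lX: "line_open X i (chart_dom X i)" and lF: "line_open F j (chart_dom F j)"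
    using X F by (auto simp: metric_ok_def)
  have lW: "line_open W (i, j) (chart_dom W (i, j))" unfolding W_def by (rule product_line_open[OF lX lF])
  have P: "(x, z) \<in> chart_dom W (i, j)" using x z by (simp add: W_def)
  have dW: "mdim W = n + l" by (simp add: W_def n_def l_def)
  have iX: "is_inverse n (\<lambda>a b. gcomp X i a b x) (\<lambda>a b. ginv X i a b x)"
    and symX: "\<And>a b. a < n \<Longrightarrow> b < n \<Longrightarrow> gcomp X i a b x = gcomp X i b a x"
    and dX: "\<And>a b c. a < n \<Longrightarrow> b < n \<Longrightarrow> c < n \<Longrightarrow> has_pd X i c (gcomp X i a b) x (pd X i c (gcomp X i a b) x)"
    using X x by (auto simp: metric_ok_def n_def)
  have iF: "is_inverse l (\<lambda>a b. gcomp F j a b z) (\<lambda>a b. ginv F j a b z)"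
    and symF: "\<And>a b. a < l \<Longrightarrow> b < l \<Longrightarrow> gcomp F j a b z = gcomp F j b a z"
    and dF: "\<And>a b c. a < l \<Longrightarrow> b < l \<Longrightarrow> c < l \<Longrightarrow> has_pd F j c (gcomp F j a b) z (pd F j c (gcomp F j a b) z)"
    using F z by (auto simp: metric_ok_def l_def)
  have gr1: "gr r (i, j) a b (x', z') = (1 - r / 2)\<^sup>2 * gcomp X i a b x'" if "a < n" "b < n" for r a b x' z'
    using that by (simp add: gr block_metric_def n_def)
  have gr2: "gr r (i, j) (n + a) (n + b) (x', z') = (1 + r / 2)\<^sup>2 * gcomp F j a b z'" for r a b x' z'
    by (simp add: gr block_metric_def n_def)
  have gr3: "gr r (i, j) a (n + b) (x', z') = 0" "gr r (i, j) (n + b) a (x', z') = 0" if "a < n" for r a b x' z'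
    using that by (simp_all add: gr block_metric_def n_def)
  note g\<alpha> = gr1[of _ _ \<rho>, folded \<alpha>_def] and g\<beta> = gr2[of \<rho>, folded \<beta>_def]
  define B where "B = (\<lambda>a b. if a < n \<and> b < n then ginv X i a b x / \<alpha>
     else if n \<le> a \<and> n \<le> b then ginv F j (a - n) (b - n) z / \<beta> else 0)"
  \<comment> \<open>\<open>\<alpha>'\<close> and \<open>\<beta>'\<close> are the derivatives of
    \<open>\<alpha>\<close> and \<open>\<beta>\<close> in \<rho>; the logarithmic derivatives
    \<open>\<alpha>' / \<alpha>\<close> and \<open>\<beta>' / \<beta>\<close> times the dimensions
    add up to \<open>\<tau>\<close>.\<close>
  define \<alpha>' where "\<alpha>' = - (1 - \<rho> / 2)"
  define \<beta>' where "\<beta>' = 1 + \<rho> / 2"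
  have d\<alpha>: "((\<lambda>r. (1 - r / 2)\<^sup>2 * c) has_real_derivative \<alpha>' * c) (at \<rho>)"
    and d\<beta>: "((\<lambda>r. (1 + r / 2)\<^sup>2 * c) has_real_derivative \<beta>' * c) (at \<rho>)" for c
    by (auto simp: \<alpha>'_def \<beta>'_def field_simps intro!: derivative_eq_intros)
  define g' where "g' = (\<lambda>a b. if a < n \<and> b < n then \<alpha>' * gcomp X i a b x
     else if n \<le> a \<and> n \<le> b then \<beta>' * gcomp F j (a - n) (b - n) z else 0)"
  define D where "D = (\<lambda>a b c. if a < n \<and> b < n \<and> c < n then \<alpha> * pd X i a (gcomp X i b c) x
     else if n \<le> a \<and> n \<le> b \<and> n \<le> c then \<beta> * pd F j (a - n) (gcomp F j (b - n) (c - n)) z else 0)"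
  have cases: "c < n \<or> (\<exists>e<l. c = n + e)" if "c < mdim W" for c
    using that unfolding dW by presburger
  have B: "is_inverse (mdim W) (\<lambda>a b. gr \<rho> (i, j) a b (x, z)) B"
    unfolding dW
    by (rule is_inverse_block[OF is_inverse_scale[OF iX ab(1)] is_inverse_scale[OF iF ab(2)]])
      (simp_all add: g\<alpha> g\<beta> gr3 B_def)
  have sym: "gr \<rho> (i, j) a b (x, z) = gr \<rho> (i, j) b a (x, z)" if "a < mdim W" "b < mdim W" for a b
    using cases[OF that(1)] cases[OF that(2)] by (elim disjE exE conjE) (simp_all add: g\<alpha> g\<beta> gr3 symX symF)
  have g': "((\<lambda>r. gr r (i, j) a b (x, z)) has_real_derivative g' a b) (at \<rho>)" if "a < mdim W" "b < mdim W" for a b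
    using cases[OF that(1)] cases[OF that(2)]
    by (elim disjE exE conjE) (simp_all add: gr1 gr2 gr3 g'_def d\<alpha> d\<beta>)
  have D: "has_pd W (i, j) a (gr \<rho> (i, j) b c) (x, z) (D a b c)"
    if "a < mdim W" "b < mdim W" "c < mdim W" for a b c
  proof -
    have 1: "has_pd W (i, j) a (gr \<rho> (i, j) b c) (x, z) (D a b c) \<longleftrightarrow>
       has_pd X i a (\<lambda>x'. gr \<rho> (i, j) b c (x', z)) x (D a b c)" if "a < n"
      unfolding W_def by (rule product_has_pd(1)[OF lX lF x z]) (use that n_def in auto)
    have 2: "has_pd W (i, j) (n + e) (gr \<rho> (i, j) b c) (x, z) (D a b c) \<longleftrightarrow>
       has_pd F j e (\<lambda>z'. gr \<rho> (i, j) b c (x, z')) z (D a b c)" if "e < l" for e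
      unfolding W_def n_def by (rule product_has_pd(2)[OF lX lF x z]) (use that l_def in auto)
    from cases[OF that(1)] show ?thesis
    proof (elim disjE exE conjE)
      assume a: "a < n"
      have "has_pd X i a (\<lambda>x'. gr \<rho> (i, j) b c (x', z)) x (D a b c)"
        using cases[OF that(2)] cases[OF that(3)]
      proof (elim disjE exE conjE)
        assume bc: "b < n" "c < n"
        show ?thesis using has_pd_cmult[OF dX[OF bc a], of \<alpha>] a bc by (simp add: g\<alpha> D_def)
      qed (use a in \<open>simp_all add: g\<beta> gr3 D_def has_pd_const\<close>)
      then show ?thesis unfolding 1[OF a] .
    next
      fix e assume e: "e < l" "a = n + e"
      have "has_pd F j e (\<lambda>z'. gr \<rho> (i, j) b c (x, z')) z (D a b c)"
        using cases[OF that(2)] cases[OF that(3)]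
      proof (elim disjE exE conjE)
        fix b' c' assume bc: "b' < l" "b = n + b'" "c' < l" "c = n + c'"
        show ?thesis using has_pd_cmult[OF dF[OF bc(1,3) e(1)], of \<beta>] e bc by (simp add: g\<beta> D_def)
      qed (use e in \<open>simp_all add: g\<alpha> gr3 D_def has_pd_const\<close>)
      with 2[OF e(1)] show ?thesis by (simp only: e(2))
    qed
  qed
  have f1: "has_pd W (i, j) a (f m) q (pd W (i, j) a (f m) q)"
    if "m \<le> k" "q \<in> chart_dom W (i, j)" "a < mdim W" for m q a
    by (rule smooth_in_has_pd[OF f[OF that(1)] that(2,3)])
  have f2: "has_pd W (i, j) a (pd W (i, j) b (f m)) (x, z) (pd W (i, j) a (pd W (i, j) b (f m)) (x, z))"
    if "m \<le> k" "a < mdim W" "b < mdim W" for m a b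
    by (rule smooth_in_has_pd[OF smooth_in_pd[OF that(3) f[OF that(1)]] P that(2)])
  have cancel: "- c / c\<^sup>2 * N = - N * inverse c" "c / c\<^sup>2 * N = N * inverse c" for c N :: real
    by (cases "c = 0"; simp add: power2_eq_square field_simps)+
  have trX: "(\<Sum>a<n. \<Sum>b<n. ginv X i a b x * gcomp X i a b x) = real n"
    by (rule is_inverse_trace[OF iX symX])
  have trF: "(\<Sum>a<l. \<Sum>b<l. ginv F j a b z * gcomp F j a b z) = real l"
    by (rule is_inverse_trace[OF iF symF])
  have tau: "(\<Sum>a<mdim W. \<Sum>b<mdim W. B a b * g' a b) = \<tau>"
  proof -
    have "(\<Sum>a<mdim W. \<Sum>b<mdim W. B a b * g' a b) =
      (\<Sum>a<n. \<Sum>b<n. ginv X i a b x / \<alpha> * (\<alpha>' * gcomp X i a b x)) +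
      (\<Sum>a<l. \<Sum>b<l. ginv F j a b z / \<beta> * (\<beta>' * gcomp F j a b z))"
      unfolding dW sum_lessThan_add by (simp add: B_def g'_def)
    also have "(\<Sum>a<n. \<Sum>b<n. ginv X i a b x / \<alpha> * (\<alpha>' * gcomp X i a b x)) =
      \<alpha>' / \<alpha> * (\<Sum>a<n. \<Sum>b<n. ginv X i a b x * gcomp X i a b x)"
      unfolding sum_distrib_left by (intro sum.cong refl) simp
    also have "\<dots> = - real n * inverse (1 - \<rho> / 2)"
      unfolding trX \<alpha>_def \<alpha>'_def by (rule cancel)
    also have "(\<Sum>a<l. \<Sum>b<l. ginv F j a b z / \<beta> * (\<beta>' * gcomp F j a b z)) =
      \<beta>' / \<beta> * (\<Sum>a<l. \<Sum>b<l. ginv F j a b z * gcomp F j a b z)"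
      unfolding sum_distrib_left by (intro sum.cong refl) simp
    also have "\<dots> = real l * inverse (1 + \<rho> / 2)"
      unfolding trF \<beta>_def \<beta>'_def by (rule cancel)
    finally show ?thesis by (simp add: \<tau>_def n_def l_def)
  qed
  have lap: "lap_data (mdim W) B D (\<lambda>a b. pd W (i, j) a (pd W (i, j) b (f m)) (x, z)) (\<lambda>a. pd W (i, j) a (f m) (x, z)) =
     laplacian_in X i (\<lambda>x'. f m (x', z)) x / \<alpha> + laplacian_in F j (\<lambda>z'. f m (x, z')) z / \<beta>" for m
  proof -
    let ?H = "\<lambda>a b. pd W (i, j) a (pd W (i, j) b (f m)) (x, z)"
    let ?G = "\<lambda>a. pd W (i, j) a (f m) (x, z)"
    have "lap_data (mdim W) B D ?H ?G =
      lap_data n (\<lambda>a b. ginv X i a b x / \<alpha>) (\<lambda>a b c. \<alpha> * pd X i a (gcomp X i b c) x) ?H ?G +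
      lap_data l (\<lambda>a b. ginv F j a b z / \<beta>) (\<lambda>a b c. \<beta> * pd F j a (gcomp F j b c) z)
        (\<lambda>a b. ?H (n + a) (n + b)) (\<lambda>a. ?G (n + a))"
      unfolding dW by (rule lap_data_block) (simp_all add: B_def D_def)
    also have "\<dots> = lap_data n (\<lambda>a b. ginv X i a b x) (\<lambda>a b c. pd X i a (gcomp X i b c) x) ?H ?G / \<alpha> +
      lap_data l (\<lambda>a b. ginv F j a b z) (\<lambda>a b c. pd F j a (gcomp F j b c) z)
        (\<lambda>a b. ?H (n + a) (n + b)) (\<lambda>a. ?G (n + a)) / \<beta>"
      by (simp only: lap_data_scale[OF ab(1)] lap_data_scale[OF ab(2)])
    also have "lap_data n (\<lambda>a b. ginv X i a b x) (\<lambda>a b c. pd X i a (gcomp X i b c) x) ?H ?G =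
       laplacian_in X i (\<lambda>x'. f m (x', z)) x"
      unfolding laplacian_in_eq_lap_data n_def[symmetric]
    proof (rule lap_data_cong)
      fix a b assume ab: "a < n" "b < n"
      have "?H a b = pd X i a (\<lambda>x'. pd W (i, j) b (f m) (x', z)) x"
        unfolding W_def using ab by (intro product_pd(1)[OF lX lF x z]) (simp add: n_def)
      also have "\<dots> = pd X i a (pd X i b (\<lambda>x'. f m (x', z))) x"
        by (rule pd_cong[OF lX x]) (use ab product_pd(1)[OF lX lF _ z] in \<open>auto simp: W_def n_def\<close>)
      finally show "?H a b = \<dots>" .
    qed (use product_pd(1)[OF lX lF x z] in \<open>auto simp: W_def n_def\<close>)
    also have "lap_data l (\<lambda>a b. ginv F j a b z) (\<lambda>a b c. pd F j a (gcomp F j b c) z)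
        (\<lambda>a b. ?H (n + a) (n + b)) (\<lambda>a. ?G (n + a)) = laplacian_in F j (\<lambda>z'. f m (x, z')) z"
      unfolding laplacian_in_eq_lap_data l_def[symmetric]
    proof (rule lap_data_cong)
      fix a b assume ab: "a < l" "b < l"
      have "?H (n + a) (n + b) = pd F j a (\<lambda>z'. pd W (i, j) (n + b) (f m) (x, z')) z"
        unfolding W_def n_def using ab by (intro product_pd(2)[OF lX lF x z]) (simp add: l_def)
      also have "\<dots> = pd F j a (pd F j b (\<lambda>z'. f m (x, z'))) z"
        by (rule pd_cong[OF lF z]) (use ab product_pd(2)[OF lX lF x] in \<open>auto simp: W_def n_def l_def\<close>)
      finally show "?H (n + a) (n + b) = \<dots>" .
    qed (use product_pd(2)[OF lX lF x z] in \<open>auto simp: W_def n_def l_def\<close>)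
    finally show ?thesis .
  qed
  have s: "- real (mdim W) / 2 + real k = s" by (simp add: s_def dW n_def l_def add_divide_distrib)
  have s2: "2 * s - 2 + real (mdim W) = 2 * real k - 2" by (simp add: s_def dW n_def l_def field_simps)
  have regroup: "r * (u / c\<^sup>2 + v / e\<^sup>2) = (inverse c)\<^sup>2 * (u * r) + (inverse e)\<^sup>2 * (v * r)" for r u v c e :: real
    by (simp add: divide_inverse power_inverse algebra_simps)
  have "(\<Sum>m\<le>k. \<rho> ^ m * (laplacian_in X i (\<lambda>x'. f m (x', z)) x / \<alpha> + laplacian_in F j (\<lambda>z'. f m (x, z')) z / \<beta>)) =
      (inverse (1 - \<rho> / 2))\<^sup>2 * (\<Sum>m\<le>k. laplacian_in X i (\<lambda>x'. f m (x', z)) x * \<rho> ^ m)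
     + (inverse (1 + \<rho> / 2))\<^sup>2 * (\<Sum>m\<le>k. laplacian_in F j (\<lambda>z'. f m (x, z')) z * \<rho> ^ m)"
    unfolding sum_distrib_left sum.distrib[symmetric]
    unfolding \<alpha>_def \<beta>_def by (intro sum.cong refl regroup)
  moreover have "laplacian_in (ambient_space W gr) (i, j) (homogeneous_ext W k f) (1, \<rho>, x, z) =
     (2 * (- real (mdim W) / 2 + real k) - 2 + real (mdim W) - \<rho> * (\<Sum>a<mdim W. \<Sum>b<mdim W. B a b * g' a b))
       * (\<Sum>m\<le>k. f m (x, z) * (real m * \<rho> ^ (m - 1)))
     - 2 * \<rho> * (\<Sum>m\<le>k. f m (x, z) * (real m * (real (m - 1) * \<rho> ^ (m - 1 - 1))))
     + (- real (mdim W) / 2 + real k) / 2 * (\<Sum>a<mdim W. \<Sum>b<mdim W. B a b * g' a b) * (\<Sum>m\<le>k. f m (x, z) * \<rho> ^ m)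
     + (\<Sum>m\<le>k. \<rho> ^ m * lap_data (mdim W) B D (\<lambda>a b. pd W (i, j) a (pd W (i, j) b (f m)) (x, z))
         (\<lambda>a. pd W (i, j) a (f m) (x, z)))"
    by (rule ambient_laplacian_in[where gr = gr, OF lW \<rho> P B]; (rule sym g' D f1 f2; assumption))
  ultimately show ?thesis
    unfolding s tau lap s2 by simp
qed

section \<open>The obstruction as a formal power series\<close>

text \<open>\<open>fps_a\<close> and \<open>fps_b\<close> are the radial variables of the two cones
  at t = 1; their squares scale the two blocks of the metric.\<close>

definition fps_a :: "real fps" where "fps_a = 1 - fps_const (1/2) * fps_X"
definition fps_b :: "real fps" where "fps_b = 1 + fps_const (1/2) * fps_X"
definition fps_tau :: "real \<Rightarrow> real \<Rightarrow> real fps" where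
  "fps_tau d l = fps_const l * inverse fps_b - fps_const d * inverse fps_a"

text \<open>
  The ambient Laplacian at \<open>t = 1\<close> on functions homogeneous of degree \<open>w\<close>, with \<open>\<mu>\<close> in place of the Laplacian of
  \<open>X\<close>; \<open>d = dim X\<close>, and \<open>fps_tau d l\<close> is the trace of \<open>g\<^sub>\<rho>\<^sup>-\<^sup>1 \<partial>\<^sub>\<rho> g\<^sub>\<rho>\<close>.
\<close>

definition amb_op :: "real \<Rightarrow> real \<Rightarrow> real \<Rightarrow> real \<Rightarrow> real fps \<Rightarrow> real fps" where
  "amb_op d l \<mu> w F = fps_const (2 * w - 2 + d + l) * fps_deriv F
     - 2 * fps_X * fps_deriv (fps_deriv F) - fps_X * fps_tau d l * fps_deriv F
     + fps_const (w / 2) * fps_tau d l * F + fps_const \<mu> * (inverse fps_a)\<^sup>2 * F"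

lemma amb_op_add: "amb_op d l \<mu> w (F + G) = amb_op d l \<mu> w F + amb_op d l \<mu> w G"
  by (simp add: amb_op_def algebra_simps)

lemma amb_op_cmult: "amb_op d l \<mu> w (fps_const c * F) = fps_const c * amb_op d l \<mu> w F"
  by (simp add: amb_op_def algebra_simps)

text \<open>The commutator with \<rho> t^2, which has gradient the Euler field T and Laplacian N +
  2. On functions of degree w - 2 the commutator 2 T + N + 2 is the number 2 (w - 2) + N + 2, with N
  = d + l. Since \<rho> t^2 has degree 2, H carries degree w - 2.\<close>

lemma amb_op_X_mult:
  "amb_op d l \<mu> w (fps_X * H) = fps_X * amb_op d l \<mu> (w - 2) H + fps_const (2 * w + d + l - 2) * H"
proof -
  have 1: "fps_const (2 * w - 2 + d + l) = fps_const (2 * (w-2) - 2 + d + l) + 4"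
    by (simp flip: fps_const_add numeral_fps_const)
  have 2: "fps_const (w/2) = fps_const ((w - 2)/2) + 1"
    by (simp add: diff_divide_distrib flip: fps_const_add)
  have 3: "fps_const (2 * w + d + l - 2) = fps_const (2 * (w-2) - 2 + d + l) + 4"
    by (simp flip: numeral_fps_const)
  show ?thesis unfolding amb_op_def 2 3 unfolding 1 by (simp add: algebra_simps)
qed

text \<open>The binomial series of (1 - \<rho>/2)^w for real w.\<close>

definition cone_power :: "real \<Rightarrow> real fps" where
  "cone_power w = Abs_fps (\<lambda>n. (w gchoose n) * (- 1 / 2) ^ n)"

lemma cone_power_0: "fps_nth (cone_power w) 0 = 1"
  by (simp add: cone_power_def)

lemma cone_power_Suc: "cone_power (w + 1) = fps_a * cone_power w"
proof (rule fps_ext)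
  fix n show "fps_nth (cone_power (w + 1)) n = fps_nth (fps_a * cone_power w) n"
  proof (cases n)
    case (Suc m)
    have "fps_nth (fps_a * cone_power w) (Suc m) =
      (- 1 / 2) ^ Suc m * ((w gchoose m) + (w gchoose Suc m))"
      by (simp add: cone_power_def fps_a_def left_diff_distrib mult.assoc) (simp add: algebra_simps)
    then show ?thesis
      unfolding Suc by (simp only: gbinomial_Suc_Suc[symmetric]) (simp add: cone_power_def)
  qed (simp add: cone_power_def fps_a_def)
qed

lemma cone_power_deriv: "fps_deriv (cone_power w) = - fps_const (w / 2) * cone_power (w - 1)"
proof (rule fps_ext)
  fix n show "fps_nth (fps_deriv (cone_power w)) n = fps_nth (- fps_const (w / 2) * cone_power (w - 1)) n"
  proof -
    have e: "real (Suc n) * (w gchoose Suc n) = w * (w - 1 gchoose n)"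
      using gbinomial_absorption'[of "Suc n" w] by (simp add: field_simps)
    have "fps_nth (fps_deriv (cone_power w)) n = (- 1 / 2) ^ Suc n * (real (Suc n) * (w gchoose Suc n))"
      by (simp add: cone_power_def)
    then show ?thesis unfolding e by (simp add: cone_power_def)
  qed
qed

lemma inverse_ab: "inverse fps_a * fps_a = 1" "inverse fps_b * fps_b = 1"
  by (simp_all add: fps_a_def fps_b_def inverse_mult_eq_1)

text \<open>The radial part of the Laplacian of \<open>- dr^2 + r^2 g\<close> in dimension d + 1
  maps r^w to - w (w + d - 1) r^(w-2). The other cone contributes nothing, so l disappears.\<close>

lemma amb_op_cone_power:
  "amb_op d l \<mu> w (cone_power w) = fps_const (\<mu> - w * (w + d - 1)) * cone_power (w - 2)"
proof -
  define C where "C = cone_power (w - 2)"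
  define a where "a = fps_a" define b where "b = fps_b"
  define ia where "ia = inverse fps_a" define ib where "ib = inverse fps_b"
  have ia: "ia * a = 1" "ib * b = 1" by (auto simp: ia_def ib_def a_def b_def inverse_ab)
  have c1: "cone_power (w - 1) = a * C"
    using cone_power_Suc[of "w - 2"] by (simp add: C_def a_def)
  have c0: "cone_power w = a * (a * C)"
    using cone_power_Suc[of "w - 1"] by (simp add: c1 a_def)
  define W where "W = fps_const (w/2)"
  have d1: "fps_deriv (cone_power w) = - W * (a * C)"
    by (simp only: cone_power_deriv c1 W_def)
  have d2: "fps_deriv (fps_deriv (cone_power w)) = fps_const (w / 2 * ((w - 1) / 2)) * C"
    unfolding cone_power_deriv C_def
    by (simp add: cone_power_deriv  mult.assoc[symmetric] del: mult.assoc)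
  \<comment> \<open>Expressing \<rho> and b through a turns the claim into a ring identity modulo
    \<open>ia * a = 1\<close> and \<open>ib * b = 1\<close>.\<close>
  have X: "fps_X = 2 * (1 - a)"
    by (rule fps_ext) (auto simp: a_def fps_a_def fps_X_def numeral_fps_const)
  have b: "b = 2 - a" by (simp add: b_def a_def fps_a_def fps_b_def)
  define D where "D = fps_const d"
  define L where "L = fps_const l"
  define M where "M = fps_const \<mu>"
  have w: "fps_const w = 2 * W" by (simp add: W_def numeral_fps_const)
  have e1: "fps_const (2 * w - 2 + d + l) = 4 * W - 2 + D + L"
    by (simp add: W_def D_def L_def numeral_fps_const)
  have e2: "fps_const (w / 2 * ((w - 1) / 2)) * 2 = W * (2 * W - 1)"
    by (simp add: W_def numeral_fps_const flip: fps_const_1_eq_1)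
  have e3: "fps_const (\<mu> - w * (w + d - 1)) = M - 2 * W * (2 * W + D - 1)"
    by (simp add: W_def D_def M_def numeral_fps_const flip: fps_const_1_eq_1)
  have tau: "fps_tau d l = L * ib - D * ia" by (simp add: fps_tau_def L_def D_def ia_def ib_def)
  have "amb_op d l \<mu> w (cone_power w) =
    (4 * W - 2 + D + L) * (- W * (a * C)) - fps_X * (fps_const (w / 2 * ((w - 1) / 2)) * 2) * C
    - fps_X * (L * ib - D * ia) * (- W * (a * C)) + W * (L * ib - D * ia) * (a * (a * C))
    + M * ia\<^sup>2 * (a * (a * C))"
    unfolding amb_op_def d2 unfolding d1 unfolding c0 tau e1 by (simp add: M_def ia_def algebra_simps flip: W_def)
  also have "\<dots> = (4 * W - 2 + D + L) * (- W * (a * C)) - 2 * (1 - a) * (W * (2 * W - 1)) * C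
    + W * (L * ib - D * ia) * a * C * (2 * (1 - a) + a)
    + M * (ia * a) * (ia * a) * C"
    unfolding e2 X by (simp add: algebra_simps power2_eq_square)
  \<comment> \<open>The two terms with the trace combine to the factor \<rho> + a = 2 - a = b, which
    cancels \<open>ib\<close>.\<close>
  also have "W * (L * ib - D * ia) * a * C * (2 * (1 - a) + a) = W * L * (ib * b) * a * C - W * D * (ia * a) * b * C"
    by (simp add: b algebra_simps)
  finally show ?thesis unfolding ia e3 C_def[symmetric] by (simp add: b algebra_simps)
qed

section \<open>Powers of the ambient Laplacian\<close>

fun amb_iter :: "real \<Rightarrow> real \<Rightarrow> real \<Rightarrow> nat \<Rightarrow> real \<Rightarrow> real fps \<Rightarrow> real fps" where
  "amb_iter d l \<mu> 0 w F = F"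
| "amb_iter d l \<mu> (Suc k) w F = amb_iter d l \<mu> k (w - 2) (amb_op d l \<mu> w F)"

lemma amb_iter_add: "amb_iter d l \<mu> k w (F + G) = amb_iter d l \<mu> k w F + amb_iter d l \<mu> k w G"
  by (induction k arbitrary: w F G) (simp_all add: amb_op_add)

lemma amb_iter_cmult: "amb_iter d l \<mu> k w (fps_const c * F) = fps_const c * amb_iter d l \<mu> k w F"
  by (induction k arbitrary: w F) (simp_all add: amb_op_cmult)

text \<open>The commutator numbers 2 w' + d + l - 2 are summed over the degrees w' = w, w - 2, ...,
  w - 2 k. Their sum vanishes exactly at w = k + 1 - (d + l)/2, the degree in which k + 1 Laplacians
  descend to the cone \<rho> = 0.\<close>

lemma amb_iter_X_mult:
  "amb_iter d l \<mu> (Suc k) w (fps_X * H) = fps_X * amb_iter d l \<mu> (Suc k) (w - 2) H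
     + fps_const ((real k + 1) * (2 * w + d + l - 2 * real k - 2)) * amb_iter d l \<mu> k (w - 2) H"
proof (induction k arbitrary: w H)
  case 0
  then show ?case by (simp add: amb_op_X_mult algebra_simps)
next
  case (Suc k)
  have e: "fps_const ((real k + 1) * (2 * (w - 2) + d + l - 2 * real k - 2)) + fps_const (2 * w + d + l - 2)
    = fps_const ((real (Suc k) + 1) * (2 * w + d + l - 2 * real (Suc k) - 2))"
    by (simp only: fps_const_add, rule arg_cong[of _ _ fps_const]) (simp add: algebra_simps)
  have "amb_iter d l \<mu> (Suc (Suc k)) w (fps_X * H) =
     amb_iter d l \<mu> (Suc k) (w - 2) (fps_X * amb_op d l \<mu> (w - 2) H)
     + fps_const (2 * w + d + l - 2) * amb_iter d l \<mu> (Suc k) (w - 2) H"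
    by (simp only: amb_iter.simps(2)[of _ _ _ "Suc k" w] amb_op_X_mult amb_iter_add amb_iter_cmult)
  also have "\<dots> = fps_X * amb_iter d l \<mu> (Suc (Suc k)) (w - 2) H
     + (fps_const ((real k + 1) * (2 * (w - 2) + d + l - 2 * real k - 2)) + fps_const (2 * w + d + l - 2))
        * amb_iter d l \<mu> (Suc k) (w - 2) H"
    unfolding Suc.IH by (simp only: amb_iter.simps distrib_right add.assoc)
  finally show ?case unfolding e .
qed

lemma amb_iter_cone_power:
  "amb_iter d l \<mu> k w (cone_power w) =
     fps_const (\<Prod>i<k. \<mu> - (w - 2 * real i) * (w - 2 * real i + d - 1)) * cone_power (w - 2 * real k)"
proof (induction k arbitrary: w)
  case (Suc k)
  have "amb_iter d l \<mu> (Suc k) w (cone_power w) = fps_const (\<mu> - w * (w + d - 1)) *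
     (fps_const (\<Prod>i<k. \<mu> - (w - 2 - 2 * real i) * (w - 2 - 2 * real i + d - 1)) * cone_power (w - 2 - 2 * real k))"
    by (simp only: amb_iter.simps amb_op_cone_power amb_iter_cmult Suc.IH)
  also have "\<dots> = fps_const ((\<mu> - w * (w + d - 1)) * (\<Prod>i<k. \<mu> - (w - 2 - 2 * real i) * (w - 2 - 2 * real i + d - 1)))
     * cone_power (w - 2 - 2 * real k)" by (simp flip: mult.assoc)
  also have "(\<mu> - w * (w + d - 1)) * (\<Prod>i<k. \<mu> - (w - 2 - 2 * real i) * (w - 2 - 2 * real i + d - 1)) =
     (\<Prod>i<Suc k. \<mu> - (w - 2 * real i) * (w - 2 * real i + d - 1))"
    by (simp add: prod.lessThan_Suc_shift algebra_simps del: prod.lessThan_Suc)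
  finally show ?case by (simp add: algebra_simps)
qed auto

text \<open>At \<rho> = 0 only the commutator term survives, so each Laplacian strips one factor
  \<rho> and contributes the number - 2 (j + 1) (k - 1 - j). The factorial on the left clears the
  quotient (k - 1)! / (k - 1 - j)!.\<close>

lemma amb_iter_X_power:
  assumes "j < k"
  shows "fps_nth (amb_iter d l \<mu> j (real k - (d + l) / 2 - 2 * (real k - real j)) (fps_X ^ j * G)) 0
    * fact (k - 1 - j) = (- 2) ^ j * fact j * fact (k - 1) * fps_nth G 0"
  using assms
proof (induction j)
  case (Suc j)
  define w where "w = real k - (d + l) / 2 - 2 * (real k - real (Suc j))"
  have w2: "w - 2 = real k - (d + l) / 2 - 2 * (real k - real j)" by (simp add: w_def)
  have c: "(real j + 1) * (2 * w + d + l - 2 * real j - 2) = - 2 * (real j + 1) * real (k - Suc j)"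
    using Suc.prems by (simp add: w_def of_nat_diff field_simps)
  have f: "fact (k - 1 - j) = real (k - Suc j) * fact (k - 1 - Suc j)"
    using Suc.prems fact_reduce[of "k - Suc j", where ?'a = real] by (simp)
  have "fps_nth (amb_iter d l \<mu> (Suc j) w (fps_X ^ Suc j * G)) 0 =
     - 2 * (real j + 1) * real (k - Suc j) * fps_nth (amb_iter d l \<mu> j (w - 2) (fps_X ^ j * G)) 0"
    by (simp add: mult.assoc amb_iter_X_mult c del: amb_iter.simps)
  then have "fps_nth (amb_iter d l \<mu> (Suc j) w (fps_X ^ Suc j * G)) 0 * fact (k - 1 - Suc j) =
     - 2 * (real j + 1) * (fps_nth (amb_iter d l \<mu> j (w - 2) (fps_X ^ j * G)) 0 * fact (k - 1 - j))"
    unfolding f by simp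
  also have "\<dots> = (- 2) ^ Suc j * fact (Suc j) * fact (k - 1) * fps_nth G 0"
    unfolding w2 using Suc by (simp add: algebra_simps)
  finally show ?case by (simp add: w_def)
qed auto

lemma fps_vanishing_order:
  assumes "\<forall>i<n. fps_nth F i = (0::real)"
  shows "\<exists>G. F = fps_X ^ n * G \<and> fps_nth G 0 = fps_nth F n"
proof (intro exI conjI)
  show "F = fps_X ^ n * fps_shift n F"
    by (rule fps_ext) (use assms in \<open>auto simp: fps_X_power_mult_nth\<close>)
qed simp

text \<open>
  The \<open>k\<close>-th power of the ambient Laplacian, restricted to the cone \<open>\<rho> = 0\<close>, depends only on the restriction
  of its argument to that cone when the argument is homogeneous of degree \<open>k - N/2\<close>.  It is evaluated on the
  harmonic extension \<open>F\<close> and on the extension \<open>t\<^sup>w (1 - \<rho>/2)\<^sup>w\<close>, a power of the radial variable of the cone over \<open>X\<close>.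
\<close>

lemma obstruction_eq:
  assumes k: "k \<ge> 1" and F0: "fps_nth F 0 = 1"
    and harm: "\<forall>i<k - 1. fps_nth (amb_op d l \<mu> (real k - (d + l) / 2) F) i = 0"
  shows "fps_nth (amb_op d l \<mu> (real k - (d + l) / 2) F) (k - 1) * ((- 2) ^ (k - 1) * (fact (k - 1))\<^sup>2) =
    (\<Prod>i<k. \<mu> - (real k - (d + l) / 2 - 2 * real i) * (real k - (d + l) / 2 - 2 * real i + d - 1))"
proof -
  define w where "w = real k - (d + l) / 2"
  obtain k' where k': "k = Suc k'" using k by (cases k) auto
  define c where "c = fps_nth (amb_op d l \<mu> w F) (k - 1)"
  obtain G where G: "amb_op d l \<mu> w F = fps_X ^ k' * G" "fps_nth G 0 = c"
    using fps_vanishing_order[of "k - 1" "amb_op d l \<mu> w F"] harm by (auto simp: w_def c_def k')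
  have "\<forall>i<1. fps_nth (F - cone_power w) i = 0" using F0 by (simp add: cone_power_0)
  from fps_vanishing_order[OF this] obtain H where "F - cone_power w = fps_X ^ 1 * H" by blast
  then have H: "F = fps_X * H + cone_power w" by (simp add: algebra_simps)
  \<comment> \<open>The degree k - N/2 is the one in which the commutator number for k Laplacians is
    zero, so the part \<open>fps_X * H\<close> leaves no trace at \<rho> = 0.\<close>
  have z: "(real k' + 1) * (2 * w + d + l - 2 * real k' - 2) = 0" by (simp add: w_def k')
  have "fps_nth (amb_iter d l \<mu> k w F) 0 = (\<Prod>i<k. \<mu> - (w - 2 * real i) * (w - 2 * real i + d - 1))"
    unfolding H k' amb_iter_add amb_iter_X_mult z amb_iter_cone_power
    by (simp add: cone_power_0 del: amb_iter.simps prod.lessThan_Suc)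
  moreover have "amb_iter d l \<mu> k w F = amb_iter d l \<mu> k' (w - 2) (fps_X ^ k' * G)"
    by (simp add: k' G)
  moreover have "fps_nth (amb_iter d l \<mu> k' (w - 2) (fps_X ^ k' * G)) 0 = (- 2) ^ k' * fact k' * fact k' * c"
    using amb_iter_X_power[of k' k d l \<mu> G] by (simp add: k' G w_def)
  ultimately show ?thesis unfolding w_def[symmetric] c_def[symmetric] by (simp add: k' power2_eq_square mult.commute mult.left_commute)
qed

section \<open>The recursion for the harmonic extension\<close>

text \<open>Allows the iterated derivatives in \<open>ambient_laplacian_coeff\<close> to be read off
  a power series.\<close>

lemma has_fps_expansion_higher_deriv:
  fixes f :: "real \<Rightarrow> real"
  assumes "f has_fps_expansion F"
  shows "(deriv ^^ n) f 0 / fact n = fps_nth F n"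
  using assms
proof (induction n arbitrary: f F)
  case 0
  then have "\<forall>\<^sub>F z in nhds 0. eval_fps F z = f z" by (simp add: has_fps_expansion_def)
  from eventually_nhds_x_imp_x[OF this] show ?case by (simp add: eval_fps_at_0)
next
  case (Suc n)
  have "(deriv ^^ n) (deriv f) 0 / fact n / real (Suc n) = fps_nth F (Suc n)"
    using Suc.IH[OF has_fps_expansion_deriv[OF Suc.prems]] by (simp del: of_nat_Suc)
  moreover have "(deriv ^^ Suc n) f 0 = (deriv ^^ n) (deriv f) 0" by (simp add: funpow_swap1)
  ultimately show ?case by (simp only: fact_Suc divide_divide_eq_left mult.commute)
qed

lemma has_fps_expansion_polynomial:
  "(\<lambda>x::real. \<Sum>m\<le>k. c m * x ^ m) has_fps_expansion Abs_fps (\<lambda>m. if m \<le> k then c m else 0)"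
proof (rule has_fps_expansion_schematicI)
  show "(\<lambda>x::real. \<Sum>m\<le>k. c m * x ^ m) has_fps_expansion (\<Sum>m\<le>k. fps_const (c m) * fps_X ^ m)"
    by (intro has_fps_expansion_sum has_fps_expansion_cmult_left has_fps_expansion_fps_X_power)
  show "(\<Sum>m\<le>k. fps_const (c m) * fps_X ^ m) = Abs_fps (\<lambda>m. if m \<le> k then c m else 0)"
    by (rule fps_ext) (simp add: fps_sum_nth fps_X_power_nth if_distrib cong: if_cong)
qed

lemma has_fps_expansion_inverse_ab:
  "(\<lambda>\<rho>. inverse (1 - \<rho> / 2)) has_fps_expansion inverse fps_a"
  "(\<lambda>\<rho>. inverse (1 + \<rho> / 2)) has_fps_expansion inverse fps_b"
proof -
  have X: "(\<lambda>\<rho>::real. 1 / 2 * \<rho>) has_fps_expansion fps_const (1 / 2) * fps_X"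
    by (intro has_fps_expansion_cmult_left has_fps_expansion_fps_X)
  have "(\<lambda>\<rho>. inverse (1 - 1 / 2 * \<rho>)) has_fps_expansion inverse fps_a"
    unfolding fps_a_def by (intro has_fps_expansion_inverse has_fps_expansion_diff has_fps_expansion_1 X) simp
  then show "(\<lambda>\<rho>. inverse (1 - \<rho> / 2)) has_fps_expansion inverse fps_a" by simp
  have "(\<lambda>\<rho>. inverse (1 + 1 / 2 * \<rho>)) has_fps_expansion inverse fps_b"
    unfolding fps_b_def by (intro has_fps_expansion_inverse has_fps_expansion_add has_fps_expansion_1 X) simp
  then show "(\<lambda>\<rho>. inverse (1 + \<rho> / 2)) has_fps_expansion inverse fps_b" by simp
qed

lemma ambient_expansion:
  fixes c A B :: "nat \<Rightarrow> real" and k :: nat and d l w \<kappa> :: real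
  defines "T \<equiv> \<lambda>c. Abs_fps (\<lambda>m. if m \<le> k then c m else 0)"
  shows "(\<lambda>\<rho>. (\<kappa> - \<rho> * (l * inverse (1 + \<rho> / 2) - d * inverse (1 - \<rho> / 2))) * (\<Sum>m\<le>k. c m * (real m * \<rho> ^ (m - 1)))
     - 2 * \<rho> * (\<Sum>m\<le>k. c m * (real m * (real (m - 1) * \<rho> ^ (m - 1 - 1))))
     + w / 2 * (l * inverse (1 + \<rho> / 2) - d * inverse (1 - \<rho> / 2)) * (\<Sum>m\<le>k. c m * \<rho> ^ m)
     + (inverse (1 - \<rho> / 2))\<^sup>2 * (\<Sum>m\<le>k. A m * \<rho> ^ m)
     + (inverse (1 + \<rho> / 2))\<^sup>2 * (\<Sum>m\<le>k. B m * \<rho> ^ m)) has_fps_expansion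
    (fps_const \<kappa> - fps_X * fps_tau d l) * fps_deriv (T c) - 2 * fps_X * fps_deriv (fps_deriv (T c))
     + fps_const (w / 2) * fps_tau d l * T c + (inverse fps_a)\<^sup>2 * T A + (inverse fps_b)\<^sup>2 * T B"
proof -
  have p: "(\<lambda>x::real. \<Sum>m\<le>k. c m * x ^ m) has_fps_expansion T c" for c
    unfolding T_def by (rule has_fps_expansion_polynomial)
  have "deriv (\<lambda>x::real. \<Sum>m\<le>k. c m * x ^ m) = (\<lambda>x. \<Sum>m\<le>k. c m * (real m * x ^ (m - Suc 0)))"
    by (intro ext DERIV_imp_deriv DERIV_sum DERIV_cmult DERIV_pow)
  with has_fps_expansion_deriv[OF p, of c]
  have d1: "(\<lambda>x. \<Sum>m\<le>k. c m * (real m * x ^ (m - 1))) has_fps_expansion fps_deriv (T c)" by simp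
  have "deriv (\<lambda>x::real. \<Sum>m\<le>k. c m * (real m * x ^ (m - 1))) =
      (\<lambda>x. \<Sum>m\<le>k. c m * (real m * (real (m - 1) * x ^ (m - 1 - Suc 0))))"
    by (intro ext DERIV_imp_deriv DERIV_sum DERIV_cmult DERIV_pow)
  with has_fps_expansion_deriv[OF d1]
  have d2: "(\<lambda>x. \<Sum>m\<le>k. c m * (real m * (real (m - 1) * x ^ (m - 1 - 1)))) has_fps_expansion
     fps_deriv (fps_deriv (T c))" by simp
  show ?thesis
    unfolding fps_tau_def power2_eq_square
    by (intro has_fps_expansion_add has_fps_expansion_diff has_fps_expansion_mult has_fps_expansion_const
      has_fps_expansion_numeral has_fps_expansion_fps_X has_fps_expansion_inverse_ab p d1 d2)
qed

text \<open>
  The coefficient of \<open>\<rho>\<^sup>m\<close> in the ambient Laplacian, without the term in \<open>c (Suc m)\<close>; \<open>A\<close> and \<open>B\<close> are the Laplacians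
  along \<open>X\<close> and along the sphere of the coefficients \<open>c\<close>.
\<close>

definition amb_tail :: "real \<Rightarrow> real \<Rightarrow> real \<Rightarrow> nat \<Rightarrow> (nat \<Rightarrow> real) \<Rightarrow> (nat \<Rightarrow> real) \<Rightarrow> (nat \<Rightarrow> real) \<Rightarrow> real" where
  "amb_tail d l w m c A B = (\<Sum>j\<le>m. fps_nth (fps_tau d l) (m - j) * (w / 2 - real j) * c j +
     fps_nth ((inverse fps_a)\<^sup>2) (m - j) * A j + fps_nth ((inverse fps_b)\<^sup>2) (m - j) * B j)"

text \<open>Only the two leading derivative terms reach the coefficient of index m + 1, with (2
  \<kappa> - 2)(m + 1) - 2 m (m + 1). The operator \<rho> d/d\<rho> is diagonal on powers, so the
  remaining first order term merely shifts w/2 to w/2 - j.\<close>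

lemma ambient_series_nth:
  "fps_nth ((fps_const (2 * \<kappa> - 2) - fps_X * fps_tau d l) * fps_deriv F - 2 * fps_X * fps_deriv (fps_deriv F)
     + fps_const (w / 2) * fps_tau d l * F + (inverse fps_a)\<^sup>2 * A + (inverse fps_b)\<^sup>2 * B) m =
   2 * (real m + 1) * (\<kappa> - 1 - real m) * fps_nth F (Suc m) +
   amb_tail d l w m (fps_nth F) (fps_nth A) (fps_nth B)"
proof -
  have XF: "fps_nth (fps_X * fps_deriv F) j = real j * fps_nth F j" for j
    by (cases j) (simp_all add: fps_X_mult_nth)
  have conv: "fps_nth (G * H) m = (\<Sum>j\<le>m. fps_nth G (m - j) * fps_nth H j)" for G H :: "real fps"
    unfolding mult.commute[of G H] fps_mult_nth atMost_atLeast0 by (simp only: mult.commute)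
  have 1: "fps_nth (fps_X * fps_tau d l * fps_deriv F) m = (\<Sum>j\<le>m. fps_nth (fps_tau d l) (m - j) * (real j * fps_nth F j))"
  proof -
    have "fps_X * fps_tau d l * fps_deriv F = fps_tau d l * (fps_X * fps_deriv F)" by (simp add: mult_ac)
    then show ?thesis by (simp only: conv XF)
  qed
  have 2: "fps_nth (fps_const (w / 2) * fps_tau d l * F) m = (\<Sum>j\<le>m. fps_nth (fps_tau d l) (m - j) * (w / 2 * fps_nth F j))"
  proof -
    have "fps_nth (fps_const (w / 2) * fps_tau d l * F) m = w / 2 * fps_nth (fps_tau d l * F) m"
      by (simp only: mult.assoc fps_mult_left_const_nth)
    then show ?thesis by (simp only: conv sum_distrib_left mult.left_commute)
  qed
  have 3: "fps_nth (2 * fps_X * fps_deriv (fps_deriv F)) m = 2 * real m * (real m + 1) * fps_nth F (Suc m)"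
  proof -
    have "fps_nth (2 * (fps_X * fps_deriv (fps_deriv F))) m = 2 * fps_nth (fps_X * fps_deriv (fps_deriv F)) m"
      by (simp add: numeral_fps_const)
    then show ?thesis by (cases m) (simp_all add: fps_X_mult_nth mult.assoc algebra_simps)
  qed
  have 4: "fps_nth ((fps_const (2 * \<kappa> - 2) - fps_X * fps_tau d l) * fps_deriv F) m =
     (2 * \<kappa> - 2) * ((real m + 1) * fps_nth F (Suc m)) - fps_nth (fps_X * fps_tau d l * fps_deriv F) m"
    by (simp add: left_diff_distrib add.commute)
  show ?thesis
    unfolding fps_add_nth fps_sub_nth 4 1 2 3 conv[of "(inverse fps_a)\<^sup>2"] conv[of "(inverse fps_b)\<^sup>2"] amb_tail_def
    by (simp add: sum.distrib sum_subtractf algebra_simps)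
qed

lemma mult_uminus_inverse: "a \<noteq> 0 \<Longrightarrow> a * (- inverse a * t) + t = (0 :: real)"
  by simp

text \<open>The coefficients of the harmonic extension of \<open>u\<close> are \<open>amb_poly d l k m\<close>, evaluated at the Laplacian of \<open>X\<close>,
  applied to \<open>u\<close>.  For \<open>m \<ge> k\<close> they are junk: the factor \<open>k - 1 - m\<close> in the recursion vanishes at \<open>m = k - 1\<close>.\<close>

fun amb_poly :: "real \<Rightarrow> real \<Rightarrow> nat \<Rightarrow> nat \<Rightarrow> real poly" where
  "amb_poly d l k 0 = 1"
| "amb_poly d l k (Suc m) = smult (- inverse (2 * (real m + 1) * (real k - 1 - real m)))
     (\<Sum>j\<le>m. smult (fps_nth (fps_tau d l) (m - j) * ((real k - (d + l) / 2) / 2 - real j)) (amb_poly d l k j) +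
        smult (fps_nth ((inverse fps_a)\<^sup>2) (m - j)) (pCons 0 (amb_poly d l k j)))"

text \<open>\<open>amb_tail\<close> for functions constant along the sphere, as a polynomial in the
  Laplacian of X: \<open>pCons 0\<close> multiplies by the variable. At m = k - 1 this is the
  obstruction before normalisation.\<close>

definition amb_tail_poly :: "real \<Rightarrow> real \<Rightarrow> nat \<Rightarrow> nat \<Rightarrow> real poly" where
  "amb_tail_poly d l k m = (\<Sum>j\<le>m. smult (fps_nth (fps_tau d l) (m - j) * ((real k - (d + l) / 2) / 2 - real j)) (amb_poly d l k j) +
        smult (fps_nth ((inverse fps_a)\<^sup>2) (m - j)) (pCons 0 (amb_poly d l k j)))"

lemma amb_poly_Suc:
  "amb_poly d l k (Suc m) = smult (- inverse (2 * (real m + 1) * (real k - 1 - real m))) (amb_tail_poly d l k m)"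
  by (simp add: amb_tail_poly_def)

lemma poly_amb_tail_poly:
  "poly (amb_tail_poly d l k m) x = amb_tail d l (real k - (d + l) / 2) m
     (\<lambda>j. poly (amb_poly d l k j) x) (\<lambda>j. x * poly (amb_poly d l k j) x) (\<lambda>j. 0)"
  by (simp add: amb_tail_poly_def amb_tail_def poly_sum mult.left_commute)

text \<open>At every real x the values of \<open>amb_poly\<close> are the coefficients of a harmonic
  series, so \<open>obstruction_eq\<close> gives the equality at x. Agreement at all reals makes the
  polynomials equal, which is what can be applied to the operator.\<close>

lemma obstruction_poly:
  assumes k: "k \<ge> 1"
  shows "smult ((- 2) ^ (k - 1) * (fact (k - 1))\<^sup>2) (amb_tail_poly d l k (k - 1)) =
    (\<Prod>i<k. [:- (real k - (d + l) / 2 - 2 * real i) * (real k - (d + l) / 2 - 2 * real i + d - 1), 1:])"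
proof -
  define w where "w = real k - (d + l) / 2"
  have "poly (smult ((- 2) ^ (k - 1) * (fact (k - 1))\<^sup>2) (amb_tail_poly d l k (k - 1))) x =
    poly (\<Prod>i<k. [:- (w - 2 * real i) * (w - 2 * real i + d - 1), 1:]) x" for x
  proof -
    define F where "F = Abs_fps (\<lambda>j. poly (amb_poly d l k j) x)"
    have nth: "fps_nth (amb_op d l x w F) m = 2 * (real m + 1) * (real k - 1 - real m) * poly (amb_poly d l k (Suc m)) x
       + poly (amb_tail_poly d l k m) x" for m
    proof -
      have "2 * w - 2 + d + l = 2 * real k - 2" by (simp add: w_def field_simps)
      then have "amb_op d l x w F = (fps_const (2 * real k - 2) - fps_X * fps_tau d l) * fps_deriv F
         - 2 * fps_X * fps_deriv (fps_deriv F)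
         + fps_const (w / 2) * fps_tau d l * F + (inverse fps_a)\<^sup>2 * (fps_const x * F) + (inverse fps_b)\<^sup>2 * 0"
        by (simp add: amb_op_def algebra_simps)
      then show ?thesis
        by (simp only: ambient_series_nth poly_amb_tail_poly) (simp add: F_def w_def amb_tail_def)
    qed
    have F0: "fps_nth F 0 = 1" by (simp add: F_def)
    have "fps_nth (amb_op d l x w F) m = 0" if "m < k - 1" for m
    proof -
      have "2 * (real m + 1) * (real k - 1 - real m) \<noteq> 0" using that by auto
      then show ?thesis unfolding nth amb_poly_Suc poly_smult by (rule mult_uminus_inverse)
    qed
    then have "fps_nth (amb_op d l x w F) (k - 1) * ((- 2) ^ (k - 1) * (fact (k - 1))\<^sup>2) =
      (\<Prod>i<k. x - (w - 2 * real i) * (w - 2 * real i + d - 1))"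
      using obstruction_eq[OF k F0, of d l x] by (auto simp: w_def)
    \<comment> \<open>At order k - 1 the factor k - 1 - m is zero, so the junk coefficient of index
      k does not enter.\<close>
    moreover have "fps_nth (amb_op d l x w F) (k - 1) = poly (amb_tail_poly d l k (k - 1)) x"
      using k by (simp add: nth of_nat_diff)
    moreover have "poly (\<Prod>i<k. [:- (w - 2 * real i) * (w - 2 * real i + d - 1), 1:]) x =
      (\<Prod>i<k. x - (w - 2 * real i) * (w - 2 * real i + d - 1))"
      unfolding poly_prod by (intro prod.cong refl) (simp add: algebra_simps)
    ultimately show ?thesis by (simp only: poly_smult mult.commute)
  qed
  then show ?thesis unfolding w_def by (intro poly_eq_poly_eq_iff[THEN iffD1] ext)
qed

section \<open>Polynomials in the Laplacian\<close>

text \<open>The polynomial functional calculus: p(\<Delta>) u at y.\<close>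

definition lap_poly :: "('a, 'i) mfd \<Rightarrow> ('a \<Rightarrow> real) \<Rightarrow> real poly \<Rightarrow> 'a \<Rightarrow> real" where
  "lap_poly X u p y = (\<Sum>i\<le>degree p. coeff p i * (laplacian X ^^ i) u y)"

lemma lap_poly_eq: "degree p \<le> m \<Longrightarrow> lap_poly X u p y = (\<Sum>i\<le>m. coeff p i * (laplacian X ^^ i) u y)"
  unfolding lap_poly_def by (intro sum.mono_neutral_left) (auto simp: coeff_eq_0)

lemma lap_poly_add: "lap_poly X u (p + q) y = lap_poly X u p y + lap_poly X u q y"
proof -
  define m where "m = max (degree p) (degree q)"
  have "degree (p + q) \<le> m" "degree p \<le> m" "degree q \<le> m" by (auto simp: m_def degree_add_le)
  then show ?thesis by (simp add: lap_poly_eq[of _ m] sum.distrib distrib_right)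
qed

lemma lap_poly_smult: "lap_poly X u (smult c p) y = c * lap_poly X u p y"
proof -
  have "degree (smult c p) \<le> degree p" by simp
  then show ?thesis by (simp only: lap_poly_eq[of _ "degree p"] order_refl)
      (simp add: sum_distrib_left mult.assoc)
qed

lemma lap_poly_0: "lap_poly X u 0 y = 0"
  by (simp add: lap_poly_def)

lemma lap_poly_1: "lap_poly X u 1 y = u y"
  by (simp add: lap_poly_def)

lemma lap_poly_sum: "lap_poly X u (\<Sum>j\<in>S. p j) y = (\<Sum>j\<in>S. lap_poly X u (p j) y)"
  by (induction S rule: infinite_finite_induct) (simp_all add: lap_poly_0 lap_poly_add)

lemma laplacian_in_cong:
  assumes "line_open M i (chart_dom M i)" "p \<in> chart_dom M i" "\<And>q. q \<in> chart_dom M i \<Longrightarrow> f q = g q"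
  shows "laplacian_in M i f p = laplacian_in M i g p"
proof -
  have 1: "pd M i b f q = pd M i b g q" if "q \<in> chart_dom M i" "b < mdim M" for q b
    by (rule pd_cong[OF assms(1) that assms(3)])
  show ?thesis
    unfolding laplacian_in_eq_lap_data
  proof (rule lap_data_cong)
    show "pd M i a (pd M i b f) p = pd M i a (pd M i b g) p" if "a < mdim M" "b < mdim M" for a b
      by (rule pd_cong[OF assms(1,2) that(1)]) (rule 1[OF _ that(2)])
    show "pd M i a f p = pd M i a g p" if "a < mdim M" for a
      by (rule 1[OF assms(2) that])
  qed
qed

lemma laplacian_in_const: "laplacian_in M i (\<lambda>_. c) p = 0"
  by (simp add: laplacian_in_def pd_const)

lemma laplacian_in_sum:
  assumes lo: "line_open M i (chart_dom M i)" and p: "p \<in> chart_dom M i"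
    and f: "\<And>j. j \<in> S \<Longrightarrow> smooth_in M i (chart_dom M i) (f j)"
  shows "laplacian_in M i (\<lambda>q. \<Sum>j\<in>S. c j * f j q) p = (\<Sum>j\<in>S. c j * laplacian_in M i (f j) p)"
proof -
  have 1: "pd M i b (\<lambda>q. \<Sum>j\<in>S. c j * f j q) q = (\<Sum>j\<in>S. c j * pd M i b (f j) q)"
    if "q \<in> chart_dom M i" "b < mdim M" for q b
    by (intro has_pd_imp_pd has_pd_sum has_pd_cmult smooth_in_has_pd[OF f that])
  have 2: "pd M i a (pd M i b (\<lambda>q. \<Sum>j\<in>S. c j * f j q)) p = (\<Sum>j\<in>S. c j * pd M i a (pd M i b (f j)) p)"
    if ab: "a < mdim M" "b < mdim M" for a b
  proof -
    have "pd M i a (pd M i b (\<lambda>q. \<Sum>j\<in>S. c j * f j q)) p = pd M i a (\<lambda>q. \<Sum>j\<in>S. c j * pd M i b (f j) q) p"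
      by (rule pd_cong[OF lo p ab(1)]) (rule 1[OF _ ab(2)])
    also have "\<dots> = (\<Sum>j\<in>S. c j * pd M i a (pd M i b (f j)) p)"
      by (intro has_pd_imp_pd has_pd_sum has_pd_cmult smooth_in_has_pd[OF smooth_in_pd[OF ab(2) f] p ab(1)])
    finally show ?thesis .
  qed
  have "laplacian_in M i (\<lambda>q. \<Sum>j\<in>S. c j * f j q) p =
     lap_data (mdim M) (\<lambda>a b. ginv M i a b p) (\<lambda>a b c. pd M i a (gcomp M i b c) p)
       (\<lambda>a b. \<Sum>j\<in>S. c j * pd M i a (pd M i b (f j)) p) (\<lambda>b. \<Sum>j\<in>S. c j * pd M i b (f j) p)"
    unfolding laplacian_in_eq_lap_data by (rule lap_data_cong) (simp_all add: 1 2 p)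
  then show ?thesis unfolding lap_data_linear by (simp add: laplacian_in_eq_lap_data)
qed

lemma riemannian_chart_exists:
  assumes "riemannian_manifold X" "x \<in> topspace (mtop X)"
  shows "\<exists>i. i \<in> chart_index X \<and> x \<in> chart_dom X i"
proof -
  have "(\<Union>i\<in>chart_index X. chart_dom X i) = topspace (mtop X)"
    using assms(1) unfolding riemannian_manifold_def by (elim conjE) assumption
  then show ?thesis using assms(2) by blast
qed

lemma chart_dom_subset:
  assumes "riemannian_manifold X" "i \<in> chart_index X"
  shows "chart_dom X i \<subseteq> topspace (mtop X)"
  using openin_subset[OF riemannian_chart(1)[OF assms]] .

lemma chart_dom_line_open:
  "riemannian_manifold X \<Longrightarrow> i \<in> chart_index X \<Longrightarrow> line_open X i (chart_dom X i)"
  by (rule chart_line_open[OF _ _ riemannian_chart(1)]) auto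

text \<open>Both sides use the same chosen chart at y, so equality of the functions on the manifold
  suffices without any smoothness.\<close>

lemma laplacian_cong:
  assumes X: "riemannian_manifold X" and y: "y \<in> topspace (mtop X)"
    and eq: "\<And>q. q \<in> topspace (mtop X) \<Longrightarrow> f q = g q"
  shows "laplacian X f y = laplacian X g y"
proof -
  define i where "i = (SOME i. i \<in> chart_index X \<and> y \<in> chart_dom X i)"
  have i: "i \<in> chart_index X \<and> y \<in> chart_dom X i"
    unfolding i_def by (rule someI_ex[OF riemannian_chart_exists[OF X y]])
  have "laplacian_in X i f y = laplacian_in X i g y"
    by (rule laplacian_in_cong) (use i chart_dom_line_open[OF X] chart_dom_subset[OF X] eq in blast)+
  then show ?thesis by (simp add: laplacian_def i_def)
qed

context
  fixes X :: "('a, 'i) mfd" and u :: "'a \<Rightarrow> real"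
  assumes X: "riemannian_manifold X" and u: "smooth_fun X u"
begin

lemma smooth_laplacian_power: "smooth_fun X ((laplacian X ^^ i) u)"
  by (induction i) (simp_all add: u smooth_fun_laplacian[OF X])

lemma smooth_lap_poly: "smooth_fun X (lap_poly X u p)"
  unfolding smooth_fun_def
proof
  fix i assume i: "i \<in> chart_index X"
  show "smooth_in X i (chart_dom X i) (lap_poly X u p)"
    unfolding lap_poly_def[abs_def]
    by (intro smooth_in_sum smooth_in_mult smooth_in_const chart_dom_line_open[OF X i])
      (use smooth_laplacian_power i in \<open>auto simp: smooth_fun_def\<close>)
qed

lemma laplacian_lap_poly:
  assumes y: "y \<in> topspace (mtop X)"
  shows "laplacian X (lap_poly X u p) y = lap_poly X u (pCons 0 p) y"
proof -
  define i where "i = (SOME i. i \<in> chart_index X \<and> y \<in> chart_dom X i)"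
  have i: "i \<in> chart_index X" "y \<in> chart_dom X i"
    using someI_ex[OF riemannian_chart_exists[OF X y]] unfolding i_def by auto
  have "laplacian X (lap_poly X u p) y = laplacian_in X i (lap_poly X u p) y"
    by (rule laplacian_eq_in[OF X i(1) smooth_lap_poly i(2)])
  also have "\<dots> = (\<Sum>m\<le>degree p. coeff p m * laplacian_in X i ((laplacian X ^^ m) u) y)"
    unfolding lap_poly_def[abs_def]
    by (rule laplacian_in_sum[OF chart_dom_line_open[OF X i(1)] i(2)])
      (use smooth_laplacian_power i in \<open>auto simp: smooth_fun_def\<close>)
  also have "\<dots> = (\<Sum>m\<le>degree p. coeff p m * (laplacian X ^^ Suc m) u y)"
    by (intro sum.cong refl) (simp add: laplacian_eq_in[OF X i(1) smooth_laplacian_power i(2)])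
  also have "\<dots> = (\<Sum>m\<le>Suc (degree p). coeff (pCons 0 p) m * (laplacian X ^^ m) u y)"
    by (simp add: sum.atMost_Suc_shift del: sum.atMost_Suc)
  also have "\<dots> = lap_poly X u (pCons 0 p) y"
    by (rule lap_poly_eq[symmetric]) (rule degree_pCons_le)
  finally show ?thesis .
qed

lemma lap_poly_linear_mult:
  assumes y: "y \<in> topspace (mtop X)"
  shows "lap_poly X u ([:- c, - 1:] * p) y = - laplacian X (lap_poly X u p) y - c * lap_poly X u p y"
proof -
  have "[:- c, - 1:] * p = smult (- c) p + smult (- 1) (pCons 0 p)" by simp
  then show ?thesis by (simp only: lap_poly_add lap_poly_smult laplacian_lap_poly[OF y])
qed

text \<open>The factor - \<Delta> - c is the linear polynomial \<open>[:- c, - 1:]\<close> at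
  \<Delta>; composing such operators becomes multiplying polynomials, so the order of the factors is
  immaterial.\<close>

lemma foldr_lap_poly:
  assumes y: "y \<in> topspace (mtop X)"
  shows "foldr (\<lambda>j w y. - laplacian X w y - c j * w y) js u y =
     lap_poly X u (\<Prod>j\<leftarrow>js. [:- c j, - 1:]) y"
  using y
proof (induction js arbitrary: y)
  case Nil
  then show ?case by (simp add: lap_poly_1)
next
  case (Cons j js)
  then show ?case
    by (simp add: lap_poly_linear_mult laplacian_cong[OF X Cons.prems Cons.IH] del: mult_pCons_left)
qed

end

text \<open>Expanding the product shows that every coefficient depends polynomially on the weight
  parameter, as the continuation to real m requires.\<close>

lemma coeff_prod_list_poly:
  "\<exists>P :: nat \<Rightarrow> real poly. \<forall>i m. coeff (\<Prod>j\<leftarrow>js. [:- poly (C j) m, - 1:]) i = poly (P i) m"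
proof (induction js)
  case Nil
  show ?case by (rule exI[of _ "\<lambda>i. if i = 0 then 1 else 0"]) (simp add: coeff_1)
next
  case (Cons j js)
  then obtain P where P: "\<And>i m. coeff (\<Prod>j\<leftarrow>js. [:- poly (C j) m, - 1:]) i = poly (P i) m" by blast
  show ?case
    by (rule exI[of _ "\<lambda>i. - C j * P i - (case i of 0 \<Rightarrow> 0 | Suc i' \<Rightarrow> P i')"])
      (auto simp: P coeff_pCons split: nat.split)
qed

lemma degree_prod_list_linear: "degree (\<Prod>j\<leftarrow>js. [:a j, b j :: real:]) \<le> length js"
proof (induction js)
  case (Cons j js)
  have "degree ([:a j, b j:] * (\<Prod>j\<leftarrow>js. [:a j, b j:])) \<le> degree [:a j, b j:] + degree (\<Prod>j\<leftarrow>js. [:a j, b j:])"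
    by (rule degree_mult_le)
  also have "\<dots> \<le> 1 + length js" using Cons by (intro add_mono) auto
  finally show ?case by (simp del: mult_pCons_left)
qed simp

section \<open>The GJMS operators of \<open>X \<times> S\<^sup>l\<close>\<close>

lemma amb_tail_cong:
  assumes "\<And>j. j \<le> m \<Longrightarrow> c j = c' j" "\<And>j. j \<le> m \<Longrightarrow> A j = A' j" "\<And>j. j \<le> m \<Longrightarrow> B j = B' j"
  shows "amb_tail d l w m c A B = amb_tail d l w m c' A' B'"
  unfolding amb_tail_def using assms by (intro sum.cong refl) simp

lemma eq_uminus_inverse_mult: "a * f = - t \<Longrightarrow> a \<noteq> 0 \<Longrightarrow> f = - inverse a * (t :: real)"
  by (simp add: field_simps)

lemma sphere_chart_exists: "z \<in> topspace (nsphere l) \<Longrightarrow> \<exists>N. z \<in> chart_dom (round_sphere l) N"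
  by (cases "z l = 1") (auto simp: pole_sign_def intro: exI[of _ False] exI[of _ True])

context
  fixes X :: "('a, 'i) mfd" and k l :: nat
  assumes X: "riemannian_manifold X"
begin

lemma ambient_laplacian_coeff_product:
  fixes f :: "nat \<Rightarrow> 'a \<times> (nat \<Rightarrow> real) \<Rightarrow> real"
  defines "W \<equiv> warped_product X (\<lambda>_. 1) (round_sphere l)"
  assumes f: "\<And>j. j \<le> k \<Longrightarrow> smooth_fun W (f j)"
    and x: "x \<in> topspace (mtop X)" and z: "z \<in> topspace (nsphere l)"
  shows "\<exists>i N. i \<in> chart_index X \<and> x \<in> chart_dom X i \<and> z \<in> chart_dom (round_sphere l) N \<and>
    (\<forall>m<k. ambient_laplacian_coeff W (product_ambient X l) k f m (x, z) =
       2 * (real m + 1) * (real k - 1 - real m) * f (Suc m) (x, z) +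
       amb_tail (mdim X) l (real k - (real (mdim X) + real l) / 2) m (\<lambda>j. f j (x, z))
         (\<lambda>j. laplacian_in X i (\<lambda>x'. f j (x', z)) x)
         (\<lambda>j. laplacian_in (round_sphere l) N (\<lambda>z'. f j (x, z')) z))"
proof -
  \<comment> \<open>This is the chart that \<open>laplacian\<close> chooses on the ambient space:
    for |\<rho>| < 2 its description does not depend on \<rho>, so a single chart serves the whole
    germ.\<close>
  define ij where "ij = (SOME ij. ij \<in> chart_index W \<and> (x, z) \<in> chart_dom W ij)"
  have "\<exists>ij. ij \<in> chart_index W \<and> (x, z) \<in> chart_dom W ij"
  proof -
    obtain i N where "i \<in> chart_index X" "x \<in> chart_dom X i" "z \<in> chart_dom (round_sphere l) N"
      using riemannian_chart_exists[OF X x] sphere_chart_exists[OF z] by blast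
    then show ?thesis unfolding W_def by (intro exI[of _ "(i, N)"]) (simp del: round_sphere_simps(4))
  qed
  then have ij: "ij \<in> chart_index W" "(x, z) \<in> chart_dom W ij"
    using someI_ex[of "\<lambda>ij. ij \<in> chart_index W \<and> (x, z) \<in> chart_dom W ij"] by (auto simp: ij_def)
  obtain i N where iN: "ij = (i, N)" by (cases ij)
  have i: "i \<in> chart_index X" "x \<in> chart_dom X i" "z \<in> chart_dom (round_sphere l) N"
    using ij by (auto simp: iN W_def simp del: round_sphere_simps(4))
  define A where "A = (\<lambda>j. laplacian_in X i (\<lambda>x'. f j (x', z)) x)"
  define B where "B = (\<lambda>j. laplacian_in (round_sphere l) N (\<lambda>z'. f j (x, z')) z)"
  define c where "c = (\<lambda>j. f j (x, z))"
  define w where "w = real k - (real (mdim X) + real l) / 2"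
  define h where "h = (\<lambda>\<rho>. laplacian (ambient_space W (product_ambient X l)) (homogeneous_ext W k f) (1, \<rho>, x, z))"
  define F where "F = (\<lambda>\<rho>. (2 * real k - 2 - \<rho> * (real l * inverse (1 + \<rho> / 2) - real (mdim X) * inverse (1 - \<rho> / 2)))
        * (\<Sum>m\<le>k. c m * (real m * \<rho> ^ (m - 1)))
     - 2 * \<rho> * (\<Sum>m\<le>k. c m * (real m * (real (m - 1) * \<rho> ^ (m - 1 - 1))))
     + w / 2 * (real l * inverse (1 + \<rho> / 2) - real (mdim X) * inverse (1 - \<rho> / 2)) * (\<Sum>m\<le>k. c m * \<rho> ^ m)
     + (inverse (1 - \<rho> / 2))\<^sup>2 * (\<Sum>m\<le>k. A m * \<rho> ^ m)
     + (inverse (1 + \<rho> / 2))\<^sup>2 * (\<Sum>m\<le>k. B m * \<rho> ^ m))"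
  have hF: "h \<rho> = F \<rho>" if \<rho>: "\<bar>\<rho>\<bar> < 2" for \<rho>
  proof -
    have "h \<rho> = laplacian_in (ambient_space W (product_ambient X l)) ij (homogeneous_ext W k f) (1, \<rho>, x, z)"
      using \<rho> by (simp add: h_def laplacian_def ij_def abs_less_iff)
    also have "\<dots> = F \<rho>"
      unfolding iN F_def c_def A_def B_def w_def W_def
    proof (subst product_ambient_laplacian_in[OF riemannian_metric_ok[OF X i(1)] sphere_metric_ok i(2,3) \<rho>])
      show "smooth_in (warped_product X (\<lambda>_. 1) (round_sphere l)) (i, N)
          (chart_dom (warped_product X (\<lambda>_. 1) (round_sphere l)) (i, N)) (f m)" if "m \<le> k" for m
        using f[OF that] i(1) by (auto simp: smooth_fun_def W_def)
      show "product_ambient X l r = block_metric X (round_sphere l) (\<lambda>_. (1 - r / 2)\<^sup>2) (\<lambda>_. (1 + r / 2)\<^sup>2)" for r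
        by (simp add: product_ambient_def)
    qed simp
    finally show ?thesis .
  qed
  define T where "T = (\<lambda>c::nat \<Rightarrow> real. Abs_fps (\<lambda>m. if m \<le> k then c m else 0))"
  have "F has_fps_expansion (fps_const (2 * real k - 2) - fps_X * fps_tau (mdim X) l) * fps_deriv (T c)
     - 2 * fps_X * fps_deriv (fps_deriv (T c)) + fps_const (w / 2) * fps_tau (mdim X) l * T c
     + (inverse fps_a)\<^sup>2 * T A + (inverse fps_b)\<^sup>2 * T B" (is "_ has_fps_expansion ?F")
    unfolding F_def T_def by (rule ambient_expansion)
  moreover have "\<forall>\<^sub>F \<rho> in nhds 0. F \<rho> = h \<rho>"
    unfolding eventually_nhds_metric by (rule exI[of _ 2]) (simp add: hF)
  ultimately have h: "h has_fps_expansion ?F"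
    unfolding has_fps_expansion_def by (auto elim: eventually_elim2)
  \<comment> \<open>The truncation after index k is invisible for m < k, because only indices up to
    m + 1 occur.\<close>
  have "ambient_laplacian_coeff W (product_ambient X l) k f m (x, z) =
       2 * (real m + 1) * (real k - 1 - real m) * c (Suc m) + amb_tail (mdim X) l w m c A B" if "m < k" for m
  proof -
    have "ambient_laplacian_coeff W (product_ambient X l) k f m (x, z) = fps_nth ?F m"
      unfolding ambient_laplacian_coeff_def h_def[symmetric] by (rule has_fps_expansion_higher_deriv[OF h])
    also have "\<dots> = 2 * (real m + 1) * (real k - 1 - real m) * fps_nth (T c) (Suc m) +
        amb_tail (mdim X) l w m (fps_nth (T c)) (fps_nth (T A)) (fps_nth (T B))"
      by (rule ambient_series_nth)
    also have "amb_tail (mdim X) l w m (fps_nth (T c)) (fps_nth (T A)) (fps_nth (T B)) = amb_tail (mdim X) l w m c A B"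
      by (rule amb_tail_cong) (use that in \<open>auto simp: T_def\<close>)
    finally show ?thesis using that by (simp add: T_def)
  qed
  then show ?thesis using i unfolding A_def B_def c_def w_def by blast
qed

text \<open>The recursion forces the coefficients below index k to be polynomials in the Laplacian
  of u, pulled back from X. The coefficient of index k stays free, but it has factor zero in the
  obstruction, so the value is unique.\<close>

lemma gjms_product:
  assumes u: "smooth_fun X u" and k: "k \<ge> 1"
    and x: "x \<in> topspace (mtop X)" and z: "z \<in> topspace (nsphere l)"
  shows "gjms (warped_product X (\<lambda>_. 1) (round_sphere l)) (product_ambient X l) k (\<lambda>(x', _). u x') (x, z) =
    2 ^ k * (- ((fact (k - 1))\<^sup>2 / 2) * lap_poly X u (amb_tail_poly (mdim X) l k (k - 1)) x)"
proof -
  define W where "W = warped_product X (\<lambda>_. 1) (round_sphere l)"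
  define G where "G = product_ambient X l"
  define p where "p = amb_poly (mdim X) l k"
  have top: "topspace (mtop W) = topspace (mtop X) \<times> topspace (nsphere l)"
    by (simp add: W_def)
  \<comment> \<open>Stated for any extension with the expected coefficients up to m, so that it
    serves both the constructed extension and the uniqueness argument.\<close>
  have coeff: "ambient_laplacian_coeff W G k f m (x, z) =
      2 * (real m + 1) * (real k - 1 - real m) * f (Suc m) (x, z) + lap_poly X u (amb_tail_poly (mdim X) l k m) x"
    if f: "\<And>j. j \<le> k \<Longrightarrow> smooth_fun W (f j)" and m: "m < k"
      and eq: "\<And>j x z. j \<le> m \<Longrightarrow> x \<in> topspace (mtop X) \<Longrightarrow> z \<in> topspace (nsphere l) \<Longrightarrow> f j (x, z) = lap_poly X u (p j) x"
      and x: "x \<in> topspace (mtop X)" and z: "z \<in> topspace (nsphere l)"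
    for f m x z
  proof -
    define w where "w = real k - (real (mdim X) + real l) / 2"
    obtain i N where i: "i \<in> chart_index X" "x \<in> chart_dom X i" "z \<in> chart_dom (round_sphere l) N"
      and c: "ambient_laplacian_coeff W G k f m (x, z) =
       2 * (real m + 1) * (real k - 1 - real m) * f (Suc m) (x, z) +
       amb_tail (mdim X) l w m (\<lambda>j. f j (x, z)) (\<lambda>j. laplacian_in X i (\<lambda>x'. f j (x', z)) x)
         (\<lambda>j. laplacian_in (round_sphere l) N (\<lambda>z'. f j (x, z')) z)"
      using ambient_laplacian_coeff_product[of f x z] f x z m unfolding W_def G_def w_def by blast
    have "amb_tail (mdim X) l w m (\<lambda>j. f j (x, z)) (\<lambda>j. laplacian_in X i (\<lambda>x'. f j (x', z)) x)
         (\<lambda>j. laplacian_in (round_sphere l) N (\<lambda>z'. f j (x, z')) z) =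
       amb_tail (mdim X) l w m (\<lambda>j. lap_poly X u (p j) x) (\<lambda>j. lap_poly X u (pCons 0 (p j)) x) (\<lambda>j. 0)"
    proof (rule amb_tail_cong)
      fix j assume j: "j \<le> m"
      show "f j (x, z) = lap_poly X u (p j) x" by (rule eq[OF j x z])
      have "laplacian_in X i (\<lambda>x'. f j (x', z)) x = laplacian_in X i (lap_poly X u (p j)) x"
        by (rule laplacian_in_cong[OF chart_dom_line_open[OF X i(1)] i(2)])
          (use chart_dom_subset[OF X i(1)] eq[OF j _ z] in auto)
      also have "\<dots> = laplacian X (lap_poly X u (p j)) x"
        by (rule laplacian_eq_in[OF X i(1) smooth_lap_poly[OF X u] i(2), symmetric])
      also have "\<dots> = lap_poly X u (pCons 0 (p j)) x" by (rule laplacian_lap_poly[OF X u x])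
      finally show "laplacian_in X i (\<lambda>x'. f j (x', z)) x = \<dots>" .
      \<comment> \<open>A pulled back coefficient is constant along the sphere.\<close>
      have "laplacian_in (round_sphere l) N (\<lambda>z'. f j (x, z')) z =
          laplacian_in (round_sphere l) N (\<lambda>_. lap_poly X u (p j) x) z"
        by (rule laplacian_in_cong[OF sphere_line_open i(3)]) (use eq[OF j x] in auto)
      then show "laplacian_in (round_sphere l) N (\<lambda>z'. f j (x, z')) z = 0"
        by (simp add: laplacian_in_const)
    qed
    also have "\<dots> = lap_poly X u (amb_tail_poly (mdim X) l k m) x"
      by (simp only: amb_tail_def amb_tail_poly_def lap_poly_sum lap_poly_add lap_poly_smult p_def w_def
        mult_zero_right add_0_right)
    finally show ?thesis using c by simp
  qed
  \<comment> \<open>The witness; its coefficient of index k is irrelevant apart from being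
    smooth.\<close>
  define g where "g = (\<lambda>j (x :: 'a, z :: nat \<Rightarrow> real). lap_poly X u (p j) x)"
  have g: "smooth_fun W (g j)" for j
    unfolding g_def W_def
    by (rule smooth_fun_pullback[OF chart_dom_line_open[OF X] sphere_line_open smooth_lap_poly[OF X u]])
  have "harmonic_ext W G k (\<lambda>(x', _). u x') g"
    unfolding harmonic_ext_def
  proof (intro conjI allI impI ballI g)
    fix P assume "P \<in> topspace (mtop W)"
    then obtain x z where P: "P = (x, z)" "x \<in> topspace (mtop X)" "z \<in> topspace (nsphere l)"
      by (auto simp: top)
    show "g 0 P = (case P of (x', _) \<Rightarrow> u x')" by (simp add: P g_def p_def lap_poly_1)
    fix m assume m: "m < k - 1"
    have "ambient_laplacian_coeff W G k g m (x, z) =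
      2 * (real m + 1) * (real k - 1 - real m) * g (Suc m) (x, z) + lap_poly X u (amb_tail_poly (mdim X) l k m) x"
      by (rule coeff) (use P g m in \<open>auto simp: g_def\<close>)
    also have "\<dots> = 0"
    proof -
      have "2 * (real m + 1) * (real k - 1 - real m) \<noteq> 0" using m by auto
      then show ?thesis unfolding g_def p_def prod.case amb_poly_Suc lap_poly_smult by (rule mult_uminus_inverse)
    qed
    finally show "ambient_laplacian_coeff W G k g m P = 0" by (simp add: P)
  qed
  moreover have gr0: "G 0 = gcomp W"
    by (simp add: G_def W_def product_ambient_def)
  moreover have val: "ambient_laplacian_coeff W G k f (k - 1) (x, z) = lap_poly X u (amb_tail_poly (mdim X) l k (k - 1)) x"
    if h: "harmonic_ext W G k (\<lambda>(x', _). u x') f" for f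
  proof -
    have f: "smooth_fun W (f j)" if "j \<le> k" for j using h that by (auto simp: harmonic_ext_def)
    \<comment> \<open>The point stays arbitrary in the induction, since the Laplacians at the next
      order need the earlier coefficients on a whole chart domain.\<close>
    have eq: "f j (x, z) = lap_poly X u (p j) x"
      if "j < k" "x \<in> topspace (mtop X)" "z \<in> topspace (nsphere l)" for j x z
      using that
    proof (induction j arbitrary: x z rule: less_induct)
      case (less j)
      show ?case
      proof (cases j)
        case 0
        have "f 0 (x, z) = u x" using h less.prems by (auto simp: harmonic_ext_def top)
        then show ?thesis by (simp add: 0 p_def lap_poly_1)
      next
        case (Suc m)
        have nz: "real k - 1 - real m \<noteq> 0" "m < k - 1" "real m + 1 \<noteq> 0" using less.prems Suc by auto
        have "0 = ambient_laplacian_coeff W G k f m (x, z)"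
          using h nz less.prems by (auto simp: harmonic_ext_def top)
        also have "\<dots> = 2 * (real m + 1) * (real k - 1 - real m) * f (Suc m) (x, z) +
            lap_poly X u (amb_tail_poly (mdim X) l k m) x"
          by (rule coeff) (use f less Suc in auto)
        finally have "2 * (real m + 1) * (real k - 1 - real m) * f (Suc m) (x, z) =
            - lap_poly X u (amb_tail_poly (mdim X) l k m) x" by simp
        then have "f (Suc m) (x, z) = - inverse (2 * (real m + 1) * (real k - 1 - real m)) *
            lap_poly X u (amb_tail_poly (mdim X) l k m) x"
          by (rule eq_uminus_inverse_mult) (use nz in auto)
        then show ?thesis unfolding Suc p_def amb_poly_Suc lap_poly_smult .
      qed
    qed
    \<comment> \<open>The factor of \<open>f (Suc (k - 1))\<close>, about which nothing but
      smoothness is known, is zero.\<close>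
    have "ambient_laplacian_coeff W G k f (k - 1) (x, z) =
       2 * (real (k - 1) + 1) * (real k - 1 - real (k - 1)) * f (Suc (k - 1)) (x, z) +
         lap_poly X u (amb_tail_poly (mdim X) l k (k - 1)) x"
      by (rule coeff[OF f]) (use k eq x z in auto)
    then show ?thesis using k by (simp add: of_nat_diff)
  qed
  ultimately show ?thesis
    unfolding gjms_def W_def[symmetric] G_def[symmetric]
    by (intro the_equality) (auto simp: val intro!: exI[of _ g])
qed

end

section \<open>Identification of the factors and continuation in m\<close>

lemma nsphere_nonempty: "(\<lambda>i. if i = 0 then 1 else 0) \<in> topspace (nsphere l)"
proof -
  have "(\<Sum>i\<le>l. (if i = 0 then 1 else 0 :: real)\<^sup>2) = (\<Sum>i\<le>l. if i = 0 then 1 else 0)"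
    by (intro sum.cong) auto
  then show ?thesis by (simp add: topspace_nsphere)
qed

text \<open>Matches the degrees met by the successive Laplacians with the asserted factors, and the
  constants of \<open>obstruction_poly\<close> with the normalisation of
  \<open>gjms\<close>.\<close>

lemma obstruction_factors:
  fixes n k l :: nat
  assumes k: "k \<ge> 1"
  shows "(\<Prod>j\<leftarrow>[1..<k + 1]. [:- ((real n - real l + 2 * real k - 4 * real j + 3) * (real l + real n - 2 * real k + 4 * real j - 3) / 4), - 1:]) =
    smult (2 ^ k * (- ((fact (k - 1))\<^sup>2 / 2))) (amb_tail_poly (real (n + 1)) l k (k - 1))"
proof -
  define w where "w = (\<lambda>i. real k - (real (n + 1) + real l) / 2 - 2 * real i)"
  have "(\<Prod>j\<leftarrow>[1..<k + 1]. [:- ((real n - real l + 2 * real k - 4 * real j + 3) * (real l + real n - 2 * real k + 4 * real j - 3) / 4), - 1:])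
    = (\<Prod>j\<in>set [1..<k + 1]. [:- ((real n - real l + 2 * real k - 4 * real j + 3) * (real l + real n - 2 * real k + 4 * real j - 3) / 4), - 1:])"
    by (rule prod.distinct_set_conv_list[symmetric]) simp
  also have "\<dots> = (\<Prod>i<k. [:- ((real n - real l + 2 * real k - 4 * real (Suc i) + 3) * (real l + real n - 2 * real k + 4 * real (Suc i) - 3) / 4), - 1:])"
  proof -
    have "set [1..<k + 1] = {Suc 0..k}" by auto
    then show ?thesis by (simp only: prod.atLeast1_atMost_eq)
  qed
  \<comment> \<open>With j = i + 1 the two linear factors are 2 (w i + n) and - 2 w i.\<close>
  also have "\<dots> = (\<Prod>i<k. [:w i * (w i + n), - 1:])"
    by (intro prod.cong refl) (simp add: w_def field_simps)
  also have "\<dots> = smult ((- 1) ^ k) (\<Prod>i<k. [:- w i * (w i + real (n + 1) - 1), 1:])"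
  proof (rule poly_eq_poly_eq_iff[THEN iffD1], rule ext)
    fix y
    have "(\<Prod>i<k. w i * (w i + n) - y) = (\<Prod>i<k. - 1 * (y - w i * (w i + n)))" by simp
    also have "\<dots> = (- 1) ^ k * (\<Prod>i<k. y - w i * (w i + n))" by (simp only: prod.distrib prod_constant card_lessThan)
    finally show "poly (\<Prod>i<k. [:w i * (w i + n), - 1:]) y =
       poly (smult ((- 1) ^ k) (\<Prod>i<k. [:- w i * (w i + real (n + 1) - 1), 1:])) y"
      by (simp add: poly_prod)
  qed
  also have "\<dots> = smult ((- 1) ^ k * ((- 2) ^ (k - 1) * (fact (k - 1))\<^sup>2)) (amb_tail_poly (real (n + 1)) l k (k - 1))"
    using obstruction_poly[OF k, of "real (n + 1)" "real l"] by (simp add: w_def flip: smult_smult)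
  \<comment> \<open>(-1)^k (-2)^(k-1) = - 2^(k-1), the sign and power of 2 in the
    normalisation.\<close>
  also have "(- 1) ^ k * ((- 2) ^ (k - 1) * (fact (k - 1))\<^sup>2) = 2 ^ k * (- ((fact (k - 1))\<^sup>2 / 2) :: real)"
  proof -
    obtain k' where k': "k = Suc k'" using k by (cases k) auto
    have "(- 1 :: real) ^ k' * (- 2) ^ k' = 2 ^ k'" by (simp flip: power_mult_distrib)
    then show ?thesis by (simp add: k')
  qed
  finally show ?thesis .
qed

theorem theorem3p1:
  fixes X :: "('a, 'i) mfd" and n k :: nat and m :: real
  assumes "riemannian_manifold X"
    and "mdim X = n + 1"
    and "\<forall>i\<in>chart_index X. \<forall>p\<in>chart_dom X i. \<forall>a<n + 1. \<forall>b<n + 1.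
           ricci X i a b p = - real n * gcomp X i a b p"
    and "k \<ge> 1"
    and "m > 1 - real n"
  shows "\<forall>u. smooth_fun X u \<longrightarrow> (\<forall>x\<in>topspace (mtop X).
           weighted_gjms X (\<lambda>_. 1) (product_ambient X) k m u x =
           foldr (\<lambda>j w y. - laplacian X w y
               - (real n - m + 2 * real k - 4 * real j + 3) * (m + real n - 2 * real k + 4 * real j - 3) / 4 * w y)
             [1..<k + 1] u x)"
proof (intro allI impI ballI)
  fix u x assume u: "smooth_fun X u" and x: "x \<in> topspace (mtop X)"
  note X = assms(1)
  \<comment> \<open>The constant of the j-th factor as a polynomial in m.\<close>
  define C where "C = (\<lambda>j. smult (1 / 4) ([:real n + 2 * real k - 4 * real j + 3, - 1:] *
    [:real n - 2 * real k + 4 * real j - 3, 1:]))"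
  define R where "R = (\<lambda>m. \<Prod>j\<leftarrow>[1..<k + 1]. [:- poly (C j) m, - 1:])"
  have C: "poly (C j) m = (real n - m + 2 * real k - 4 * real j + 3) * (m + real n - 2 * real k + 4 * real j - 3) / 4" for j m
  proof -
    have e: "real n - m + 2 * real k - 4 * real j + 3 = (real n + 2 * real k - 4 * real j + 3) - m"
      "m + real n - 2 * real k + 4 * real j - 3 = (real n - 2 * real k + 4 * real j - 3) + m" by simp_all
    show ?thesis unfolding C_def e by (simp only: poly_smult poly_mult poly_pCons poly_0) simp
  qed
  obtain c where c: "\<And>i m. coeff (R m) i = poly (c i) m"
    using coeff_prod_list_poly[of C "[1..<k + 1]"] unfolding R_def by blast
  \<comment> \<open>For fixed u and x the iterated Laplacians are numbers, so the asserted right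
    side is this polynomial in m.\<close>
  define P where "P = (\<Sum>i\<le>k. smult ((laplacian X ^^ i) u x) (c i))"
  have P: "lap_poly X u (R m) x = poly P m" for m
  proof -
    have "degree (R m) \<le> length [1..<k + 1]" unfolding R_def by (rule degree_prod_list_linear)
    then have "lap_poly X u (R m) x = (\<Sum>i\<le>k. coeff (R m) i * (laplacian X ^^ i) u x)"
      by (intro lap_poly_eq) (simp only: length_upt diff_add_inverse2)
    then show ?thesis by (simp add: P_def c poly_sum mult.commute)
  qed
  have gjms: "gjms (warped_product X (\<lambda>_. 1) (round_sphere l)) (product_ambient X l) k (\<lambda>(x', _). u x') (x, z) = poly P (real l)"
    if "z \<in> topspace (nsphere l)" for l z
  proof -
    have R: "R (real l) = smult (2 ^ k * (- ((fact (k - 1))\<^sup>2 / 2))) (amb_tail_poly (real (n + 1)) l k (k - 1))"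
      unfolding R_def C by (rule obstruction_factors[OF assms(4)])
    show ?thesis
      unfolding P[symmetric] gjms_product[OF X u assms(4) x that] R assms(2) lap_poly_smult by (simp only: mult.assoc)
  qed
  have "weighted_gjms X (\<lambda>_. 1) (product_ambient X) k m u x = poly P m"
    unfolding weighted_gjms_def
  proof (rule the_equality)
    show "\<exists>P' Q. poly Q m \<noteq> 0 \<and>
     (\<forall>l\<ge>1. poly Q (real l) \<noteq> 0 \<longrightarrow> (\<forall>z\<in>topspace (mtop (round_sphere l)).
        gjms (warped_product X (\<lambda>_. 1) (round_sphere l)) (product_ambient X l) k (\<lambda>(x', _). u x') (x, z) =
          poly P' (real l) / poly Q (real l))) \<and> poly P m = poly P' m / poly Q m"
      by (rule exI[of _ P], rule exI[of _ 1]) (simp add: gjms)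
  next
    fix y assume "\<exists>P' Q. poly Q m \<noteq> 0 \<and>
     (\<forall>l\<ge>1. poly Q (real l) \<noteq> 0 \<longrightarrow> (\<forall>z\<in>topspace (mtop (round_sphere l)).
        gjms (warped_product X (\<lambda>_. 1) (round_sphere l)) (product_ambient X l) k (\<lambda>(x', _). u x') (x, z) =
          poly P' (real l) / poly Q (real l))) \<and> y = poly P' m / poly Q m"
    then obtain P' Q where Q: "poly Q m \<noteq> 0" and y: "y = poly P' m / poly Q m"
      and eq: "\<And>l. l \<ge> 1 \<Longrightarrow> poly Q (real l) \<noteq> 0 \<Longrightarrow> (\<forall>z\<in>topspace (nsphere l).
        gjms (warped_product X (\<lambda>_. 1) (round_sphere l)) (product_ambient X l) k (\<lambda>(x', _). u x') (x, z) =
          poly P' (real l) / poly Q (real l))" by auto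
    \<comment> \<open>The extra factor Q makes the equation hold also at integers where Q vanishes
      and nothing is prescribed; having all positive integers as roots, the polynomial is
      zero.\<close>
    have "poly ((P' - P * Q) * Q) (real l) = 0" if "l \<ge> 1" for l
    proof (cases "poly Q (real l) = 0")
      case False
      then have "poly P (real l) = poly P' (real l) / poly Q (real l)"
        using eq[OF that False] gjms[OF nsphere_nonempty] nsphere_nonempty by metis
      then show ?thesis using False by (simp add: field_simps)
    qed simp
    then have "real ` {1..} \<subseteq> {r. poly ((P' - P * Q) * Q) r = 0}" by auto
    moreover have "infinite (real ` {1..})"
      by (simp add: finite_image_iff inj_on_def infinite_Ici)
    ultimately have "(P' - P * Q) * Q = 0"
      using poly_roots_finite finite_subset by blast
    then have "P' = P * Q" using Q by auto
    then show "y = poly P m" using Q y by simp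
  qed
  also have "\<dots> = foldr (\<lambda>j w y. - laplacian X w y
               - (real n - m + 2 * real k - 4 * real j + 3) * (m + real n - 2 * real k + 4 * real j - 3) / 4 * w y)
             [1..<k + 1] u x"
    unfolding foldr_lap_poly[OF X u x] P[symmetric] R_def C ..
  finally show "weighted_gjms X (\<lambda>_. 1) (product_ambient X) k m u x = \<dots>" .
qed

end
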